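(* Every graph with minimum degree at least $3$ on at most $23$ vertices contains a cycle of length $4$ or a cycle of length $8$.
   Context: Graphs are finite, simple, undirected, with nonempty vertex set. A cycle of length $\ell$ is a (not necessarily induced) subgraph that is a simple cycle on $\ell$ vertices. *)

theory Defs
  imports "Graph_Theory.Arc_Walk"
begin

text \<open>
  A finite simple undirected graph is a \<^locale>\<open>graph\<close> of the library, i.e. a finite,
  loop-free, symmetric digraph without parallel arcs: every edge is represented by two opposite
  arcs. The number of arcs leaving a vertex is therefore its degree. The null graph is not
  excluded by the locale, and \<^const>\<open>Min\<close> is unspecified on the empty set, so
  non-emptiness of the vertex set has to be assumed separately.
\<close>

definition min_degree :: "('a, 'b) pre_digraph \<Rightarrow> nat" where
  "min_degree G = Min (out_degree G ` verts G)"

text \<open>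
  The library also counts the walk along an edge and back as a cycle (of length 2), which is not
  a cycle of an undirected graph; the bound \<open>3 \<le> l\<close> excludes it. From length 3 on, a closed walk
  without repeated vertices runs exactly once around a cycle subgraph.
\<close>

definition has_cycle_of_length :: "('a, 'b) pre_digraph \<Rightarrow> nat \<Rightarrow> bool" where
  "has_cycle_of_length G l \<longleftrightarrow> 3 \<le> l \<and> (\<exists>p. pre_digraph.cycle G p \<and> length p = l)"

end

theory Submission
  imports Defs
begin

text \<open>
  A graph without the required cycles is explored through partial subgraphs: a vertex that has fewer
  than three known neighbours is joined either to a known vertex, or to a new one as long as there
  are at most 23 vertices. A known vertex is impossible if a path of length 3 or 7 leads there, as
  the new edge would close a 4- or 8-cycle. The search is small because degrees are not bounded from
  above, so that a refuted partial graph is a subgraph that cannot occur anywhere: every later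
  partial graph that contains a copy of it can be discarded. With this rule, which also takes care of
  symmetries, fewer than 4000 partial graphs remain. The search tree is given as a certificate, which
  a verified checker, executed by the simplifier, replays.
\<close>

section \<open>Certificates\<close>

text \<open>The top of the search is a case distinction by the length of a shortest cycle. A
  breadth-first tree is grown from one vertex, and the first refutations forbid a triangle, then a
  5-cycle, then a 6-cycle in all that follows. The saved patterns contain some pendant edges besides
  the short cycle; since the minimum degree supplies these, one small pattern excludes every
  occurrence of the cycle. What remains is girth at least 7. There the tree of depth 3 has 1 + 3 + 6
  + 12 = 22 vertices, so that at most one vertex lies outside of it and the search ends quickly. The
  bulk of the certificate deals with short cycles, where many sparse extensions have to be told
  apart. A pattern is refuted relative to one fixed hypothetical counterexample, whatever number of
  vertices the search had in use at that point. Hence patterns move freely between branches, and the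
  order of the branches decides how much they help.\<close>

text \<open>Entry \<open>i\<close> of the flags tells whether an endpoint of a path with
  \<open>i + 1\<close> vertices, the first of them in \<open>xs\<close>, is struck from
  \<open>ts\<close>. The marks \<open>vis\<close> are passed unchanged to the siblings of
  \<open>x\<close>: they describe the current path, not all vertices seen so far, because every
  simple path of the right length matters and not only the shortest ones.\<close>

fun reach :: "bool list \<Rightarrow> ('v \<Rightarrow> 'v list) \<Rightarrow> ('v \<Rightarrow> bool) \<Rightarrow> 'v list \<Rightarrow> 'v list \<Rightarrow> 'v list" where
  "reach bs e vis xs [] = []"
| "reach [] e vis xs ts = ts"
| "reach (b # bs) e vis [] ts = ts"
| "reach (b # bs) e vis (x # xs) ts =
    (if vis x then reach (b # bs) e vis xs ts
     else reach (b # bs) e vis xs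
       (reach bs e (vis(x := True)) (e x) (if b then remove1 x ts else ts)))"

text \<open>A constant function with a name that rewriting does not unfold, so that its first update
  can be turned into an explicit table.\<close>

definition blank :: "'a \<Rightarrow> 'v \<Rightarrow> 'a" where
  "blank x = (\<lambda>_. x)"

lemma blank_apply [simp]: "blank x v = x"
  by (simp add: blank_def)

text \<open>Membership as a function: it becomes a table of truth values, and a query is a single
  lookup instead of a scan of the list.\<close>

fun mark :: "'v list \<Rightarrow> 'v \<Rightarrow> bool" where
  "mark [] = blank False"
| "mark (v # vs) = (mark vs)(v := True)"

text \<open>\<open>free\<close> starts as the characteristic function of the vertices in use and
  loses every vertex that is assigned. One lookup thus tests both that the target exists and that
  the map stays injective.\<close>

fun place :: "'v list \<Rightarrow> 'v list \<Rightarrow> ('v \<Rightarrow> bool) \<Rightarrow> ('v \<Rightarrow> 'v) \<Rightarrow> ('v \<Rightarrow> 'v) option" where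
  "place [] [] free g = Some g"
| "place (u # us) (x # xs) free g = (if free x then place us xs (free(x := False)) (g(u := x)) else None)"
| "place _ _ _ _ = None"

fun nbrs_ok :: "('v \<Rightarrow> 'v) \<Rightarrow> 'v list \<Rightarrow> 'v list \<Rightarrow> bool" where
  "nbrs_ok g ns [] = True"
| "nbrs_ok g ns (y # ys) \<longleftrightarrow> g y \<in> set ns \<and> nbrs_ok g ns ys"

fun hom_ok :: "('v \<Rightarrow> 'v) \<Rightarrow> ('v \<Rightarrow> 'v list) \<Rightarrow> ('v \<Rightarrow> 'v list) \<Rightarrow> 'v list \<Rightarrow> bool" where
  "hom_ok g q e [] = True"
| "hom_ok g q e (u # us) \<longleftrightarrow> nbrs_ok g (e (g u)) (q u) \<and> hom_ok g q e us"

type_synonym 'v pattern = "'v list \<times> ('v \<Rightarrow> 'v list)"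

text \<open>The certificate supplies the copy \<open>xs\<close>, so there is no subgraph search,
  only a test. The copy may have additional edges: patterns are subgraphs, not induced ones.\<close>

fun occurs :: "'v pattern \<Rightarrow> 'v list \<Rightarrow> 'v list \<Rightarrow> ('v \<Rightarrow> 'v list) \<Rightarrow> bool" where
  "occurs (us, q) xs vs e =
    (case place us xs (mark vs) (blank undefined) of None \<Rightarrow> False | Some g \<Rightarrow> hom_ok g q e us)"

text \<open>Matching on constructors decides \<open>length xs < 3\<close> without
  arithmetic.\<close>

fun few :: "'a list \<Rightarrow> bool" where
  "few [] = True"
| "few [x] = True"
| "few [x, y] = True"
| "few (x # y # z # xs) = False"

text \<open>The change of the candidate lists when a new vertex \<open>x\<close> is attached to
  \<open>u\<close>: every vertex may turn out to be adjacent to \<open>x\<close>, and none is a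
  candidate for \<open>u\<close> any more, since all candidates of \<open>u\<close> among the old
  vertices have been refuted by then.\<close>

definition widen :: "'v \<Rightarrow> 'v \<Rightarrow> ('v \<Rightarrow> 'v list) \<Rightarrow> 'v \<Rightarrow> 'v list" where
  "widen x u p = (\<lambda>v. x # remove1 u (p v))"

text \<open>
  A state consists of the vertices \<open>vs\<close> in use, the unused vertices \<open>fs\<close>, the adjacency lists \<open>e\<close>
  of a partial subgraph, and for each vertex \<open>v\<close> the list \<open>p v\<close> of those vertices that are still
  possible as further neighbours of \<open>v\<close>; \<open>k\<close> is a store of patterns known not to occur.
  \<open>Known i j xs\<close> finds the pattern stored at \<open>(i, j)\<close> at the vertices \<open>xs\<close>, \<open>Save i j c\<close> stores
  the state refuted by \<open>c\<close>, and \<open>Row u cs\<close> branches over the next neighbour of \<open>u\<close>: first the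
  remaining candidates, then an unused vertex. A list \<open>cs\<close> that ends early claims that too few
  candidates are left for \<open>u\<close> to get degree 3.
\<close>

datatype 'v cert =
    Known 'v 'v "'v list"
  | Save 'v 'v "'v cert"
  | Row 'v "'v cert list"

text \<open>The store is threaded through the whole run, so that a pattern saved deep inside one
  branch is available in all later ones. Once the edge between \<open>u\<close> and \<open>r\<close>
  is refuted, \<open>r\<close> leaves the candidates of \<open>u\<close> and \<open>u\<close> those
  of \<open>r\<close>, so the later siblings start with more negative information.\<close>

fun check :: "'v cert \<Rightarrow> 'v list \<Rightarrow> 'v list \<Rightarrow> ('v \<Rightarrow> 'v list) \<Rightarrow> ('v \<Rightarrow> 'v list) \<Rightarrow>
    ('v \<Rightarrow> 'v \<Rightarrow> 'v pattern) \<Rightarrow> ('v \<Rightarrow> 'v \<Rightarrow> 'v pattern) option"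
  and branch :: "'v \<Rightarrow> 'v list \<Rightarrow> 'v cert list \<Rightarrow> 'v list \<Rightarrow> 'v list \<Rightarrow> ('v \<Rightarrow> 'v list) \<Rightarrow>
    ('v \<Rightarrow> 'v list) \<Rightarrow> ('v \<Rightarrow> 'v \<Rightarrow> 'v pattern) \<Rightarrow> ('v \<Rightarrow> 'v \<Rightarrow> 'v pattern) option" where
  "check (Known a b xs) vs fs e p k = (if occurs (k a b) xs vs e then Some k else None)"
| "check (Save a b c) vs fs e p k =
    (case check c vs fs e p k of None \<Rightarrow> None | Some k' \<Rightarrow> Some (k'(a := (k' a)(b := (vs, e)))))"
| "check (Row u cs) vs fs e p k =
    (if u \<in> set vs \<and> few (e u)
     then branch u (reach [False, False, True, False, False, False, True] e (mark [u]) (e u) (p u)) cs vs fs e p k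
     else None)"
| "branch u rs [] vs fs e p k = (if few (e u @ rs @ fs) then Some k else None)"
| "branch u (r # rs) (c # cs) vs fs e p k =
    (case check c vs fs (e(u := r # e u, r := u # e r)) (p(u := rs, r := remove1 u (p r))) k of
      None \<Rightarrow> None
    | Some k' \<Rightarrow> branch u rs cs vs fs e (p(r := remove1 u (p r))) k')"
| "branch u [] (c # cs) vs (x # fs) e p k =
    check c (x # vs) fs (e(x := [u], u := x # e u)) ((widen x u p)(u := [], x := remove1 u vs)) k"
| "branch u [] (c # cs) vs [] e p k = None"

section \<open>Soundness of the checker\<close>

text \<open>Only removals need a justification: candidates that are left in the list cost time, not
  soundness. The witness \<open>ys\<close> omits the starting vertex of the path, so its length is
  the number of edges when the path is started at a vertex with neighbours
  \<open>xs\<close>.\<close>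

lemma reach_removed:
  assumes "t \<in> set ts" and "t \<notin> set (reach bs e vis xs ts)"
  shows "\<exists>ys. ys \<noteq> [] \<and> distinct ys \<and> (\<forall>y \<in> set ys. \<not> vis y) \<and> hd ys \<in> set xs \<and> last ys = t \<and>
    successively (\<lambda>x y. y \<in> set (e x)) ys \<and> length ys \<le> length bs \<and> bs ! (length ys - 1)"
  using assms
proof (induction bs e vis xs ts rule: reach.induct)
  case (4 b bs e vis x xs t' ts')
  let ?ts = "t' # ts'"
  let ?first = "if b then remove1 x ?ts else ?ts"
  let ?inner = "reach bs e (vis(x := True)) (e x) ?first"
  show ?case
  proof (cases "vis x")
    case True
    with 4(1)[OF True 4(4)] 4(5) show ?thesis by force
  next
    case False
    \<comment> \<open>\<open>t\<close> is lost among the later siblings of \<open>x\<close>, or at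
      \<open>x\<close> itself, or below \<open>x\<close>.\<close>
    consider "t \<in> set ?inner" | "t \<notin> set ?first" | "t \<in> set ?first" "t \<notin> set ?inner"
      by blast
    then show ?thesis
    proof cases
      case 1
      with 4(3)[OF False 1] 4(5) False show ?thesis by force
    next
      case 2
      with 4(4) have "b" "t = x"
        by (metis, metis in_set_remove1)
      with False show ?thesis by (intro exI[of _ "[x]"]) auto
    next
      case 3
      from 4(2)[OF False 3] obtain ys where ys: "ys \<noteq> []" "distinct ys"
        "\<forall>y \<in> set ys. \<not> (vis(x := True)) y" "hd ys \<in> set (e x)" "last ys = t"
        "successively (\<lambda>x y. y \<in> set (e x)) ys" "length ys \<le> length bs" "bs ! (length ys - 1)"
        by blast
      from ys(3) have "x \<notin> set ys" and "\<forall>y \<in> set ys. \<not> vis y"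
        by (auto split: if_splits)
      with ys False show ?thesis
        by (intro exI[of _ "x # ys"]) (auto simp: successively_Cons)
    qed
  qed
qed auto

lemma set_reach: "set (reach bs e vis xs ts) \<subseteq> set ts"
proof (induction bs e vis xs ts rule: reach.induct)
  case (4 b bs e vis x xs t ts)
  have "set (if b then remove1 x (t # ts) else t # ts) \<subseteq> set (t # ts)"
    using set_remove1_subset[of x "t # ts"] by simp
  show ?case
  proof (cases "vis x")
    case True
    with 4(1) show ?thesis by simp
  next
    case False
    show ?thesis
      using False \<open>_ \<subseteq> set (t # ts)\<close> 4(2,3)[OF False] by (simp only: reach.simps if_False)
  qed
qed auto

lemma mark_iff [simp]: "mark vs v \<longleftrightarrow> v \<in> set vs"
  by (induction vs) auto

text \<open>A vertex placed later finds \<open>x\<close> no longer free, which gives injectivity.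
  The last conjunct makes the induction work: it identifies \<open>h u\<close> with the value
  \<open>x\<close> assigned first.\<close>

lemma place_SomeD:
  assumes "place us xs free g = Some h"
  shows "inj_on h (set us) \<and> (\<forall>u \<in> set us. free (h u)) \<and> (\<forall>u. u \<notin> set us \<longrightarrow> h u = g u)"
  using assms
proof (induction us xs free g rule: place.induct)
  case (2 u us x xs free g)
  from 2(2) have "free x" and "place us xs (free(x := False)) (g(u := x)) = Some h"
    by (simp_all split: if_splits)
  from 2(1)[OF this] have h: "inj_on h (set us)" "\<forall>u \<in> set us. (free(x := False)) (h u)"
    "\<forall>v. v \<notin> set us \<longrightarrow> h v = (g(u := x)) v"
    by blast+
  from h(2) have h_us: "h v \<noteq> x" "free (h v)" if "v \<in> set us" for v
    using that by (auto split: if_splits)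
  have h_u: "h u = x" if "u \<notin> set us"
    using h(3) that by simp
  have "inj_on h (insert u (set us))"
  proof (cases "u \<in> set us")
    case True
    with h(1) show ?thesis by (simp add: insert_absorb)
  next
    case False
    have "h u \<notin> h ` set us"
    proof
      assume "h u \<in> h ` set us"
      then obtain v where "v \<in> set us" and "h v = h u" by auto
      with h_us(1)[of v] h_u[OF False] show False by simp
    qed
    with False h(1) show ?thesis by (simp add: inj_on_insert)
  qed
  moreover have "free (h v)" if "v \<in> insert u (set us)" for v
    using that h_us(2) h_u \<open>free x\<close> by (cases "v \<in> set us") auto
  ultimately have "inj_on h (set (u # us))" "\<forall>v \<in> set (u # us). free (h v)"
    by auto
  with h(3) show ?case by simp
qed auto

lemma nbrs_ok_iff [simp]: "nbrs_ok g ns ys \<longleftrightarrow> (\<forall>y \<in> set ys. g y \<in> set ns)"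
  by (induction ys) auto

lemma hom_ok_iff [simp]: "hom_ok g q e us \<longleftrightarrow> (\<forall>u \<in> set us. \<forall>y \<in> set (q u). g y \<in> set (e (g u)))"
  by (induction us) auto

lemma few_iff: "few xs \<longleftrightarrow> length xs < 3"
  by (induction xs rule: few.induct) auto

section \<open>Embeddings of partial graphs into a hypothetical counterexample\<close>

text \<open>Only vertices and adjacency are kept, without arcs. Cycles are given as vertex lists
  with a closing edge, which is the form in which the path search produces them.\<close>

locale counterexample =
  fixes V :: "'b set" and adj :: "'b \<Rightarrow> 'b \<Rightarrow> bool"
  assumes finite_V: "finite V"
    and adj_in_V: "adj x y \<Longrightarrow> y \<in> V"
    and adj_sym: "adj x y \<Longrightarrow> adj y x"
    and adj_irrefl: "\<not> adj x x"
    and degree: "x \<in> V \<Longrightarrow> 3 \<le> card {y. adj x y}"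
    and no_cycle: "length ys \<in> {4, 8} \<Longrightarrow> distinct ys \<Longrightarrow> successively adj ys \<Longrightarrow> \<not> adj (last ys) (hd ys)"
begin

definition embeds :: "('v \<Rightarrow> 'b) \<Rightarrow> 'v list \<Rightarrow> ('v \<Rightarrow> 'v list) \<Rightarrow> bool" where
  "embeds f vs e \<longleftrightarrow> inj_on f (set vs) \<and> f ` set vs \<subseteq> V \<and>
    (\<forall>v \<in> set vs. \<forall>w \<in> set (e v). adj (f v) (f w))"

text \<open>
  The negative information in \<open>p\<close> holds for every embedding of the current partial graph, not just
  for a fixed one. This is what makes a refuted state reusable as a pattern, at any place.
\<close>

definition refuted :: "'v pattern \<Rightarrow> bool" where
  "refuted q \<longleftrightarrow> (\<forall>f. \<not> embeds f (fst q) (snd q))"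

definition nonadj :: "'v list \<Rightarrow> ('v \<Rightarrow> 'v list) \<Rightarrow> 'v \<Rightarrow> 'v list \<Rightarrow> bool" where
  "nonadj vs e v ws \<longleftrightarrow>
    (\<forall>f w. embeds f vs e \<longrightarrow> w \<in> set vs \<longrightarrow> adj (f v) (f w) \<longrightarrow> w \<in> set (e v) \<union> set ws)"

text \<open>The bound on the number of vertices is carried by
  \<open>card V \<le> length (vs @ fs)\<close>. It is invariant because a new vertex merely moves
  from \<open>fs\<close> to \<open>vs\<close>, and it says that at most \<open>length fs\<close>
  vertices of \<open>V\<close> lie outside the image of an embedding.\<close>

definition state_ok :: "'v list \<Rightarrow> 'v list \<Rightarrow> ('v \<Rightarrow> 'v list) \<Rightarrow> ('v \<Rightarrow> 'v list) \<Rightarrow> bool" where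
  "state_ok vs fs e p \<longleftrightarrow> distinct (vs @ fs) \<and> card V \<le> length (vs @ fs) \<and>
    (\<forall>v \<in> set vs. set (e v) \<subseteq> set vs \<and> set (p v) \<subseteq> set vs \<and> nonadj vs e v (p v)) \<and>
    (\<forall>v \<in> set vs. \<forall>w \<in> set vs. w \<in> set (e v) \<longrightarrow> v \<in> set (e w))"

lemma state_okI:
  assumes "distinct (vs @ fs)" and "card V \<le> length (vs @ fs)"
    and "\<And>v w. v \<in> set vs \<Longrightarrow> w \<in> set (e v) \<Longrightarrow> w \<in> set vs"
    and "\<And>v. v \<in> set vs \<Longrightarrow> set (p v) \<subseteq> set vs"
    and "\<And>v. v \<in> set vs \<Longrightarrow> nonadj vs e v (p v)"
    and "\<And>v w. v \<in> set vs \<Longrightarrow> w \<in> set (e v) \<Longrightarrow> v \<in> set (e w)"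
  shows "state_ok vs fs e p"
  using assms unfolding state_ok_def by blast

lemma state_okD:
  assumes "state_ok vs fs e p"
  shows "distinct (vs @ fs)" and "card V \<le> length (vs @ fs)"
    and "v \<in> set vs \<Longrightarrow> w \<in> set (e v) \<Longrightarrow> w \<in> set vs"
    and "v \<in> set vs \<Longrightarrow> set (p v) \<subseteq> set vs"
    and "v \<in> set vs \<Longrightarrow> nonadj vs e v (p v)"
    and "v \<in> set vs \<Longrightarrow> w \<in> set (e v) \<Longrightarrow> v \<in> set (e w)"
  using assms unfolding state_ok_def by blast+

lemma nonadjD:
  "nonadj vs e v ws \<Longrightarrow> embeds f vs e \<Longrightarrow> w \<in> set vs \<Longrightarrow> adj (f v) (f w) \<Longrightarrow> w \<in> set (e v) \<union> set ws"
  by (simp add: nonadj_def)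

lemma embedsD:
  assumes "embeds f vs e"
  shows "inj_on f (set vs)" and "v \<in> set vs \<Longrightarrow> f v \<in> V"
    and "v \<in> set vs \<Longrightarrow> w \<in> set (e v) \<Longrightarrow> adj (f v) (f w)"
  using assms unfolding embeds_def by auto

text \<open>Embeddings restrict to subgraphs. Therefore negative information about a partial graph
  is inherited by all its extensions.\<close>

lemma embeds_mono:
  assumes "embeds f vs' e'" and "set vs \<subseteq> set vs'" and "\<And>v. v \<in> set vs \<Longrightarrow> set (e v) \<subseteq> set (e' v)"
  shows "embeds f vs e"
  using assms unfolding embeds_def by (blast intro: inj_on_subset)

text \<open>The composition of an embedding of the state with the placement of the pattern would
  embed the pattern.\<close>

lemma occurs_refuted:
  assumes "occurs q xs vs e" and "refuted q"
  shows "\<not> embeds f vs e"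
proof
  assume f: "embeds f vs e"
  obtain us e' where q: "q = (us, e')" by (cases q)
  with assms(1) obtain g where "place us xs (mark vs) (blank undefined) = Some g"
    and hom: "\<forall>u \<in> set us. \<forall>y \<in> set (e' u). g y \<in> set (e (g u))"
    by (auto split: option.splits)
  from place_SomeD[OF this(1)] have "inj_on g (set us)" and "g ` set us \<subseteq> set vs"
    by auto
  note g = this
  have "inj_on (f \<circ> g) (set us)"
    by (rule comp_inj_on[OF g(1) inj_on_subset[OF embedsD(1)[OF f] g(2)]])
  moreover have "f (g u) \<in> V" if "u \<in> set us" for u
    using embedsD(2)[OF f] g(2) that by blast
  moreover have "adj (f (g u)) (f (g y))" if "u \<in> set us" "y \<in> set (e' u)" for u y
    using embedsD(3)[OF f] g(2) hom that by blast
  ultimately have "embeds (f \<circ> g) us e'"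
    unfolding embeds_def by auto
  with assms(2) q show False by (simp add: refuted_def)
qed

section \<open>Forbidden edges and the degree bound\<close>

text \<open>By injectivity, a path with 3 or 7 edges is mapped to a path on 4 or 8 vertices; an edge
  between its ends would close a forbidden cycle.\<close>

lemma closed_path:
  assumes f: "embeds f vs e" and vs: "\<forall>v \<in> set vs. set (e v) \<subseteq> set vs" and "u \<in> set vs"
    and ys: "ys \<noteq> []" "distinct (u # ys)" "successively (\<lambda>x y. y \<in> set (e x)) (u # ys)"
    and len: "length ys \<in> {3, 7}"
  shows "\<not> adj (f u) (f (last ys))"
proof -
  have sub: "set (u # ys) \<subseteq> set vs" "successively adj (map f (u # ys))"
    using \<open>u \<in> set vs\<close> ys(3)
  proof (induction ys arbitrary: u)
    case (Cons y ys)
    { case 1 then show ?case using Cons.IH(1)[of y] vs by simp blast }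
    { case 2 then have "y \<in> set vs" "adj (f u) (f y)" using vs embedsD(3)[OF f] by auto
      with 2 show ?case using Cons.IH(2)[of y] by simp }
  qed auto
  have "distinct (map f (u # ys))"
    unfolding distinct_map using ys(2) inj_on_subset[OF embedsD(1)[OF f] sub(1)] by blast
  with no_cycle[of "map f (u # ys)"] sub(2) len ys(1) have "\<not> adj (f (last ys)) (f u)"
    by (auto simp: last_map)
  then show ?thesis using adj_sym by blast
qed

lemma nonadj_reach:
  assumes ok: "state_ok vs fs e p" and u: "u \<in> set vs"
  shows "nonadj vs e u (reach [False, False, True, False, False, False, True] e (mark [u]) (e u) (p u))"
    (is "nonadj vs e u ?rs")
  unfolding nonadj_def
proof (intro allI impI)
  fix f w assume f: "embeds f vs e" and w: "w \<in> set vs" and adj: "adj (f u) (f w)"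
  from nonadjD[OF state_okD(5)[OF ok u] f w adj] have "w \<in> set (e u) \<union> set (p u)" .
  moreover have "w \<in> set ?rs" if "w \<in> set (p u)"
  proof (rule ccontr)
    assume "w \<notin> set ?rs"
    from reach_removed[OF that this] obtain ys where ys: "ys \<noteq> []" "distinct ys"
      "\<forall>y \<in> set ys. \<not> mark [u] y" "hd ys \<in> set (e u)" "last ys = w"
      "successively (\<lambda>x y. y \<in> set (e x)) ys" "length ys \<le> 7"
      "[False, False, True, False, False, False, True] ! (length ys - 1)"
      by auto
    \<comment> \<open>The flags are \<open>True\<close> at positions 2 and 6 only.\<close>
    from ys(1,7,8) have "length ys \<in> {3, 7}"
      by (auto simp: nth_Cons' split: if_splits)
    moreover from ys(3) have "u \<notin> set ys" by (metis mark_iff list.set_intros(1))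
    moreover have "\<forall>v \<in> set vs. set (e v) \<subseteq> set vs" using state_okD(3)[OF ok] by blast
    ultimately show False
      using closed_path[OF f _ u ys(1)] ys(2,4,5,6) adj by (simp add: successively_Cons)
  qed
  ultimately show "w \<in> set (e u) \<union> set ?rs" by blast
qed

text \<open>A neighbour of \<open>f u\<close> is the image of a known neighbour, the image of a
  candidate, or a vertex outside the image of \<open>vs\<close>. For the last kind the count of
  \<open>V\<close> leaves at most \<open>length fs\<close> vertices. This justifies the early end of
  a list of certificates.\<close>

lemma neighbours_bound:
  assumes ok: "state_ok vs fs e p" and u: "u \<in> set vs" and rs: "nonadj vs e u rs"
    and f: "embeds f vs e"
  shows "3 \<le> length (e u @ rs @ fs)"
proof -
  let ?N = "{y. adj (f u) y}"
  have inj: "inj_on f (set vs)" and V: "f ` set vs \<subseteq> V" using f by (auto simp: embeds_def)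
  have "?N \<subseteq> f ` set (e u @ rs) \<union> (V - f ` set vs)"
    using nonadjD[OF rs f] adj_in_V by auto
  then have "card ?N \<le> card (f ` set (e u @ rs) \<union> (V - f ` set vs))"
    by (intro card_mono) (auto simp: finite_V)
  also have "\<dots> \<le> card (f ` set (e u @ rs)) + card (V - f ` set vs)"
    by (rule card_Un_le)
  also have "card (f ` set (e u @ rs)) \<le> length (e u @ rs)"
    by (metis card_image_le card_length finite_set le_trans)
  also have "card (V - f ` set vs) = card V - length vs"
    using V inj state_okD(1)[OF ok] by (simp add: card_Diff_subset card_image distinct_card)
  also have "\<dots> \<le> length fs"
    using state_okD(2)[OF ok] by simp
  finally show ?thesis using degree[of "f u"] u V by auto
qed

section \<open>The moves of the search preserve the invariant\<close>

text \<open>The new edge merely moves \<open>r\<close> from the candidates of \<open>u\<close> to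
  its neighbours, and conversely; all other information is inherited. For \<open>u\<close> itself
  the list \<open>r # rs\<close> is used in place of \<open>p u\<close>, as it already takes the
  path search and the refuted siblings into account.\<close>

lemma state_ok_edge:
  assumes ok: "state_ok vs fs e p" and u: "u \<in> set vs" and r: "r \<in> set vs" and rs: "set rs \<subseteq> set vs"
    and non: "nonadj vs e u (r # rs)"
  shows "state_ok vs fs (e(u := r # e u, r := u # e r)) (p(u := rs, r := remove1 u (p r)))"
    (is "state_ok vs fs ?e ?p")
proof (rule state_okI)
  fix v assume v: "v \<in> set vs"
  show "nonadj vs ?e v (?p v)"
    unfolding nonadj_def
  proof (intro allI impI)
    fix f w assume f: "embeds f vs ?e" and w: "w \<in> set vs" and adj: "adj (f v) (f w)"
    have "w \<noteq> v" using adj adj_irrefl by auto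
    have emb: "embeds f vs e" using f by (rule embeds_mono) auto
    have "w \<in> set (e v) \<union> set (p v)" "v = u \<Longrightarrow> w \<in> set (e v) \<union> set (r # rs)"
      using nonadjD[OF state_okD(5)[OF ok v] emb w adj] nonadjD[OF non emb w] adj by auto
    with \<open>w \<noteq> v\<close> show "w \<in> set (?e v) \<union> set (?p v)" by auto
  qed
  show "set (?p v) \<subseteq> set vs"
    using state_okD(4)[OF ok v] state_okD(4)[OF ok r] rs set_remove1_subset[of u "p r"]
    by (auto split: if_splits)
  fix w assume w: "w \<in> set (?e v)"
  then show "w \<in> set vs"
    using state_okD(3)[OF ok v] u r by (auto split: if_splits)
  show "v \<in> set (?e w)"
    using w state_okD(6)[OF ok v, of w] by (auto split: if_splits)
qed (use state_okD(1,2)[OF ok] in auto)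

text \<open>An embedding that makes \<open>u\<close> and \<open>r\<close> adjacent would embed the
  graph with the added edge. As that graph has no embedding at all, the edge is excluded for every
  embedding of the present state.\<close>

lemma state_ok_skip:
  assumes ok: "state_ok vs fs e p" and u: "u \<in> set vs" and r: "r \<in> set vs"
    and ref: "refuted (vs, e(u := r # e u, r := u # e r))"
  shows "state_ok vs fs e (p(r := remove1 u (p r)))" and "nonadj vs e u (r # rs) \<Longrightarrow> nonadj vs e u rs"
proof -
  have no: "\<not> adj (f u) (f r)" if f: "embeds f vs e" for f
  proof
    assume "adj (f u) (f r)"
    with f adj_sym[OF this] have "embeds f vs (e(u := r # e u, r := u # e r))"
      by (auto simp: embeds_def)
    with ref show False by (simp add: refuted_def)
  qed
  show "nonadj vs e u (r # rs) \<Longrightarrow> nonadj vs e u rs"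
    using no by (auto simp: nonadj_def)
  show "state_ok vs fs e (p(r := remove1 u (p r)))" (is "state_ok vs fs e ?p")
  proof (rule state_okI)
    fix v assume v: "v \<in> set vs"
    show "set (?p v) \<subseteq> set vs"
      using state_okD(4)[OF ok v] set_remove1_subset[of u "p r"] by auto
    show "nonadj vs e v (?p v)"
      unfolding nonadj_def
    proof (intro allI impI)
      fix f w assume f: "embeds f vs e" and w: "w \<in> set vs" and adj: "adj (f v) (f w)"
      have "w \<noteq> u" if "v = r" using no[OF f] adj_sym[OF adj] that by auto
      with nonadjD[OF state_okD(5)[OF ok v] f w adj] show "w \<in> set (e v) \<union> set (?p v)"
        by auto
    qed
  qed (blast intro: state_okD(1-3,6)[OF ok])+
qed

text \<open>The hypothesis on \<open>u\<close> says that all its adjacencies within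
  \<open>vs\<close> are recorded in \<open>e u\<close>. This is what permits removing
  \<open>u\<close> from every other candidate list, including those from which no refutation has
  removed it.\<close>

lemma state_ok_new:
  assumes ok: "state_ok vs (x # fs) e p" and u: "u \<in> set vs" and non: "nonadj vs e u []"
  shows "state_ok (x # vs) fs (e(x := [u], u := x # e u)) ((widen x u p)(u := [], x := remove1 u vs))"
    (is "state_ok _ _ ?e ?p")
proof (rule state_okI)
  from state_okD(1)[OF ok] u have x: "x \<notin> set vs" "x \<noteq> u" by auto
  fix v assume v: "v \<in> set (x # vs)"
  show "set (?p v) \<subseteq> set (x # vs)"
    using v state_okD(4)[OF ok, of v] set_remove1_subset[of u vs] set_remove1_subset[of u "p v"]
    by (auto simp: widen_def)
  show "nonadj (x # vs) ?e v (?p v)"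
    unfolding nonadj_def
  proof (intro allI impI)
    fix f w assume f: "embeds f (x # vs) ?e" and w: "w \<in> set (x # vs)" and adj: "adj (f v) (f w)"
    have "w \<noteq> v" using adj adj_irrefl by auto
    have emb: "embeds f vs e" using f x by (auto intro: embeds_mono)
    consider "v = x" | "w = x" | "v \<in> set vs" "w \<in> set vs" "v = u" | "v \<in> set vs" "w \<in> set vs" "v \<noteq> u"
      using v w by auto
    then show "w \<in> set (?e v) \<union> set (?p v)"
    proof cases
      case 3
      with nonadjD[OF non emb] adj have "w \<in> set (e u)" by auto
      with 3 x show ?thesis by auto
    next
      case 4
      from nonadjD[OF state_okD(5)[OF ok 4(1)] emb 4(2) adj] have *: "w \<in> set (e v) \<union> set (p v)" .
      \<comment> \<open>Striking \<open>u\<close> from \<open>p v\<close> loses nothing: seen from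
        \<open>u\<close>, the adjacency is already a recorded edge, and edges are recorded at both
        ends.\<close>
      have "u \<in> set (e v)" if "w = u"
      proof -
        from adj_sym[OF adj] that have "adj (f u) (f v)" by simp
        with nonadjD[OF non emb 4(1)] have "v \<in> set (e u)" by auto
        with state_okD(6)[OF ok u] show ?thesis by blast
      qed
      with * 4 x show ?thesis by (cases "w = u") (auto simp: widen_def)
    next
      case 1
      with w x \<open>w \<noteq> v\<close> show ?thesis by (cases "w = u") auto
    next
      case 2
      with x \<open>w \<noteq> v\<close> show ?thesis by (auto simp: widen_def)
    qed
  qed
  fix w assume w: "w \<in> set (?e v)"
  show "w \<in> set (x # vs)"
    using w v x u state_okD(3)[OF ok, of v w] by (auto split: if_splits)
  show "v \<in> set (?e w)"
    using w v x u state_okD(3,6)[OF ok, of v w] by (auto split: if_splits)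
qed (use state_okD(1,2)[OF ok] in auto)

text \<open>Given an embedding \<open>f\<close>, the vertex \<open>f u\<close> has a neighbour
  \<open>y\<close> other than the at most two images of \<open>e u\<close>. Since \<open>u\<close>
  has no further neighbour within \<open>vs\<close>, this \<open>y\<close> lies outside the whole
  image, and mapping \<open>x\<close> to \<open>y\<close> embeds the extended graph.\<close>

lemma refuted_new:
  assumes ok: "state_ok vs (x # fs) e p" and u: "u \<in> set vs" and non: "nonadj vs e u []"
    and few: "few (e u)" and ref: "refuted (x # vs, e(x := [u], u := x # e u))"
  shows "refuted (vs, e)"
  unfolding refuted_def
proof (intro allI notI)
  fix f assume "embeds f (fst (vs, e)) (snd (vs, e))"
  then have f: "embeds f vs e" by simp
  from state_okD(1)[OF ok] u have x: "x \<notin> set vs" "x \<noteq> u" by auto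
  have "card (f ` set (e u)) < 3"
    using few by (metis card_image_le card_length few_iff finite_set le_less_trans)
  moreover have "3 \<le> card {y. adj (f u) y}"
    using degree f u by (auto simp: embeds_def)
  ultimately have "\<not> {y. adj (f u) y} \<subseteq> f ` set (e u)"
    by (meson card_mono finite_imageI finite_set leD le_less_trans)
  then obtain y where y: "adj (f u) y" "y \<notin> f ` set (e u)" by auto
  \<comment> \<open>An image adjacent to \<open>f u\<close> would have to come from
    \<open>e u\<close>, as no candidates are left.\<close>
  have "f v \<noteq> y" if "v \<in> set vs" for v
    using nonadjD[OF non f that] y by auto
  moreover have "f v \<in> V" if "v \<in> set vs" for v
    using f that by (auto simp: embeds_def)
  moreover have "w \<noteq> x" "adj (f v) (f w)" if "v \<in> set vs" "w \<in> set (e v)" for v w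
    using state_okD(3)[OF ok that] x f that by (auto simp: embeds_def)
  moreover have "inj_on f (set vs)" using f by (simp add: embeds_def)
  ultimately have "embeds (f(x := y)) (x # vs) (e(x := [u], u := x # e u))"
    using x u y(1) adj_sym[OF y(1)] adj_in_V[OF y(1)]
    unfolding embeds_def by (auto simp: inj_on_def)
  with ref show False by (simp add: refuted_def)
qed

section \<open>Correctness of certificates\<close>

text \<open>The claim about the store has to be part of the induction, as each certificate in a row
  is checked with the store left behind by the preceding ones. A row refutes its state in the last
  step, by the degree bound or by the new vertex; the steps before it only shorten the candidate
  list.\<close>

lemma check_sound:
  "check c vs fs e p k = Some k' \<Longrightarrow> state_ok vs fs e p \<Longrightarrow> \<forall>a b. refuted (k a b) \<Longrightarrow>
    refuted (vs, e) \<and> (\<forall>a b. refuted (k' a b))"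
  "branch u rs cs vs fs e p k = Some k' \<Longrightarrow> state_ok vs fs e p \<Longrightarrow> \<forall>a b. refuted (k a b) \<Longrightarrow>
    u \<in> set vs \<Longrightarrow> set rs \<subseteq> set vs \<Longrightarrow> nonadj vs e u rs \<Longrightarrow> few (e u) \<Longrightarrow>
    refuted (vs, e) \<and> (\<forall>a b. refuted (k' a b))"
proof (induction c vs fs e p k and u rs cs vs fs e p k arbitrary: k' and k' rule: check_branch.induct)
  case (1 a b xs vs fs e p k)
  then show ?case
    using occurs_refuted[of "k a b" xs vs e] by (simp add: refuted_def[of "(vs, e)"] split: if_splits)
next
  case (2 a b c vs fs e p k)
  then show ?case by (auto split: option.splits)
next
  case (3 u cs vs fs e p k)
  let ?rs = "reach [False, False, True, False, False, False, True] e (mark [u]) (e u) (p u)"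
  from 3(2) have c: "u \<in> set vs \<and> few (e u)" and b: "branch u ?rs cs vs fs e p k = Some k'"
    by (auto split: if_splits)
  show ?case
    by (rule 3(1)[OF c b 3(3,4) conjunct1[OF c] subset_trans[OF set_reach state_okD(4)[OF 3(3) conjunct1[OF c]]]
          nonadj_reach[OF 3(3) conjunct1[OF c]] conjunct2[OF c]])
next
  case (4 u rs vs fs e p k)
  then show ?case
    using neighbours_bound[OF 4(2,4,6)] by (force simp: refuted_def[of "(vs, e)"] few_iff split: if_splits)
next
  case (5 u r rs c cs vs fs e p k)
  let ?e = "e(u := r # e u, r := u # e r)"
  from 5(3) obtain k1 where c: "check c vs fs ?e (p(u := rs, r := remove1 u (p r))) k = Some k1"
    and b: "branch u rs cs vs fs e (p(r := remove1 u (p r))) k1 = Some k'"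
    by (auto split: option.splits)
  from 5(7) have r: "r \<in> set vs" "set rs \<subseteq> set vs" by auto
  have "refuted (vs, ?e) \<and> (\<forall>a b. refuted (k1 a b))"
    by (rule 5(1)[OF c state_ok_edge[OF 5(4,6) r 5(8)] 5(5)])
  note ref = conjunct1[OF this] conjunct2[OF this]
  show ?case
    by (rule 5(2)[OF c b state_ok_skip(1)[OF 5(4,6) r(1) ref(1)] ref(2) 5(6) r(2)
          state_ok_skip(2)[OF 5(4,6) r(1) ref(1) 5(8)] 5(9)])
next
  case (6 u c cs vs x fs e p k)
  have "refuted (x # vs, e(x := [u], u := x # e u)) \<and> (\<forall>a b. refuted (k' a b))"
    by (rule 6(1)[OF 6(2)[unfolded branch.simps] state_ok_new[OF 6(3,5,7)] 6(4)])
  then show ?case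
    by (intro conjI refuted_new[OF 6(3,5,7,8)]) (erule conjunct1, erule conjunct2)
qed auto

text \<open>A single vertex without edges embeds into any nonempty \<open>V\<close>, so it cannot be
  refuted. In the initial store every slot holds a loop at \<open>v\<close>: it is refuted by
  irreflexivity, so the invariant of the store holds from the start and no slot has to be
  optional.\<close>

lemma no_certificate:
  assumes "V \<noteq> {}" and "distinct (v # fs)" and "card V \<le> length (v # fs)"
  shows "check c [v] fs (blank []) (blank []) (blank (blank ([v], blank [v]))) = None"
proof (rule ccontr)
  assume "\<not> ?thesis"
  then obtain k where k: "check c [v] fs (blank []) (blank []) (blank (blank ([v], blank [v]))) = Some k"
    by auto
  have "refuted ([v], blank [v])"
    using adj_irrefl by (auto simp: refuted_def embeds_def blank_def)
  moreover have "state_ok [v] fs (blank []) (blank [])"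
    by (rule state_okI) (use assms adj_irrefl in \<open>auto simp: nonadj_def blank_def\<close>)
  ultimately have "refuted ([v], blank [])"
    using check_sound(1)[OF k] by simp
  moreover obtain x where "x \<in> V" using assms(1) by auto
  then have "embeds (\<lambda>_. x) [v] (blank [])"
    by (auto simp: embeds_def blank_def)
  ultimately show False by (simp add: refuted_def)
qed

end

section \<open>Evaluation by the simplifier\<close>

text \<open>
  The simplifier normalizes a term again after each rule whose left-hand side contains \<open>if\<close> or
  \<open>case\<close>, because of their weak congruence rules. The following functions replace them by rules on
  constructors, so that the large arguments are not traversed again at every step.
\<close>

definition "remove1_if c x y ys = (if c then ys else y # remove1 x ys)"
definition "drop_if b x ts = (if b then remove1 x ts else ts)"
definition "reach_if c b bs e vis x xs ts =
  (if c then reach (b # bs) e vis xs ts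
   else reach (b # bs) e vis xs (reach bs e (vis(x := True)) (e x) (drop_if b x ts)))"
definition "place_if c us xs free g u x = (if c then place us xs (free(x := False)) (g(u := x)) else None)"
definition "hom_if g q e us = (case g of None \<Rightarrow> False | Some g \<Rightarrow> hom_ok g q e us)"
definition "some_if c k = (if c then Some k else None)"
definition "save_if k' a b q = (case k' of None \<Rightarrow> None | Some k' \<Rightarrow> Some (k'(a := (k' a)(b := q))))"
definition "row_if c u cs vs fs e p k =
  (if c
   then branch u (reach [False, False, True, False, False, False, True] e (mark [u]) (e u) (p u)) cs vs fs e p k
   else None)"
definition "branch_if k' u rs cs vs fs e p =
  (case k' of None \<Rightarrow> None | Some k' \<Rightarrow> branch u rs cs vs fs e p k')"

text \<open>\<open>remove1_if\<close>, \<open>drop_if\<close> and \<open>reach_if\<close> are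
  evaluated for both truth values. The tests that a certificate has to pass only have a rule for
  success, so that an invalid certificate would end in a stuck term.\<close>

lemma eval_simps:
  "remove1 x [] = []"
  "remove1 x (y # ys) = remove1_if (x = y) x y ys"
  "remove1_if True x y ys = ys"
  "remove1_if False x y ys = y # remove1 x ys"
  "drop_if True x ts = remove1 x ts"
  "drop_if False x ts = ts"
  "reach bs e vis xs [] = []"
  "reach [] e vis xs (t # ts) = t # ts"
  "reach (b # bs) e vis [] (t # ts) = t # ts"
  "reach (b # bs) e vis (x # xs) (t # ts) = reach_if (vis x) b bs e vis x xs (t # ts)"
  "reach_if True b bs e vis x xs ts = reach (b # bs) e vis xs ts"
  "reach_if False b bs e vis x xs ts =
    reach (b # bs) e vis xs (reach bs e (vis(x := True)) (e x) (drop_if b x ts))"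
  "place [] [] free g = Some g"
  "place (u # us) (x # xs) free g = place_if (free x) us xs free g u x"
  "place_if True us xs free g u x = place us xs (free(x := False)) (g(u := x))"
  "hom_if (Some h) q e us = hom_ok h q e us"
  "occurs (us, q) xs vs e = hom_if (place us xs (mark vs) (blank undefined)) q e us"
  "some_if True k = Some k"
  "save_if (Some k) i j z = Some (k(i := (k i)(j := z)))"
  "row_if True u cs vs fs e p k =
    branch u (reach [False, False, True, False, False, False, True] e (mark [u]) (e u) (p u)) cs vs fs e p k"
  "branch_if (Some k) u rs cs vs fs e p = branch u rs cs vs fs e p k"
  "check (Known i j xs) vs fs e p k = some_if (occurs (k i j) xs vs e) k"
  "check (Save i j c) vs fs e p k = save_if (check c vs fs e p k) i j (vs, e)"
  "check (Row u cs) vs fs e p k = row_if (u \<in> set vs \<and> few (e u)) u cs vs fs e p k"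
  "branch u rs [] vs fs e p k = some_if (few (e u @ rs @ fs)) k"
  "branch u (r # rs) (c # cs) vs fs e p k =
    branch_if (check c vs fs (e(u := r # e u, r := u # e r)) (p(u := rs, r := remove1 u (p r))) k)
      u rs cs vs fs e (p(r := remove1 u (p r)))"
  "branch u [] (c # cs) vs (x # fs) e p k =
    check c (x # vs) fs (e(x := [u], u := x # e u)) ((widen x u p)(u := [], x := remove1 u vs)) k"
  by (simp_all add: remove1_if_def drop_if_def reach_if_def place_if_def hom_if_def some_if_def save_if_def
      row_if_def branch_if_def)

text \<open>
  The functions of a state are represented by their 23 values. The letter \<open>O\<close> is skipped because it
  is the infix symbol for relation composition.
\<close>

datatype vertex = A | B | C | D | E | F | G | H | I | J | K | L | M | N | P | Q | R | S | T | U | V | W | X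

lemma widen_vertex:
  "widen y u (case_vertex xa xb xc xd xe xf xg xh xi xj xk xl xm xn xp xq xr xs xt xu xv xw xx) =
    case_vertex (y # remove1 u xa) (y # remove1 u xb) (y # remove1 u xc) (y # remove1 u xd) (y # remove1 u xe) (y
    # remove1 u xf) (y # remove1 u xg) (y # remove1 u xh) (y # remove1 u xi) (y # remove1 u xj) (y # remove1 u
    xk) (y # remove1 u xl) (y # remove1 u xm) (y # remove1 u xn) (y # remove1 u xp) (y # remove1 u xq) (y #
    remove1 u xr) (y # remove1 u xs) (y # remove1 u xt) (y # remove1 u xu) (y # remove1 u xv) (y # remove1 u
    xw) (y # remove1 u xx)"
    "widen y u (blank xs) = blank (y # remove1 u xs)"
  by (auto simp: widen_def blank_def fun_eq_iff split: vertex.split)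

text \<open>Every update yields a table again, so the terms do not grow with the number of updates.
  The store is a table of tables with 23 * 23 slots.\<close>

lemma update_vertex:
  "(case_vertex xa xb xc xd xe xf xg xh xi xj xk xl xm xn xp xq xr xs xt xu xv xw xx)(A := y) =
    case_vertex y xb xc xd xe xf xg xh xi xj xk xl xm xn xp xq xr xs xt xu xv xw xx"
  "(case_vertex xa xb xc xd xe xf xg xh xi xj xk xl xm xn xp xq xr xs xt xu xv xw xx)(B := y) =
    case_vertex xa y xc xd xe xf xg xh xi xj xk xl xm xn xp xq xr xs xt xu xv xw xx"
  "(case_vertex xa xb xc xd xe xf xg xh xi xj xk xl xm xn xp xq xr xs xt xu xv xw xx)(C := y) =
    case_vertex xa xb y xd xe xf xg xh xi xj xk xl xm xn xp xq xr xs xt xu xv xw xx"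
  "(case_vertex xa xb xc xd xe xf xg xh xi xj xk xl xm xn xp xq xr xs xt xu xv xw xx)(D := y) =
    case_vertex xa xb xc y xe xf xg xh xi xj xk xl xm xn xp xq xr xs xt xu xv xw xx"
  "(case_vertex xa xb xc xd xe xf xg xh xi xj xk xl xm xn xp xq xr xs xt xu xv xw xx)(E := y) =
    case_vertex xa xb xc xd y xf xg xh xi xj xk xl xm xn xp xq xr xs xt xu xv xw xx"
  "(case_vertex xa xb xc xd xe xf xg xh xi xj xk xl xm xn xp xq xr xs xt xu xv xw xx)(F := y) =
    case_vertex xa xb xc xd xe y xg xh xi xj xk xl xm xn xp xq xr xs xt xu xv xw xx"
  "(case_vertex xa xb xc xd xe xf xg xh xi xj xk xl xm xn xp xq xr xs xt xu xv xw xx)(G := y) =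
    case_vertex xa xb xc xd xe xf y xh xi xj xk xl xm xn xp xq xr xs xt xu xv xw xx"
  "(case_vertex xa xb xc xd xe xf xg xh xi xj xk xl xm xn xp xq xr xs xt xu xv xw xx)(H := y) =
    case_vertex xa xb xc xd xe xf xg y xi xj xk xl xm xn xp xq xr xs xt xu xv xw xx"
  "(case_vertex xa xb xc xd xe xf xg xh xi xj xk xl xm xn xp xq xr xs xt xu xv xw xx)(I := y) =
    case_vertex xa xb xc xd xe xf xg xh y xj xk xl xm xn xp xq xr xs xt xu xv xw xx"
  "(case_vertex xa xb xc xd xe xf xg xh xi xj xk xl xm xn xp xq xr xs xt xu xv xw xx)(J := y) =
    case_vertex xa xb xc xd xe xf xg xh xi y xk xl xm xn xp xq xr xs xt xu xv xw xx"
  "(case_vertex xa xb xc xd xe xf xg xh xi xj xk xl xm xn xp xq xr xs xt xu xv xw xx)(K := y) =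
    case_vertex xa xb xc xd xe xf xg xh xi xj y xl xm xn xp xq xr xs xt xu xv xw xx"
  "(case_vertex xa xb xc xd xe xf xg xh xi xj xk xl xm xn xp xq xr xs xt xu xv xw xx)(L := y) =
    case_vertex xa xb xc xd xe xf xg xh xi xj xk y xm xn xp xq xr xs xt xu xv xw xx"
  "(case_vertex xa xb xc xd xe xf xg xh xi xj xk xl xm xn xp xq xr xs xt xu xv xw xx)(M := y) =
    case_vertex xa xb xc xd xe xf xg xh xi xj xk xl y xn xp xq xr xs xt xu xv xw xx"
  "(case_vertex xa xb xc xd xe xf xg xh xi xj xk xl xm xn xp xq xr xs xt xu xv xw xx)(N := y) =
    case_vertex xa xb xc xd xe xf xg xh xi xj xk xl xm y xp xq xr xs xt xu xv xw xx"
  "(case_vertex xa xb xc xd xe xf xg xh xi xj xk xl xm xn xp xq xr xs xt xu xv xw xx)(P := y) =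
    case_vertex xa xb xc xd xe xf xg xh xi xj xk xl xm xn y xq xr xs xt xu xv xw xx"
  "(case_vertex xa xb xc xd xe xf xg xh xi xj xk xl xm xn xp xq xr xs xt xu xv xw xx)(Q := y) =
    case_vertex xa xb xc xd xe xf xg xh xi xj xk xl xm xn xp y xr xs xt xu xv xw xx"
  "(case_vertex xa xb xc xd xe xf xg xh xi xj xk xl xm xn xp xq xr xs xt xu xv xw xx)(R := y) =
    case_vertex xa xb xc xd xe xf xg xh xi xj xk xl xm xn xp xq y xs xt xu xv xw xx"
  "(case_vertex xa xb xc xd xe xf xg xh xi xj xk xl xm xn xp xq xr xs xt xu xv xw xx)(S := y) =
    case_vertex xa xb xc xd xe xf xg xh xi xj xk xl xm xn xp xq xr y xt xu xv xw xx"
  "(case_vertex xa xb xc xd xe xf xg xh xi xj xk xl xm xn xp xq xr xs xt xu xv xw xx)(T := y) =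
    case_vertex xa xb xc xd xe xf xg xh xi xj xk xl xm xn xp xq xr xs y xu xv xw xx"
  "(case_vertex xa xb xc xd xe xf xg xh xi xj xk xl xm xn xp xq xr xs xt xu xv xw xx)(U := y) =
    case_vertex xa xb xc xd xe xf xg xh xi xj xk xl xm xn xp xq xr xs xt y xv xw xx"
  "(case_vertex xa xb xc xd xe xf xg xh xi xj xk xl xm xn xp xq xr xs xt xu xv xw xx)(V := y) =
    case_vertex xa xb xc xd xe xf xg xh xi xj xk xl xm xn xp xq xr xs xt xu y xw xx"
  "(case_vertex xa xb xc xd xe xf xg xh xi xj xk xl xm xn xp xq xr xs xt xu xv xw xx)(W := y) =
    case_vertex xa xb xc xd xe xf xg xh xi xj xk xl xm xn xp xq xr xs xt xu xv y xx"
  "(case_vertex xa xb xc xd xe xf xg xh xi xj xk xl xm xn xp xq xr xs xt xu xv xw xx)(X := y) =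
    case_vertex xa xb xc xd xe xf xg xh xi xj xk xl xm xn xp xq xr xs xt xu xv xw y"
  "(blank x)(A := y) =
    case_vertex y x x x x x x x x x x x x x x x x x x x x x x"
  "(blank x)(B := y) =
    case_vertex x y x x x x x x x x x x x x x x x x x x x x x"
  "(blank x)(C := y) =
    case_vertex x x y x x x x x x x x x x x x x x x x x x x x"
  "(blank x)(D := y) =
    case_vertex x x x y x x x x x x x x x x x x x x x x x x x"
  "(blank x)(E := y) =
    case_vertex x x x x y x x x x x x x x x x x x x x x x x x"
  "(blank x)(F := y) =
    case_vertex x x x x x y x x x x x x x x x x x x x x x x x"
  "(blank x)(G := y) =
    case_vertex x x x x x x y x x x x x x x x x x x x x x x x"
  "(blank x)(H := y) =
    case_vertex x x x x x x x y x x x x x x x x x x x x x x x"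
  "(blank x)(I := y) =
    case_vertex x x x x x x x x y x x x x x x x x x x x x x x"
  "(blank x)(J := y) =
    case_vertex x x x x x x x x x y x x x x x x x x x x x x x"
  "(blank x)(K := y) =
    case_vertex x x x x x x x x x x y x x x x x x x x x x x x"
  "(blank x)(L := y) =
    case_vertex x x x x x x x x x x x y x x x x x x x x x x x"
  "(blank x)(M := y) =
    case_vertex x x x x x x x x x x x x y x x x x x x x x x x"
  "(blank x)(N := y) =
    case_vertex x x x x x x x x x x x x x y x x x x x x x x x"
  "(blank x)(P := y) =
    case_vertex x x x x x x x x x x x x x x y x x x x x x x x"
  "(blank x)(Q := y) =
    case_vertex x x x x x x x x x x x x x x x y x x x x x x x"
  "(blank x)(R := y) =
    case_vertex x x x x x x x x x x x x x x x x y x x x x x x"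
  "(blank x)(S := y) =
    case_vertex x x x x x x x x x x x x x x x x x y x x x x x"
  "(blank x)(T := y) =
    case_vertex x x x x x x x x x x x x x x x x x x y x x x x"
  "(blank x)(U := y) =
    case_vertex x x x x x x x x x x x x x x x x x x x y x x x"
  "(blank x)(V := y) =
    case_vertex x x x x x x x x x x x x x x x x x x x x y x x"
  "(blank x)(W := y) =
    case_vertex x x x x x x x x x x x x x x x x x x x x x y x"
  "(blank x)(X := y) =
    case_vertex x x x x x x x x x x x x x x x x x x x x x x y"
  by (auto simp: blank_def fun_eq_iff split: vertex.split)

section \<open>The search tree\<close>

text \<open>The tree is cut into pieces, numbered in the order in which their checks are completed;
  each one is inserted into a later one, and \<open>cert32\<close> is the root. The slots of saved
  patterns are numbered in the same manner, with the second letter running fastest.\<close>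

definition cert1 :: "vertex cert" where
  "cert1 = Row S [Save B C (Row T [Row U [Save A N (Row U [Row S [Save A L (Row T [Save A K (Row R [Row Q
   []])]), Save A M (Row T [Row W []]), Row T [Known A K [X,W,V,U,S,T,R,Q,P,N,L,M,K,J,I,H,G,F,E,D,C,B,A],
   Known A M [W,V,U,S,T,R,Q,P,N,L,M,K,J,I,H,G,F,E,D,C,B,A]]]]), Known A N
   [V,U,T,S,Q,R,P,N,M,L,K,J,I,H,G,F,E,D,C,B,A], Row U [Row S [Save A Q (Row T [Save A P (Row R [Row X [],
   Row W []]), Known A P [X,W,V,U,T,S,Q,R,P,N,M,L,K,J,I,H,G,F,E,D,C,B,A]]), Known A Q
   [W,X,V,U,T,S,R,Q,P,N,M,L,K,J,I,H,G,F,E,D,C,B,A], Save A R (Row R [Row Q [Row Q [], Row Q []], Row Q []]),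
   Known A R [X,W,V,U,T,S,Q,R,P,N,M,L,K,J,I,H,G,F,E,D,C,B,A]]]], Save A W (Row T [Save A V (Row V [Save A T
   (Row R [Row U [], Row Q [Row S [Row X [Row X [], Row X [], Row X []], Known A L
   [W,S,T,U,V,R,Q,L,M,N,P,K,I,J,H,G,E,F,B,C,D,A]]], Row U [Save A S (Row S [Row U [], Row U [Row Q []]]),
   Known A L [W,S,T,U,V,R,Q,L,M,N,P,K,I,J,H,G,E,F,B,C,D,A], Row U []]]), Row W [Row U [], Row W [Row S [Row
   Q [], Known A M [W,S,T,U,V,R,Q,L,M,N,P,K,I,J,H,G,E,F,B,C,D,A]]], Row W []], Save A U (Row R [Row W [Row S
   [Row X [], Row X []], Row Q [Row Q [], Row Q [], Row Q []]], Row U [Known A M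
   [W,S,T,V,U,R,Q,L,M,P,N,K,I,J,H,G,E,F,B,C,D,A]], Row W [], Row Q [Row S [Row X [], Row W []]]])])]), Known
   A W [V,U,T,S,Q,R,P,N,M,L,K,J,I,H,G,F,E,D,C,B,A], Row T [Save B B (Row V [Save A X (Row U [Row S [Row U
   [Known A T [X,S,T,U,V,R,Q,L,M,N,P,K,I,J,H,G,E,F,B,C,D,A], Known A T
   [X,S,T,U,V,Q,R,L,M,N,P,K,I,J,H,G,E,F,B,C,D,A]], Row U [], Row U []], Known A Q
   [X,W,S,T,U,V,R,Q,L,M,N,P,K,I,J,H,G,E,F,B,C,D,A], Known A W [S,T,U,V,R,Q,L,M,N,P,K,I,J,H,G,E,F,B,C,D,A],
   Known A W [S,T,U,V,Q,R,L,M,N,P,K,I,J,H,G,E,F,B,C,D,A]]), Known A X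
   [W,X,V,U,T,S,R,Q,P,N,M,L,K,J,I,H,G,F,E,D,C,B,A], Save B A (Row R [Known A W
   [S,T,U,V,R,Q,L,M,N,P,K,I,J,H,G,E,F,B,C,D,A], Row Q [Row Q [], Row Q []], Row Q []]), Known B A
   [X,W,V,U,T,S,Q,R,P,N,M,L,K,J,I,H,G,F,E,D,C,B,A]])]]), Known B C
   [U,V,T,S,R,Q,N,P,M,L,K,J,I,H,G,F,E,D,C,B,A], Save B F (Row S [Row U [Save B E (Row U [Known A T
   [W,U,V,S,T,R,Q,N,P,L,M,K,J,I,H,G,F,E,D,C,B,A], Row T [Row Q [Row R [Row V []], Row R [Row T [Known A S
   [X,W,T,S,U,V,Q,R,M,L,N,P,K,I,J,H,G,E,F,B,C,D,A]]]], Known A V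
   [W,V,U,S,T,R,Q,P,N,L,M,K,J,I,H,G,F,E,D,C,B,A], Row T [Row Q [Row V []]], Row T []], Save B D (Row T [Row
   T [Known A V [W,V,U,S,T,R,Q,P,N,L,M,K,J,I,H,G,F,E,D,C,B,A]], Known A V
   [W,V,U,S,T,R,Q,P,N,L,M,K,J,I,H,G,F,E,D,C,B,A], Row T []])]), Known A V
   [W,U,V,S,T,R,Q,N,P,L,M,K,J,I,H,G,F,E,D,C,B,A], Row U [Row T [Row T [], Known A V
   [W,V,U,S,T,R,Q,P,N,L,M,K,J,I,H,G,F,E,D,C,B,A], Row T []]], Row U [Row T [Known B E
   [X,S,T,V,U,Q,R,L,M,P,N,K,I,J,H,G,E,F,B,C,D,A], Row T [Known A U
   [W,X,T,S,U,V,Q,R,M,L,N,P,K,I,J,H,G,E,F,B,C,D,A]], Known A V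
   [W,V,U,S,T,R,Q,P,N,L,M,K,J,I,H,G,F,E,D,C,B,A], Row T []]], Row U []]]), Known B F
   [V,U,T,S,Q,R,P,N,M,L,K,J,I,H,G,F,E,D,C,B,A], Row S [Row U [Save B G (Row U [Known A X
   [X,W,U,V,S,T,R,Q,N,P,L,M,K,J,I,H,G,F,E,D,C,B,A], Known B D
   [W,X,T,S,V,U,R,Q,M,L,P,N,K,I,J,H,G,E,F,B,C,D,A], Known B D
   [W,X,T,S,V,U,Q,R,M,L,P,N,K,I,J,H,G,E,F,B,C,D,A]]), Known B G
   [W,X,V,U,T,S,R,Q,P,N,M,L,K,J,I,H,G,F,E,D,C,B,A], Known B B
   [X,W,U,V,S,T,R,Q,N,P,L,M,K,J,I,H,G,F,E,D,C,B,A], Known B F [T,S,V,U,R,Q,M,L,P,N,K,I,J,H,G,E,F,B,C,D,A],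
   Known B F [T,S,V,U,Q,R,M,L,P,N,K,I,J,H,G,E,F,B,C,D,A]]]]"

definition cert2 :: "vertex cert" where
  "cert2 = Row S [Save C J (Row S [Row M [Save C D (Row M [Save C C (Row N [Save C B (Row W [Row W [Row V [Save
   C A (Row T [Row T [], Row T []])], Row V [Row T [Row T [], Row T []]]], Row W [Row V [Known C A
   [X,V,W,U,T,S,R,Q,P,M,N,L,K,J,I,H,G,F,E,D,C,B,A]]], Row W []])]), Row N [Row N [Row W [Row W [Row X []],
   Row W [], Known C C [V,U,T,S,R,Q,P,W,M,L,K,J,I,H,G,F,E,D,C,B,A]]], Row N [Row X [Row X [], Row X [], Row
   X []]], Row N []]]), Save C H (Row M [Save C G (Row N [Save C F (Row W [Save C E (Row W [Row X [Row X [],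
   Row X [], Row X []]]), Known C E [W,T,U,V,R,S,Q,P,N,M,K,L,J,I,H,G,F,E,D,C,B,A], Row W []])]), Row W [Row
   W [Row X [Row X [], Row X [], Row X [], Row N [], Row X []]], Known C G
   [V,U,T,S,R,Q,P,W,M,L,K,J,I,H,G,F,E,D,C,B,A], Row W []]]), Known C D
   [T,U,V,R,S,Q,P,N,M,K,L,J,I,H,G,F,E,D,C,B,A], Row M [Row N [Known C B
   [W,V,U,T,S,R,Q,P,M,N,L,K,J,I,H,G,F,E,D,C,B,A], Known C F [W,V,U,T,S,R,Q,P,M,N,L,K,J,I,H,G,F,E,D,C,B,A],
   Known C B [W,T,U,V,R,S,Q,P,M,N,K,L,J,I,H,G,F,E,D,C,B,A], Row P [Known C D
   [V,U,T,S,R,N,M,Q,P,L,K,I,J,H,G,E,F,B,C,D,A], Known C H [V,U,T,S,R,N,M,Q,P,L,K,I,J,H,G,E,F,B,C,D,A], Known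
   C D [T,U,V,R,S,N,M,Q,P,K,L,I,J,H,G,E,F,B,C,D,A], Row P [], Row P []]]], Save C I (Row M [Row N [Known C D
   [V,U,T,S,R,Q,P,M,N,L,K,J,I,H,G,F,E,D,C,B,A], Known C H [V,U,T,S,R,Q,P,M,N,L,K,J,I,H,G,F,E,D,C,B,A], Known
   C D [T,U,V,R,S,Q,P,M,N,K,L,J,I,H,G,F,E,D,C,B,A], Row N []]]), Row M [Row N [Known C D
   [V,U,T,S,R,Q,P,M,N,L,K,J,I,H,G,F,E,D,C,B,A], Known C H [V,U,T,S,R,Q,P,M,N,L,K,J,I,H,G,F,E,D,C,B,A], Known
   C D [T,U,V,R,S,Q,P,M,N,K,L,J,I,H,G,F,E,D,C,B,A], Known C I
   [V,U,T,S,R,Q,P,M,N,L,K,J,I,H,G,F,E,D,C,B,A]]]]]), Known C J [T,U,S,R,Q,P,N,M,L,K,J,I,H,G,F,E,D,C,B,A],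
   Row S [Row M [Save C N (Row M [Row N [Save C K (Row V [Known C J
   [S,U,W,V,Q,P,L,K,M,N,J,G,H,I,F,C,D,E,A,B], Known C J [S,T,W,V,Q,P,L,K,M,N,J,G,H,I,F,C,D,E,A,B], Known C J
   [S,X,W,V,Q,P,L,K,M,N,J,G,H,I,F,C,D,E,A,B]]), Save C M (Row X [Row X [Known C J
   [S,V,W,X,Q,P,L,K,M,N,J,G,H,I,F,C,D,E,A,B]], Save C L (Row X [Known C J
   [S,U,W,X,Q,P,L,K,M,N,J,G,H,I,F,C,D,E,A,B]]), Known C L [X,W,V,T,U,S,R,Q,P,N,M,L,K,J,I,H,G,F,E,D,C,B,A],
   Known C K [W,X,U,T,S,R,Q,P,N,M,L,K,J,I,H,G,F,E,D,C,B,A]])], Row N [Row N [], Row N [], Row N [], Row N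
   []]]), Known C N [V,W,U,T,S,R,Q,P,N,M,L,K,J,I,H,G,F,E,D,C,B,A], Known C N
   [U,T,W,V,R,S,Q,P,N,M,K,L,J,I,H,G,F,E,D,C,B,A], Known C N [T,U,W,V,R,S,Q,P,N,M,K,L,J,I,H,G,F,E,D,C,B,A],
   Row M [Row N [Known C M [X,W,V,U,T,S,R,Q,P,M,N,L,K,J,I,H,G,F,E,D,C,B,A], Known C M
   [X,V,W,U,T,S,R,Q,P,M,N,L,K,J,I,H,G,F,E,D,C,B,A], Known C M
   [X,U,T,W,V,R,S,Q,P,M,N,K,L,J,I,H,G,F,E,D,C,B,A], Known C M
   [X,T,U,W,V,R,S,Q,P,M,N,K,L,J,I,H,G,F,E,D,C,B,A]]], Row M [Row N [Known C N
   [W,V,U,T,S,R,Q,P,M,N,L,K,J,I,H,G,F,E,D,C,B,A], Known C N [V,W,U,T,S,R,Q,P,M,N,L,K,J,I,H,G,F,E,D,C,B,A],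
   Known C N [U,T,W,V,R,S,Q,P,M,N,K,L,J,I,H,G,F,E,D,C,B,A], Known C N
   [T,U,W,V,R,S,Q,P,M,N,K,L,J,I,H,G,F,E,D,C,B,A]]], Row M []]]]"

text \<open>Here the triangle \<open>A B D\<close> and the vertex \<open>H\<close> are joined by
  three disjoint paths of length 2, through \<open>C\<close>, \<open>E\<close> and \<open>F\<close>
  (pattern \<open>C V\<close>), and each of these three has got a third neighbour \<open>G\<close>,
  \<open>I\<close> or \<open>J\<close>. The cases \<open>A J\<close>, \<open>B X\<close> and
  \<open>C U\<close> join \<open>G\<close> to \<open>H\<close>, to \<open>A\<close>, or to two new
  vertices.\<close>

definition cert3 :: "vertex cert" where
  "cert3 = Row G [Save A J (Row G [Row I [Row I [Row J [Row J [Row K [Row K [Row L [Save A G (Row L [Row M [Row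
   S [Row S [Row T [Save A E (Row T [Row N [Save A B (Row N [Row P [Save A A (Row X [Row X [Row W []], Row X
   []])], Row P [Row P [], Row P []]]), Save A D (Row N [Row P [Save A C (Row X [Row X [], Row X []])], Row
   P [Known A B [W,V,U,T,S,R,Q,N,P,M,L,K,J,I,H,G,F,E,D,C,B,A], Known A B
   [U,V,W,S,T,R,Q,N,P,L,M,K,J,I,H,G,F,E,D,C,B,A], Row P []]]), Known A B
   [U,V,W,S,T,R,Q,P,N,L,M,K,J,I,H,G,F,E,D,C,B,A], Row N [Row P [Known A A
   [X,W,V,U,T,S,R,Q,N,P,M,L,K,J,I,H,G,F,E,D,C,B,A], Known A C
   [X,W,V,U,T,S,R,Q,N,P,M,L,K,J,I,H,G,F,E,D,C,B,A], Known A A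
   [X,U,V,W,S,T,R,Q,N,P,L,M,K,J,I,H,G,F,E,D,C,B,A]]], Row N [Row P [Known A B
   [W,V,U,T,S,R,Q,N,P,M,L,K,J,I,H,G,F,E,D,C,B,A], Known A D [W,V,U,T,S,R,Q,N,P,M,L,K,J,I,H,G,F,E,D,C,B,A],
   Known A B [U,V,W,S,T,R,Q,N,P,L,M,K,J,I,H,G,F,E,D,C,B,A]]], Row N []]]), Known A E
   [U,V,T,S,R,Q,P,N,M,L,K,J,I,H,G,F,E,D,C,B,A], Row T [Row N [Save A F (Row N [Row P [Row W [Known A E
   [T,V,X,W,R,Q,M,L,N,P,K,I,J,H,G,E,F,B,C,D,A], Known A E [T,U,X,W,R,Q,M,L,N,P,K,I,J,H,G,E,F,B,C,D,A]]]]),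
   Known A F [W,X,V,U,T,S,R,Q,P,N,M,L,K,J,I,H,G,F,E,D,C,B,A], Known A F
   [V,U,X,W,S,T,R,Q,P,N,L,M,K,J,I,H,G,F,E,D,C,B,A], Known A F
   [U,V,X,W,S,T,R,Q,P,N,L,M,K,J,I,H,G,F,E,D,C,B,A], Row N [], Row N []]]]]]]]), Save A I (Row L [Row M [Row
   M [Row N [Known A G [R,Q,M,L,P,N,K,I,J,H,G,E,F,B,C,D,A], Save A H (Row N [Row P [Row P [Row Q [Row Q [],
   Row Q []]]]]), Row N [Row P [Known A H [U,T,S,R,Q,N,P,M,L,K,J,I,H,G,F,E,D,C,B,A], Row P []]]]]]]), Row L
   [Row M [Known A I [R,Q,P,N,L,M,K,J,I,H,G,F,E,D,C,B,A], Row M [Row N [Known A G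
   [R,Q,M,L,P,N,K,I,J,H,G,E,F,B,C,D,A], Known A I [R,Q,M,L,P,N,K,I,J,H,G,E,F,B,C,D,A], Row N [Row P
   []]]]]]]]]]]]]]), Save B X (Row G [Row I [Row I [Save B W (Row J [Row J [Row K [Row K [Save B V (Row L
   [Save B S (Row L [Row M [Row N [Row N [Row P [cert1]], Save B L (Row N [Row P [Row P [Row U [Save B K (Row U
   [Row S [Save B I (Row S [Save B H (Row T [Row T [], Row T [], Row T []]), Known B H
   [X,W,V,U,T,S,Q,R,P,N,M,L,K,J,I,H,G,F,E,D,C,B,A]]), Row S [Save B J (Row T [Row T [], Row T []]), Known B
   J [X,W,V,U,T,S,Q,R,P,N,M,L,K,J,I,H,G,F,E,D,C,B,A]], Known B I
   [V,W,X,P,T,S,R,Q,U,J,M,L,K,N,I,H,G,F,E,D,C,B,A], Row S [], Row S []]]), Known B K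
   [V,W,U,T,S,R,Q,P,N,M,L,K,J,I,H,G,F,E,D,C,B,A], Row U []]]]]), Row N [Row P [Known B L
   [T,S,R,Q,N,P,M,L,K,J,I,H,G,F,E,D,C,B,A], Row P [Row S [Save B R (Row S [Save B P (Row T [Save B N (Row T
   [Save B M (Row R [Row V [Row U [Row W []]], Row W [], Row Q [Row V [Row W [], Row U []]]]), Known B M
   [X,W,V,U,T,S,Q,R,P,N,M,L,K,J,I,H,G,F,E,D,C,B,A]]), Known B N
   [V,U,X,W,T,S,R,Q,N,P,M,L,K,J,I,H,G,F,E,D,C,B,A], Row T [], Row T []]), Known B P
   [X,W,U,V,T,S,R,Q,P,N,M,L,K,J,I,H,G,F,E,D,C,B,A], Save B Q (Row T [Row T [Known B M
   [X,W,V,U,S,T,R,Q,P,N,L,M,K,J,I,H,G,F,E,D,C,B,A], Known B M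
   [X,W,U,V,S,T,R,Q,P,N,L,M,K,J,I,H,G,F,E,D,C,B,A]], Row T [], Row T [], Row T []]), Known B Q
   [X,W,V,U,T,S,Q,R,P,N,M,L,K,J,I,H,G,F,E,D,C,B,A]]), Known B R
   [W,X,V,U,T,S,R,Q,P,N,M,L,K,J,I,H,G,F,E,D,C,B,A], Known B R
   [V,U,X,W,T,S,R,Q,N,P,M,L,K,J,I,H,G,F,E,D,C,B,A], Known B R
   [U,V,X,W,T,S,R,Q,N,P,M,L,K,J,I,H,G,F,E,D,C,B,A], Row S [], Row S []]]]]]]]), Save B U (Row L [Row M [Row
   M [Row N [Known B S [R,Q,M,L,P,N,K,I,J,H,G,E,F,B,C,D,A], Save B T (Row N [Row P [Row P [Row S [Row S [],
   Row S []]]]]), Row N [Row P [Known B T [U,T,S,R,Q,N,P,M,L,K,J,I,H,G,F,E,D,C,B,A], Row P []]]]]]]), Row L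
   [Row M [Known B U [R,Q,P,N,L,M,K,J,I,H,G,F,E,D,C,B,A], Row M [Row N [Known B S
   [R,Q,M,L,P,N,K,I,J,H,G,E,F,B,C,D,A], Known B U [R,Q,M,L,P,N,K,I,J,H,G,E,F,B,C,D,A], Row N [Row P
   []]]]]]])]]]])]]]), Row G [Save C U (Row I [Known A J [J,G,H,I,F,C,D,E,A,B], Known B X
   [J,G,H,I,F,C,D,E,A,B], Row I [Save C T (Row J [Known A J [I,G,H,J,E,C,B,F,A,D], Known B X
   [I,G,H,J,E,C,B,F,A,D], Row J [Row K [Save C P (Row K [Row L [Row R [Row R [cert2]]]]), Save C R (Row K [Row
   L [Row L [Row M [Known C P [Q,P,L,K,N,M,J,G,H,I,F,C,D,E,A,B], Save C Q (Row M [Row N [Row N [Row P [Known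
   C P [N,M,L,K,Q,P,I,G,H,J,E,C,B,F,A,D], Row Q [], Row P []]]]]), Row M [Row N [Known C Q
   [T,S,R,Q,P,M,N,L,K,J,I,H,G,F,E,D,C,B,A], Row N [Row P [Known C P [N,M,L,K,Q,P,I,G,H,J,E,C,B,F,A,D], Known
   C Q [T,S,R,N,M,Q,P,L,K,I,J,H,G,E,F,B,C,D,A]]]]]]]]]), Row K [Row L [Known C R
   [Q,P,N,M,K,L,J,I,H,G,F,E,D,C,B,A], Row L [Save C S (Row M [Known C P [Q,P,L,K,N,M,J,G,H,I,F,C,D,E,A,B],
   Known C R [Q,P,L,K,N,M,J,G,H,I,F,C,D,E,A,B], Row M [Row N [Known C R [Q,P,L,K,M,N,J,G,H,I,F,C,D,E,A,B],
   Row N []]]])]]]]]])]])]]"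

definition cert4 :: "vertex cert" where
  "cert4 = Row V [Row V [Save D U (Row W [Row T [Save D Q (Row U [Save D N (Row N [Row M [Row M [Row Q [Row X
   []]], Row Q [], Row Q [], Row M []], Save D M (Row M [Row X []]), Row R [Known D M
   [V,W,T,U,S,N,M,L,R,Q,P,K,J,G,H,I,F,C,D,E,A,B]]]), Known D N
   [W,V,U,T,S,R,Q,P,M,N,L,K,J,I,H,G,F,E,D,C,B,A], Save D P (Row Q [Row Q [Row N [], Row M []], Row Q [], Row
   Q [], Row Q []])]), Known D Q [W,V,U,T,S,Q,R,P,N,M,L,K,J,I,H,G,F,E,D,C,B,A], Known D Q
   [W,V,U,T,S,N,M,L,R,Q,P,K,J,G,H,I,F,C,D,E,A,B], Known D Q [W,V,U,T,S,M,N,L,R,Q,P,K,J,G,H,I,F,C,D,E,A,B],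
   Row U [Known D P [X,V,W,T,U,S,R,Q,P,N,M,L,K,J,I,H,G,F,E,D,C,B,A], Known D P
   [X,V,W,T,U,S,Q,R,P,N,M,L,K,J,I,H,G,F,E,D,C,B,A], Known D P
   [X,V,W,T,U,S,N,M,L,R,Q,P,K,J,G,H,I,F,C,D,E,A,B], Known D P
   [X,V,W,T,U,S,M,N,L,R,Q,P,K,J,G,H,I,F,C,D,E,A,B]]], Save D T (Row T [Save D S (Row R [Row T [], Save D R
   (Row N [Row X [], Row M [Row M [Row X []], Row M [], Row M []], Row T []]), Known D R
   [X,W,V,U,T,S,R,Q,P,M,N,L,K,J,I,H,G,F,E,D,C,B,A]]), Known D S
   [X,W,V,U,T,S,Q,R,P,N,M,L,K,J,I,H,G,F,E,D,C,B,A], Known D S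
   [X,W,V,U,T,S,N,M,L,R,Q,P,K,J,G,H,I,F,C,D,E,A,B], Known D S
   [X,W,V,U,T,S,M,N,L,R,Q,P,K,J,G,H,I,F,C,D,E,A,B]])]), Known D U
   [W,V,T,U,S,R,Q,P,N,M,L,K,J,I,H,G,F,E,D,C,B,A], Known D C [W,V,T,S,R,Q,P,N,M,L,K,J,I,H,G,F,E,D,C,B,A], Row
   W [Known D T [X,V,W,U,T,S,R,Q,P,N,M,L,K,J,I,H,G,F,E,D,C,B,A], Known D T
   [X,V,W,T,U,S,R,Q,P,N,M,L,K,J,I,H,G,F,E,D,C,B,A], Known D B
   [X,V,W,T,S,R,Q,P,N,M,L,K,J,I,H,G,F,E,D,C,B,A]]], Save D V (Row V [Known D K
   [S,U,T,V,R,Q,P,N,M,L,K,J,I,H,G,F,E,D,C,B,A], Known D G [W,V,U,S,R,Q,P,N,M,L,K,J,I,H,G,F,E,D,C,B,A], Row W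
   [Row W [Known D K [S,T,U,W,R,Q,P,N,M,L,K,J,I,H,G,F,E,D,C,B,A], Known D F
   [X,U,V,W,T,S,R,Q,P,N,M,L,K,J,I,H,G,F,E,D,C,B,A]], Row W [], Known D K
   [V,W,T,S,R,Q,P,N,M,L,K,J,I,H,G,F,E,D,C,B,A]]]), Known D V [W,V,T,U,S,R,Q,P,N,M,L,K,J,I,H,G,F,E,D,C,B,A],
   Row V [Row W [Known D V [V,W,U,T,S,R,Q,P,N,M,L,K,J,I,H,G,F,E,D,C,B,A], Known D V
   [V,W,T,U,S,R,Q,P,N,M,L,K,J,I,H,G,F,E,D,C,B,A], Known D K [V,W,T,S,R,Q,P,N,M,L,K,J,I,H,G,F,E,D,C,B,A]]],
   Known D K [W,V,T,S,R,Q,P,N,M,L,K,J,I,H,G,F,E,D,C,B,A], Row V []]"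

definition cert5 :: "vertex cert" where
  "cert5 = Row V [Save E T (Row U [Save E I (Row V [Row N [Save E D (Row S [Row X []]), Save E G (Row M [Save E
   E (Row M [Row W [Row S []], Row X []]), Known E E [S,H,C,E,W,I,Q,P,G,M,L,A,B,R,V,N,D,T,F,U,J,K], Row M
   [Row Q [Row X []]], Save E F (Row M [Row X []]), Known E F [S,H,C,E,W,I,Q,P,G,M,L,A,B,R,V,N,D,T,F,U,J,K],
   Row M []]), Save E H (Row M [Row X []]), Row R [Known E D [W,V,T,U,S,N,M,L,R,Q,P,J,K,G,H,I,F,C,D,E,A,B],
   Known E H [W,V,T,U,S,N,M,L,R,Q,P,J,K,G,H,I,F,C,D,E,A,B]]]]), Known E I
   [V,U,T,S,R,Q,P,M,N,L,K,J,I,H,G,F,E,D,C,B,A], Save E S (Row V [Row W [Row S [Save E J (Row N [Row M []]),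
   Known E J [W,V,U,T,S,R,Q,P,M,N,L,K,J,I,H,G,F,E,D,C,B,A], Row X [Row X [], Known E J
   [W,V,U,T,S,R,Q,P,X,M,L,K,J,I,H,G,F,E,D,C,B,A], Row X []]], Save E K (Row N [Row S [Row M []], Row M [Row
   R [Row Q [], Row Q []]], Row R [Row Q [], Row Q []]]), Known E K
   [W,V,U,T,S,R,Q,P,M,N,L,K,J,I,H,G,F,E,D,C,B,A], Row R [Row Q [Row Q [], Row Q []], Row Q [Row N [], Row M
   []], Save E L (Row N [Row M [Row Q []]]), Known E L [X,W,V,U,T,S,R,Q,P,M,N,L,K,J,I,H,G,F,E,D,C,B,A]]],
   Row W [Row W [Row S [Row X [], Row N [], Row M []]], Save E M (Row W [Row N [Row X [], Row S [], Row M
   []]]), Known E M [W,V,U,T,S,R,Q,P,M,N,L,K,J,I,H,G,F,E,D,C,B,A], Row W []], Known E C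
   [U,T,S,R,Q,P,V,M,L,K,J,I,H,G,F,E,D,C,B,A], Row R [Row W [Save E N (Row N [Known E F
   [S,H,C,E,X,I,Q,P,G,L,N,A,B,R,V,W,D,T,F,U,J,K]]), Known E N
   [X,W,V,U,T,S,R,Q,P,M,N,L,K,J,I,H,G,F,E,D,C,B,A], Known E G [X,V,U,T,S,R,Q,P,W,M,L,K,J,I,H,G,F,E,D,C,B,A],
   Known B W [Q,I,D,X,P,T,F,V,R,U,J,W,K]], Row S [Save E P (Row N [Row Q []]), Known E P
   [X,W,V,U,T,S,R,Q,P,M,N,L,K,J,I,H,G,F,E,D,C,B,A]], Row Q [Save E Q (Row N [Row X []]), Known E Q
   [X,W,V,U,T,S,R,Q,P,M,N,L,K,J,I,H,G,F,E,D,C,B,A]], Save E R (Row N [Row M [Row X [], Row Q []]]), Known E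
   R [X,W,V,U,T,S,R,Q,P,M,N,L,K,J,I,H,G,F,E,D,C,B,A]]])]), Save E U (Row V [Known E C
   [U,T,S,R,Q,P,V,M,L,K,J,I,H,G,F,E,D,C,B,A], Row W [Row W [Row X [Row X [Known C V [E,P,T,Q,I,W,R,X,V]],
   Row X [], Row X []]], Known E T [V,W,T,S,R,Q,P,N,M,L,K,J,I,H,G,F,E,D,C,B,A], Row W [Row U [Known E T
   [R,U,T,S,V,X,W,N,M,L,K,J,I,H,G,F,E,D,C,B,A], Row U [], Row U [], Row U [], Row U []]], Row W [Known E C
   [U,T,S,R,Q,P,V,X,W,K,J,I,H,G,F,E,D,C,B,A]], Row W [Row X [Row X [], Row X []]], Row W []]]), Row V [Known
   E B [U,T,S,V,M,L,R,Q,P,K,J,G,H,I,F,C,D,E,A,B], Row Q [Save E X (Row S [Save E V (Row N [Row W []]), Known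
   E V [V,U,T,S,R,Q,P,M,N,L,K,J,I,H,G,F,E,D,C,B,A], Save E W (Row R [Row W [], Row W [], Row W []])]), Save
   F A (Row N [Row M [Row W []], Row M [Row M [Row S []], Row W [], Row M []]]), Known F A
   [V,U,T,S,R,Q,P,M,N,L,K,J,I,H,G,F,E,D,C,B,A], Row R [Known E X
   [T,U,V,S,Q,R,P,N,M,L,K,J,I,H,G,F,E,D,C,B,A], Known F A [T,U,V,S,Q,R,P,N,M,L,K,J,I,H,G,F,E,D,C,B,A], Known
   F A [T,U,V,S,Q,R,P,M,N,L,K,J,I,H,G,F,E,D,C,B,A], Row S [Row S [], Row S [], Known D X
   [R,Q,P,N,M,L,S,J,I,H,G,F,E,D,C,B,A], Row S [], Row S []]]], Row R [Row S [Save F B (Row N [Row M []]),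
   Known F B [W,V,U,T,S,R,Q,P,M,N,L,K,J,I,H,G,F,E,D,C,B,A], Row Q [Row X [], Row X [], Row X []]], Save F E
   (Row N [Row U [Row W [Save F C (Row Q [Row X [], Row M []])], Row Q [Row X [], Row W [], Row M []]], Row
   M [Save F D (Row W [Row W [Known D J [D,S,B,H,A,E,K,F,J,X,U,W,I,C,T,P,V,G,R,L,Q,N,M]], Row W []]), Row X
   []], Row M [Row M [], Row M [], Row M []]]), Known F E [W,V,U,T,S,R,Q,P,M,N,L,K,J,I,H,G,F,E,D,C,B,A], Row
   Q [Row W [Known C V [J,R,I,X,T,W,P,V,Q]], Row S [Row N [], Row M []], Save F F (Row N [Row X [Known F D
   [W,V,U,T,S,R,Q,P,X,N,L,K,J,I,H,G,F,E,D,C,B,A]], Row M []]), Known F F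
   [X,W,V,U,T,S,R,Q,P,M,N,L,K,J,I,H,G,F,E,D,C,B,A], Row W [Row W [], Row U [], Known E U
   [W,U,T,S,V,P,Q,N,M,L,K,J,I,H,G,F,E,D,C,B,A]]]]], Known E C [U,T,S,R,Q,P,V,M,L,K,J,I,H,G,F,E,D,C,B,A], Row
   V [Row R [Row U [Known C V [P,U,F,W,R,V,K,T,J], Known E C [T,U,S,R,Q,P,N,M,L,J,K,I,H,G,F,E,D,C,B,A],
   Known E C [T,U,S,R,Q,P,M,N,L,J,K,I,H,G,F,E,D,C,B,A], Row W [Row W [], Row W [], Row W []]], Row Q [Row S
   [Save F G (Row N [Row X []]), Known F G [W,V,U,T,S,R,Q,P,M,N,L,K,J,I,H,G,F,E,D,C,B,A], Row W [Known E W
   [X,T,U,V,S,W,R,P,N,M,L,K,J,I,H,G,F,E,D,C,B,A], Row N [], Row M []]], Save F H (Row Q [Row S [Row W [],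
   Row N []]]), Known F H [W,V,U,T,S,R,Q,P,M,N,L,K,J,I,H,G,F,E,D,C,B,A], Row Q []], Row Q [Save F I (Row W
   [Row X []]), Save F J (Row N [Row X []]), Known F J [W,V,U,T,S,R,Q,P,M,N,L,K,J,I,H,G,F,E,D,C,B,A], Row X
   [Known F I [X,V,U,T,S,R,Q,P,N,M,L,K,J,I,H,G,F,E,D,C,B,A], Known F J
   [W,V,U,T,S,R,Q,P,X,M,L,K,J,I,H,G,F,E,D,C,B,A], Row X []]], Save F K (Row N [Row W [Row Q [Row X []], Row
   Q [Row Q [], Row Q [], Row Q []]], Row M [Row Q [Row X []], Row X []], Row M [Row M [], Row M [], Row M
   []]]), Known F K [W,V,U,T,S,R,Q,P,M,N,L,K,J,I,H,G,F,E,D,C,B,A], Row U [Row U [Known E S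
   [T,W,V,U,S,N,M,L,R,Q,P,J,K,G,H,I,F,C,D,E,A,B], Known E S [T,W,V,U,S,M,N,L,R,Q,P,J,K,G,H,I,F,C,D,E,A,B]],
   Row U [], Row U [], Row U [], Row U []]]], Row V [Row R [Row U [Save F L (Row X [Known B W
   [Q,I,D,W,P,T,F,V,R,X,J,U,K]]), Known F L [W,X,V,U,T,S,R,Q,P,N,M,L,K,J,I,H,G,F,E,D,C,B,A], Known E C
   [T,U,S,R,Q,P,N,M,L,J,K,I,H,G,F,E,D,C,B,A], Known E C [T,U,S,R,Q,P,M,N,L,J,K,I,H,G,F,E,D,C,B,A]], Row Q
   [Save F M (Row S [Row W [], Row N [], Row M []]), Known F M
   [W,X,V,U,T,S,R,Q,P,N,M,L,K,J,I,H,G,F,E,D,C,B,A], Row Q [], Row Q []], Row Q [Save F N (Row X [Row W []]),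
   Known F N [W,X,V,U,T,S,R,Q,P,N,M,L,K,J,I,H,G,F,E,D,C,B,A], Save F P (Row N [Row X [], Row W []]), Known F
   P [X,W,V,U,T,S,R,Q,P,M,N,L,K,J,I,H,G,F,E,D,C,B,A]], Save F T (Row N [Save F Q (Row U [Row U [], Row U [],
   Row U []]), Known F Q [W,X,V,U,T,S,R,Q,P,N,M,L,K,J,I,H,G,F,E,D,C,B,A], Row U [Save F R (Row X [Known E G
   [V,X,U,T,S,R,Q,P,N,M,L,K,J,I,H,G,F,E,D,C,B,A], Known F C
   [W,V,X,T,U,S,N,M,L,R,Q,P,J,K,G,H,I,F,C,D,E,A,B]]), Known F R
   [W,X,V,U,T,S,R,Q,P,N,M,L,K,J,I,H,G,F,E,D,C,B,A]], Row M [Save F S (Row X [Known F D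
   [W,V,U,T,S,R,X,P,N,M,L,K,J,I,H,G,F,E,D,C,B,A]]), Known F S
   [W,X,V,U,T,S,R,Q,P,N,M,L,K,J,I,H,G,F,E,D,C,B,A], Row Q []]]), Known F T
   [X,W,V,U,T,S,R,Q,P,M,N,L,K,J,I,H,G,F,E,D,C,B,A]]]]"

definition cert6 :: "vertex cert" where
  "cert6 = Row T [Save F U (Row T [Save E C (Row M [Save E A (Row M [Row S [Row R [Row Q [], Row Q [], Row Q
   []]]]), Save E B (Row M [Row N [Row Q [Row V [Row W [], Row W [], Row V []]], Row Q [Row Q [Row X []],
   Known E A [U,T,S,N,M,L,R,Q,P,K,J,G,H,I,F,C,D,E,A,B], Row Q []]]]), Row M [Row Q [Row V [Row V [Row X []],
   Row V [Row X []], Row V []]]], Row M [Row Q [Known E A [U,T,S,N,M,L,R,Q,P,K,J,G,H,I,F,C,D,E,A,B], Known E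
   B [U,T,S,N,M,L,R,Q,P,K,J,G,H,I,F,C,D,E,A,B], Row Q []]]]), Known E C
   [U,T,S,R,Q,P,M,N,L,K,J,I,H,G,F,E,D,C,B,A], cert5]), Known F U [U,T,S,Q,R,P,N,M,L,K,J,I,H,G,F,E,D,C,B,A],
   Known F U [U,T,S,N,M,L,R,Q,P,K,J,G,H,I,F,C,D,E,A,B], Known F U [U,T,S,M,N,L,R,Q,P,K,J,G,H,I,F,C,D,E,A,B],
   Save F X (Row T [Row V [Save F V (Row V [Row W [Row W [Row R [Row U [], Row U []]], Row W []]]), Known F
   V [V,U,T,S,Q,R,P,N,M,L,K,J,I,H,G,F,E,D,C,B,A], Row V [Row S [Save F W (Row R [Known F U
   [T,U,S,R,Q,P,N,M,L,J,K,I,H,G,F,E,D,C,B,A]]), Known F W [X,W,V,U,T,S,Q,R,P,N,M,L,K,J,I,H,G,F,E,D,C,B,A],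
   Row S [], Row S [], Row S [], Row S []]]]]), Known F X [U,T,S,N,M,L,R,Q,P,K,J,G,H,I,F,C,D,E,A,B], Row T
   [Row U [Save G E (Row U [Known E S [V,W,T,U,S,R,Q,P,N,M,L,J,K,I,H,G,F,E,D,C,B,A], Known E S
   [V,W,T,U,S,Q,R,P,N,M,L,J,K,I,H,G,F,E,D,C,B,A], Known E S [V,W,T,U,S,N,M,L,R,Q,P,J,K,G,H,I,F,C,D,E,A,B],
   Known E S [V,W,T,U,S,M,N,L,R,Q,P,J,K,G,H,I,F,C,D,E,A,B], Row S [Save G A (Row S [Row R [], Row Q [], Row
   N [], Row M []]), Row S [Row R [], Row Q [], Row N [], Row M [], Known C U [E,C,X,V,W,H,U,T,K,S,J,F]],
   Known G A [V,W,X,T,U,S,R,Q,P,N,M,L,J,K,I,H,G,F,E,D,C,B,A], Save G D (Row S [Save G C (Row N [Save G B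
   (Row R [Row M []]), Row Q [], Known G B [V,W,X,T,U,S,R,Q,P,N,M,L,J,K,I,H,G,F,E,D,C,B,A]]), Known G C
   [X,W,V,U,T,S,R,Q,P,M,N,L,K,J,I,H,G,F,E,D,C,B,A]]), Known G D
   [X,W,V,U,T,S,Q,R,P,N,M,L,K,J,I,H,G,F,E,D,C,B,A], Known G D
   [X,W,V,U,T,S,N,M,L,R,Q,P,K,J,G,H,I,F,C,D,E,A,B], Known G D
   [X,W,V,U,T,S,M,N,L,R,Q,P,K,J,G,H,I,F,C,D,E,A,B], Known D X [R,Q,P,N,M,L,S,J,I,H,G,F,E,D,C,B,A], Row S [],
   Row S []]]), Known G E [V,W,U,T,S,R,Q,P,N,M,L,K,J,I,H,G,F,E,D,C,B,A], Known F U
   [T,U,S,R,Q,P,N,M,L,J,K,I,H,G,F,E,D,C,B,A], Known F U [T,U,S,Q,R,P,N,M,L,J,K,I,H,G,F,E,D,C,B,A], Known F U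
   [T,U,S,N,M,L,R,Q,P,J,K,G,H,I,F,C,D,E,A,B], Known F U [T,U,S,M,N,L,R,Q,P,J,K,G,H,I,F,C,D,E,A,B], Known F X
   [T,U,S,R,Q,P,N,M,L,J,K,I,H,G,F,E,D,C,B,A], Known F X [T,U,S,N,M,L,R,Q,P,J,K,G,H,I,F,C,D,E,A,B], Row U
   []]]]"

definition cert7 :: "vertex cert" where
  "cert7 = Save H F (Row J [Row J [Row K [cert6]], Save G U (Row J [Row K [Row K [Row T [Save G P (Row T [Row S
   [Save G M (Row S [Save G J (Row N [Save G H (Row R [Save G F (Row M [Row M [Row X []], Row M []]), Save G
   G (Row W [Row U [], Row Q []])]), Save G I (Row Q [Row Q [Row X []], Row Q []]), Known G H
   [U,V,W,K,S,R,Q,P,N,M,L,T,F,I,H,G,J,E,D,C,B,A], Row R [Known G G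
   [X,W,V,U,T,S,N,M,L,R,Q,P,K,J,G,H,I,F,C,D,E,A,B], Known G I [W,V,U,T,S,N,M,L,R,Q,P,K,J,G,H,I,F,C,D,E,A,B],
   Known G G [X,U,V,W,K,S,N,M,L,R,Q,P,T,F,G,H,I,J,C,D,E,A,B]]]), Known G J
   [W,V,U,T,S,R,Q,P,M,N,L,K,J,I,H,G,F,E,D,C,B,A], Row R [Save G K (Row X [Row W [Row X [], Row U []], Known
   G H [W,V,U,T,S,X,M,L,R,Q,P,K,J,G,H,I,F,C,D,E,A,B]]), Row X [Save G L (Row W [Row X [], Row X [Known G F
   [W,V,U,T,S,R,Q,P,X,M,L,K,J,I,H,G,F,E,D,C,B,A]]]), Known G L
   [X,U,V,W,K,S,R,Q,P,N,M,L,T,F,I,H,G,J,E,D,C,B,A], Known G I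
   [W,V,U,T,S,X,M,L,R,Q,P,K,J,G,H,I,F,C,D,E,A,B]], Known G K
   [X,U,V,W,K,S,R,Q,P,N,M,L,T,F,I,H,G,J,E,D,C,B,A]]]), Known G M
   [W,V,U,T,S,Q,R,P,N,M,L,K,J,I,H,G,F,E,D,C,B,A], Known G M [W,V,U,T,S,N,M,L,R,Q,P,K,J,G,H,I,F,C,D,E,A,B],
   Known G M [W,V,U,T,S,M,N,L,R,Q,P,K,J,G,H,I,F,C,D,E,A,B], Save G N (Row S [Row X []]), Known G N
   [W,V,U,T,S,N,M,L,R,Q,P,K,J,G,H,I,F,C,D,E,A,B], Row S []]]), Known G P
   [U,V,T,S,R,Q,P,N,M,L,K,J,I,H,G,F,E,D,C,B,A], Row T [Row S [Save G T (Row S [Save G S (Row N [Save G R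
   (Row Q [Save G Q (Row Q [Row M [Row V []]]), Known G Q [X,W,U,V,T,S,R,Q,P,N,M,L,K,J,I,H,G,F,E,D,C,B,A],
   Row Q []]), Known G R [W,X,V,U,T,S,R,Q,P,N,M,L,K,J,I,H,G,F,E,D,C,B,A], Known G R
   [V,U,X,W,K,S,R,Q,P,N,M,L,T,F,I,H,G,J,E,D,C,B,A], Known G R
   [U,V,X,W,K,S,R,Q,P,N,M,L,T,F,I,H,G,J,E,D,C,B,A]]), Known G S
   [X,W,V,U,T,S,R,Q,P,M,N,L,K,J,I,H,G,F,E,D,C,B,A]]), Known G T
   [X,W,V,U,T,S,Q,R,P,N,M,L,K,J,I,H,G,F,E,D,C,B,A], Known G T
   [X,W,V,U,T,S,N,M,L,R,Q,P,K,J,G,H,I,F,C,D,E,A,B], Known G T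
   [X,W,V,U,T,S,M,N,L,R,Q,P,K,J,G,H,I,F,C,D,E,A,B], Row S [], Row S []]]]]]]), Row J [Row K [Known G U
   [S,R,Q,P,N,M,L,J,K,I,H,G,F,E,D,C,B,A], Row K [Save H E (Row S [Save H C (Row S [Save H A (Row N [Save G X
   (Row R [Save G V (Row M [Row M [Row Q []], Row M []]), Save G W (Row M [Row M [Row Q [Row U [], Row T
   []]], Row M []])]), Known G X [V,W,U,T,S,R,Q,P,N,M,L,K,J,I,H,G,F,E,D,C,B,A], Known G X
   [U,T,W,V,S,R,Q,P,N,M,L,J,K,I,H,G,F,E,D,C,B,A], Known G X [T,U,W,V,S,R,Q,P,N,M,L,J,K,I,H,G,F,E,D,C,B,A],
   Row R [Known G W [X,W,V,U,T,S,N,M,L,R,Q,P,K,J,G,H,I,F,C,D,E,A,B], Known G W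
   [X,V,W,U,T,S,N,M,L,R,Q,P,K,J,G,H,I,F,C,D,E,A,B], Known G W
   [X,U,T,W,V,S,N,M,L,R,Q,P,J,K,G,H,I,F,C,D,E,A,B], Known G W
   [X,T,U,W,V,S,N,M,L,R,Q,P,J,K,G,H,I,F,C,D,E,A,B]]]), Known H A
   [W,V,U,T,S,R,Q,P,M,N,L,K,J,I,H,G,F,E,D,C,B,A], Row R [Save H B (Row X [Row X [Known G V
   [V,W,U,T,S,R,Q,P,X,M,L,K,J,I,H,G,F,E,D,C,B,A]], Known G X
   [W,V,U,T,S,X,M,L,R,Q,P,K,J,G,H,I,F,C,D,E,A,B]]), Known H B
   [X,V,W,U,T,S,R,Q,P,N,M,L,K,J,I,H,G,F,E,D,C,B,A], Known H B
   [X,U,T,W,V,S,R,Q,P,N,M,L,J,K,I,H,G,F,E,D,C,B,A], Known H B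
   [X,T,U,W,V,S,R,Q,P,N,M,L,J,K,I,H,G,F,E,D,C,B,A]]]), Known H C
   [W,V,U,T,S,Q,R,P,N,M,L,K,J,I,H,G,F,E,D,C,B,A], Known H C [W,V,U,T,S,N,M,L,R,Q,P,K,J,G,H,I,F,C,D,E,A,B],
   Known H C [W,V,U,T,S,M,N,L,R,Q,P,K,J,G,H,I,F,C,D,E,A,B], Known D X [R,Q,P,N,M,L,S,J,I,H,G,F,E,D,C,B,A],
   Save H D (Row S [Row X []]), Known H D [W,V,U,T,S,N,M,L,R,Q,P,K,J,G,H,I,F,C,D,E,A,B], Row S []])]]]])"

text \<open>In \<open>H K\<close> the edge between \<open>G\<close> and \<open>I\<close> makes the
  5-cycles \<open>A C H E B\<close> and \<open>C G I E H\<close> overlap in the path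
  \<open>C H E\<close>. Here \<open>G\<close> has obtained a new third neighbour.\<close>

definition cert8 :: "vertex cert" where
  "cert8 = Save H J (Row L [Save H I (Row L [Save H H (Row I [Known C V [L,C,D,H,G,E,A,I,B], Save H G (Row P
   [Row P [Row H [Save D X (Row K [Row J [Row J [Save D W (Row S [Save D L (Row S [Save D K (Row U [Save D C
   (Row V [Save D B (Row W [Save D A (Row W [Save C W (Row T [Row T [Row X []], Row T [Row N [Row X [Known C
   V [V,S,H,X,U,T,K,J,F], Row X [], Row X []], Row Q []]], Row T []]), Known C W
   [W,V,U,T,S,R,Q,P,M,N,L,K,J,I,H,G,F,E,D,C,B,A], Row T [Row T [Save C X (Row N [Row M [Row Q []]]), Known C
   X [X,W,V,U,T,S,R,Q,P,M,N,L,K,J,I,H,G,F,E,D,C,B,A]], Row T [], Row T [], Row T []]]), Known D A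
   [W,V,U,T,S,Q,R,P,N,M,L,K,J,I,H,G,F,E,D,C,B,A], Known D A [W,V,U,T,S,N,M,L,R,Q,P,K,J,G,H,I,F,C,D,E,A,B],
   Known D A [W,V,U,T,S,M,N,L,R,Q,P,K,J,G,H,I,F,C,D,E,A,B], Known C V [T,F,H,W,J,V,K,U,S], Row W []])]),
   Save D G (Row V [Row V [Row W [Known C V [T,J,D,W,U,V,F,S,K], Row W []]], Row V [Save D F (Row T [Save D
   E (Row R [Row Q [Row N [], Row M []], Save D D (Row N [Row M [], Row Q []]), Known D D
   [X,W,V,U,T,S,R,Q,P,M,N,L,K,J,I,H,G,F,E,D,C,B,A]]), Known D E
   [X,W,V,U,T,S,Q,R,P,N,M,L,K,J,I,H,G,F,E,D,C,B,A], Known D E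
   [X,W,V,U,T,S,N,M,L,R,Q,P,K,J,G,H,I,F,C,D,E,A,B], Known D E
   [X,W,V,U,T,S,M,N,L,R,Q,P,K,J,G,H,I,F,C,D,E,A,B]])]]), Row V [Row V [Known C V [W,J,D,T,U,V,F,S,K], Save D
   J (Row W [Known D C [W,U,T,S,R,Q,P,N,M,L,K,J,I,H,G,F,E,D,C,B,A], Save D I (Row W [Save D H (Row N [Row R
   [Row Q []], Row M [], Row Q []]), Known D H [X,W,V,U,T,S,R,Q,P,M,N,L,K,J,I,H,G,F,E,D,C,B,A], Known D E
   [X,T,V,U,W,S,R,Q,P,N,M,L,K,J,I,H,G,F,E,D,C,B,A]]), Known D I
   [X,W,V,U,T,S,Q,R,P,N,M,L,K,J,I,H,G,F,E,D,C,B,A], Known D I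
   [X,W,V,U,T,S,N,M,L,R,Q,P,K,J,G,H,I,F,C,D,E,A,B], Known D I
   [X,W,V,U,T,S,M,N,L,R,Q,P,K,J,G,H,I,F,C,D,E,A,B], Known D F
   [X,T,V,U,W,S,R,Q,P,N,M,L,K,J,I,H,G,F,E,D,C,B,A]])], Row V [Row X [Row X [Known A J
   [W,D,J,T,U,F,S,X,K,V]], Known C V [W,J,D,X,U,V,F,S,K]]], Row V []]])]), Known D L
   [T,U,S,R,Q,P,N,M,L,K,J,I,H,G,F,E,D,C,B,A], Row S [cert4]])]]]), Known D X
   [R,Q,P,N,M,L,J,K,I,H,G,F,E,D,C,B,A], cert7]]])])])])"

definition cert9 :: "vertex cert" where
  "cert9 = Save I L (Row T [Save H V (Row S [Save H S (Row V [Save H R (Row V [Row Q [Row X [], Row P [Save H Q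
   (Row R [Row X []])]]]), Known H R [W,V,U,T,S,R,P,Q,N,M,L,K,J,I,H,G,F,E,D,C,B,A], Row V []]), Known H H
   [J,F,K,H,B,V,W,S,E,U,I,T,N,M], Save H T (Row V [Row V [Row X []], Row V [Row Q [Row R [], Row P []]], Row
   V []]), Known H T [W,V,U,T,S,R,P,Q,N,M,L,K,J,I,H,G,F,E,D,C,B,A], Row V [Row V [Save H U (Row Q [Row P
   [Known H Q [X,W,S,T,U,V,R,K,J,M,N,F,Q,P,I,B,D,L,E,G,A,H,C]]]), Known H U
   [X,W,V,U,T,S,R,P,Q,N,M,L,K,J,I,H,G,F,E,D,C,B,A]], Row V [], Row V [], Row V []]]), Known H V
   [V,W,U,T,S,R,Q,P,N,M,L,K,J,I,H,G,F,E,D,C,B,A], Row R [Save I A (Row S [Save H W (Row W [Row X []]), Known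
   H W [W,V,U,T,S,R,P,Q,N,M,L,K,J,I,H,G,F,E,D,C,B,A], Save H X (Row W [Row V [], Row V []])]), Known I A
   [V,W,U,T,S,R,Q,P,N,M,L,K,J,I,H,G,F,E,D,C,B,A], Save I C (Row Q [Row P [Save I B (Row S [Known H W
   [W,V,U,T,R,S,Q,P,N,M,L,J,K,I,H,G,F,E,D,C,B,A], Known H W
   [V,W,U,T,R,S,Q,P,N,M,L,J,K,I,H,G,F,E,D,C,B,A]])], Row P [Row P [], Row P [], Row P []]]), Known I C
   [W,V,U,T,S,R,P,Q,N,M,L,K,J,I,H,G,F,E,D,C,B,A], Row S [Known H X
   [X,W,V,U,T,R,S,Q,P,N,M,L,J,K,I,H,G,F,E,D,C,B,A], Known H X
   [X,V,W,U,T,R,S,Q,P,N,M,L,J,K,I,H,G,F,E,D,C,B,A], Known I C [W,V,U,T,R,S,Q,P,N,M,L,J,K,I,H,G,F,E,D,C,B,A],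
   Known I C [W,V,U,T,R,S,P,Q,N,M,L,J,K,I,H,G,F,E,D,C,B,A]]], Row S [Row X [Known H S
   [X,V,U,T,S,R,Q,P,N,M,L,K,J,I,H,G,F,E,D,C,B,A], Row R [Save I E (Row Q [Row P [Save I D (Row W [Row V [],
   Known H Q [V,H,U,W,G,C,E,N,I,P,L,M,A,B,Q,X,T,D,R,F,S,J,K]]), Known I D
   [X,V,W,U,T,S,R,Q,P,N,M,L,K,J,I,H,G,F,E,D,C,B,A]]]), Known I E
   [X,W,V,U,T,S,R,P,Q,N,M,L,K,J,I,H,G,F,E,D,C,B,A]], Save I F (Row Q [Row P []]), Known I F
   [X,W,V,U,T,S,R,P,Q,N,M,L,K,J,I,H,G,F,E,D,C,B,A]], Save I H (Row V [Row W [Row R [Row X [], Row X []], Row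
   V [], Row V []], Save I G (Row Q [Row P [Known I A [S,X,T,U,V,W,K,J,M,N,F,Q,P,I,B,D,L,E,G,A,H,C], Row V
   [Row W []]]]), Known I G [X,W,V,U,T,S,R,P,Q,N,M,L,K,J,I,H,G,F,E,D,C,B,A], Row V []]), Known I H
   [X,V,W,U,T,S,R,Q,P,N,M,L,K,J,I,H,G,F,E,D,C,B,A], Save I I (Row Q [Row R [Known H H
   [N,I,M,B,A,X,Q,T,D,R,F,S,J,K]], Row P [Known I B [R,W,V,U,T,X,S,K,J,N,M,F,P,Q,I,B,D,L,E,G,A,H,C]]]),
   Known I I [X,W,V,U,T,S,R,P,Q,N,M,L,K,J,I,H,G,F,E,D,C,B,A], Row X [Save I K (Row W [Save I J (Row Q [Row X
   []]), Known I J [X,W,V,U,T,S,R,P,Q,N,M,L,K,J,I,H,G,F,E,D,C,B,A]]), Known I K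
   [X,V,W,U,T,S,R,Q,P,N,M,L,K,J,I,H,G,F,E,D,C,B,A], Row X [], Row X []]]])"

definition cert10 :: "vertex cert" where
  "cert10 = Save J H (Row M [Row M [Save I S (Row N [Row T [Save I M (Row U [Row U [Row T [Row R [Save H N (Row
   R [Save H L (Row W [Row V [], Row Q [Row P []], Row Q [Row P [Row X []]]]), Known H L
   [W,V,U,T,S,R,P,Q,N,M,L,K,J,I,H,G,F,E,D,C,B,A], Row X [Save H M (Row X [Known H L
   [W,V,U,T,S,R,X,P,N,M,L,K,J,I,H,G,F,E,D,C,B,A]]), Known H M
   [X,W,V,U,T,S,R,P,Q,N,M,L,K,J,I,H,G,F,E,D,C,B,A], Known H L
   [W,V,U,T,S,R,X,P,N,M,L,K,J,I,H,G,F,E,D,C,B,A]]]), Known H N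
   [V,W,T,U,S,R,Q,P,M,N,L,K,J,I,H,G,F,E,D,C,B,A], Save H P (Row R [Row Q [Row X [Row P [Row P [], Row P
   []]], Row X [], Row P []]]), Known H P [W,V,U,T,S,R,P,Q,N,M,L,K,J,I,H,G,F,E,D,C,B,A], Row R [Row X []],
   Row R [Row X []], Row R []]]], Row U [cert9]]), Known I M [U,T,R,S,Q,P,N,M,L,J,K,I,H,G,F,E,D,C,B,A], Row T
   [Row U [Save I R (Row U [Known H V [W,V,T,U,S,R,Q,P,M,N,L,K,J,I,H,G,F,E,D,C,B,A], Known H V
   [W,V,T,U,R,S,Q,P,M,N,L,J,K,I,H,G,F,E,D,C,B,A], Row R [Save I P (Row R [Save I N (Row Q [Row P [Row P [],
   Row P [], Row P []], Row S [], Row P [Known H L [X,V,T,U,W,R,J,K,M,N,F,P,Q,I,B,D,L,E,G,A,H,C]]]), Known I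
   N [X,W,V,U,T,S,R,P,Q,N,M,L,K,J,I,H,G,F,E,D,C,B,A]]), Row R [Save I Q (Row Q [Row P [Row P [], Row P [],
   Row P [], Row P []], Row S [], Row P [Known H V [W,V,T,U,X,R,K,J,M,N,F,P,Q,I,B,D,L,E,G,A,H,C], Known H V
   [W,X,U,T,V,R,K,J,N,M,F,P,Q,I,B,D,L,E,G,A,H,C]]]), Known I Q
   [X,W,V,U,T,S,R,P,Q,N,M,L,K,J,I,H,G,F,E,D,C,B,A]], Known I P
   [V,W,X,T,U,S,R,Q,P,M,N,L,K,J,I,H,G,F,E,D,C,B,A], Row R [], Row R [], Row R [], Row R []]]), Known I R
   [V,W,U,T,S,R,Q,P,N,M,L,K,J,I,H,G,F,E,D,C,B,A], Known I L [W,V,T,U,S,R,Q,P,M,N,L,K,J,I,H,G,F,E,D,C,B,A],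
   Known I L [W,V,T,U,R,S,Q,P,M,N,L,J,K,I,H,G,F,E,D,C,B,A], Row U []]]]])], Save J B (Row M [Row N [Row N
   [Row T [Save I X (Row T [Row P [Save I W (Row Q [Row Q [Save I U (Row S [Save I T (Row V [Row U [], Row U
   []]), Row R [Row R [], Row R [], Row R [], Row R []], Known I T
   [X,U,V,W,N,S,R,Q,P,T,I,L,K,J,M,H,G,F,E,D,C,B,A]])], Save I V (Row Q [Row X []]), Row Q []]), Known I W
   [W,V,U,T,R,S,Q,P,N,M,L,J,K,I,H,G,F,E,D,C,B,A], Row P [Row Q [Known I U
   [X,W,V,U,T,S,R,P,Q,N,M,L,K,J,I,H,G,F,E,D,C,B,A], Known I U
   [X,W,V,U,T,R,S,P,Q,N,M,L,J,K,I,H,G,F,E,D,C,B,A]]], Row P [Row Q [Known I V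
   [W,V,U,T,S,R,P,Q,N,M,L,K,J,I,H,G,F,E,D,C,B,A], Known I V [W,V,U,T,R,S,P,Q,N,M,L,J,K,I,H,G,F,E,D,C,B,A]]],
   Row P []]]), Known I X [U,V,T,S,R,Q,P,N,M,L,K,J,I,H,G,F,E,D,C,B,A], Row T [Row P [Save J A (Row P [Row Q
   [Row Q [], Row Q []], Row Q []]), Known J A [X,W,V,U,T,R,S,Q,P,N,M,L,J,K,I,H,G,F,E,D,C,B,A], Row P [],
   Row P []]]]]]]), Known H J [N,K,J,M,H,I,F,C,D,E,A,B], Known H J [N,Q,P,M,B,I,L,A,G,E,C,H], Row M [Row N
   [Known J B [S,R,Q,P,M,N,L,K,J,I,H,G,F,E,D,C,B,A], Known H H [U,T,M,K,J,N,H,I,F,C,D,E,A,B], Known H H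
   [U,T,M,Q,P,N,B,I,L,A,G,E,C,H], Row N [Row P [Save J G (Row Q [Row Q [Save J E (Row S [Save J D (Row V
   [Row V [Save J C (Row U [Row T []]), Known J C [X,W,V,T,U,S,R,Q,P,N,M,L,K,J,I,H,G,F,E,D,C,B,A]], Row V
   [], Row V [], Known I S [W,S,R,Q,P,V,N,L,K,J,I,H,G,F,E,D,C,B,A]]), Known J D
   [X,V,W,U,T,S,R,Q,P,N,M,L,K,J,I,H,G,F,E,D,C,B,A], Known J D
   [X,U,T,W,V,S,R,Q,P,M,N,L,K,J,I,H,G,F,E,D,C,B,A], Known J D
   [X,T,U,W,V,S,R,Q,P,M,N,L,K,J,I,H,G,F,E,D,C,B,A]])], Save J F (Row Q [Row X []]), Row Q []]), Known J G
   [W,V,U,T,R,S,Q,P,N,M,L,J,K,I,H,G,F,E,D,C,B,A], Row P [Row Q [Known J E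
   [X,W,V,U,T,S,R,P,Q,N,M,L,K,J,I,H,G,F,E,D,C,B,A], Known J E
   [X,W,V,U,T,R,S,P,Q,N,M,L,J,K,I,H,G,F,E,D,C,B,A]]], Row P [Row Q [Known J F
   [W,V,U,T,S,R,P,Q,N,M,L,K,J,I,H,G,F,E,D,C,B,A], Known J F [W,V,U,T,R,S,P,Q,N,M,L,J,K,I,H,G,F,E,D,C,B,A]]],
   Row P []]]]]])"

text \<open>This belongs to \<open>J W\<close>, where the edge between \<open>G\<close> and
  \<open>H\<close> creates a second triangle \<open>C G H\<close> on the 5-cycle
  \<open>A C H E B\<close>.\<close>

definition cert11 :: "vertex cert" where
  "cert11 = Row J [Row J [Row K [cert10]], Save J M (Row J [Row K [Row K [Row R [Save J K (Row R [Row M [Row M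
   [Row N [Row V [Save J I (Row V [Row W [Row W [], Row W [], Row W []]]), Row V [Row W [Row W [], Row W
   []]], Known J I [W,V,S,T,U,K,Q,P,N,M,L,R,F,I,H,G,J,E,D,C,B,A], Row V []]]], Save J J (Row M [Row N [Row N
   [Row V [Row V [], Row V []]]]]), Known H J [N,K,J,M,H,I,F,C,D,E,A,B], Known H J
   [N,Q,P,M,B,I,L,A,G,E,C,H], Row M [Row N [Known J J [U,T,S,R,Q,P,M,N,L,K,J,I,H,G,F,E,D,C,B,A], Known H H
   [W,V,M,K,J,N,H,I,F,C,D,E,A,B], Known H H [W,V,M,Q,P,N,B,I,L,A,G,E,C,H], Row N []]]]]), Known J K
   [S,T,R,Q,P,N,M,L,K,J,I,H,G,F,E,D,C,B,A], Row R [Row M [Row M [Row N [Row W [Row W [], Row W [], Row W [],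
   Row W []]]], Save J L (Row M [Row N []]), Known H J [N,K,J,M,H,I,F,C,D,E,A,B], Known H J
   [N,Q,P,M,B,I,L,A,G,E,C,H], Row M [Row N [Known J L [V,U,T,S,R,Q,P,M,N,L,K,J,I,H,G,F,E,D,C,B,A], Known H H
   [X,W,M,K,J,N,H,I,F,C,D,E,A,B], Known H H [X,W,M,Q,P,N,B,I,L,A,G,E,C,H]]]]]]]]]), Row J [Row K [Known J M
   [Q,P,N,M,L,J,K,I,H,G,F,E,D,C,B,A], Row K [Row M [Row M [Row N [Row V [Save J R (Row V [Save J Q (Row W
   [Save J P (Row W [Save J N (Row X [Row S [Row R [Row T [Row X [], Row X []], Row X [], Row X []], Row X
   [], Row X []], Known H H [R,F,J,H,B,X,U,S,E,W,I,V,N,M], Row X [], Row X [], Row X []])]), Known J P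
   [W,V,S,R,U,T,Q,P,N,M,L,J,K,I,H,G,F,E,D,C,B,A], Row W []]), Known J Q
   [W,V,U,T,R,S,Q,P,N,M,L,K,J,I,H,G,F,E,D,C,B,A], Row W [Row W [], Row W [Known J N
   [X,V,W,U,T,S,R,Q,P,M,N,L,K,J,I,H,G,F,E,D,C,B,A], Known J N
   [X,V,W,U,T,R,S,Q,P,M,N,L,K,J,I,H,G,F,E,D,C,B,A]], Row W [], Row W []]]), Known J R
   [W,V,T,U,S,R,Q,P,N,M,L,K,J,I,H,G,F,E,D,C,B,A], Known J R [W,V,S,R,U,T,Q,P,N,M,L,J,K,I,H,G,F,E,D,C,B,A],
   Known J R [W,V,R,S,U,T,Q,P,N,M,L,J,K,I,H,G,F,E,D,C,B,A], Row V []]]], Save J S (Row M [Row N [Row N [Row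
   V [Row V [], Row V []]]]]), Known H J [N,K,J,M,H,I,F,C,D,E,A,B], Known H J [N,Q,P,M,B,I,L,A,G,E,C,H], Row
   M [Row N [Known J S [U,T,S,R,Q,P,M,N,L,K,J,I,H,G,F,E,D,C,B,A], Known H H [W,V,M,K,J,N,H,I,F,C,D,E,A,B],
   Known H H [W,V,M,Q,P,N,B,I,L,A,G,E,C,H], Row N []]]]]]]]"

definition cert12 :: "vertex cert" where
  "cert12 = Row S [Save L E (Row S [Row Q [Save K V (Row Q [Save K U (Row U [Known J V
   [Q,B,A,T,U,V,D,R,F,S,J,K], Known J W [B,A,V,U,T,D,S,F,R,K,J], Row T [Known H H
   [W,H,Q,B,A,T,U,V,D,R,F,S,J,K], Row T [], Row T [], Row T [], Row T [], Known K G
   [B,A,V,U,T,D,S,F,R,K,J]]])]), Row Q [Known C U [E,C,V,T,U,H,S,R,K,Q,J,F], Known C S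
   [V,K,T,J,P,N,M,L,S,R,I,G,H,U,E,C,B,Q,A,D], Row T [Known H K [B,A,V,U,T,D,S,F,R,K,J], Known J W
   [B,A,V,U,T,D,S,F,R,K,J], Known K G [B,A,V,U,T,D,S,F,R,K,J], Row T []]], Known K V
   [T,U,V,R,S,Q,P,N,M,L,J,K,I,H,G,F,E,D,C,B,A], Known K R [R,K,P,N,M,L,Q,J,I,H,G,F,E,D,C,B,A], Known J W
   [K,J,G,H,Q,F,C,D,E,A,B], Known C V [I,H,G,Q,E,D,C,B,A], Known J W [K,J,I,H,Q,F,E,D,C,B,A], Row Q [Row L
   [Save L C (Row L [Save K W (Row X [Row M [Row M [], Row M []], Row M [Row M [], Row M []]]), Row X [Row M
   [Row M [], Row M [], Row M []], Row M [Row M [], Row M [], Row M []]], Known K W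
   [X,W,T,U,V,R,S,Q,P,N,M,L,J,K,I,H,G,F,E,D,C,B,A], Row M [Row W [Save K X (Row X [Known H H
   [J,F,K,H,A,V,Q,S,C,W,G,X,M,L]]), Row X [], Known K X [X,W,T,U,V,R,S,Q,P,N,M,L,J,K,I,H,G,F,E,D,C,B,A],
   Known K U [X,W,U,T,S,R,Q,P,N,M,L,K,J,I,H,G,F,E,D,C,B,A], Known K U
   [X,W,U,V,R,S,Q,P,N,M,L,J,K,I,H,G,F,E,D,C,B,A]], Save L A (Row V [Known J V [M,B,A,T,U,V,D,R,F,S,J,K],
   Known H H [L,G,M,B,A,T,U,V,D,R,F,S,J,K]]), Save L B (Row W [Row W [], Row W []]), Known L A
   [X,W,T,U,V,R,S,Q,P,N,M,L,J,K,I,H,G,F,E,D,C,B,A]]]), Known L C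
   [W,X,V,U,T,S,R,Q,P,N,M,L,K,J,I,H,G,F,E,D,C,B,A], Save L D (Row L [Row M [Known L A
   [X,W,V,U,T,S,R,Q,P,N,L,M,K,J,I,H,G,F,E,D,C,B,A], Known L A
   [W,X,V,U,T,S,R,Q,P,N,L,M,K,J,I,H,G,F,E,D,C,B,A]]]), Row L [Row M [Known L B
   [X,W,V,U,T,S,R,Q,P,N,L,M,K,J,I,H,G,F,E,D,C,B,A], Known L B
   [W,X,V,U,T,S,R,Q,P,N,L,M,K,J,I,H,G,F,E,D,C,B,A]]], Known L D
   [X,W,T,U,V,R,S,Q,P,N,M,L,J,K,I,H,G,F,E,D,C,B,A], Row L [Known J W [K,J,H,G,M,F,C,D,L,A,B]], Known H J
   [M,K,J,L,H,G,F,E,D,C,B,A], Row L [], Row L []]]]]), Known L E [T,U,S,R,Q,P,N,M,L,K,J,I,H,G,F,E,D,C,B,A],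
   Known K T [R,S,Q,P,N,M,L,J,K,I,H,G,F,E,D,C,B,A], Known K T [R,S,Q,M,L,P,N,J,K,G,H,I,F,C,D,E,A,B], Row S
   [Row L [Save L M (Row L [Save L L (Row M [Save L I (Row V [Save L G (Row W [Save L F (Row U [Row T [],
   Row T []])]), Known L G [W,V,T,U,S,R,Q,P,N,M,L,K,J,I,H,G,F,E,D,C,B,A], Save L H (Row W [Known L F
   [X,V,W,U,T,S,R,Q,P,N,L,M,K,J,I,H,G,F,E,D,C,B,A], Known L F
   [X,V,W,T,U,S,R,Q,P,N,L,M,K,J,I,H,G,F,E,D,C,B,A]])]), Save L K (Row X [Row X [Known L H
   [V,W,X,U,T,S,R,Q,P,N,M,L,K,J,I,H,G,F,E,D,C,B,A], Row Q [Known H H [J,F,K,H,A,V,Q,S,C,X,G,W,M,L]]], Save L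
   J (Row X [Known L G [W,X,U,T,S,R,Q,P,N,M,L,K,J,I,H,G,F,E,D,C,B,A], Row U [Row T [], Row P [], Row N
   []]]), Known L J [X,W,V,T,U,S,R,Q,P,N,M,L,K,J,I,H,G,F,E,D,C,B,A], Known L I
   [W,X,U,T,S,R,Q,P,N,M,L,K,J,I,H,G,F,E,D,C,B,A], Row X []])]), Row X [Row X [Row Q [Known J H
   [S,R,W,L,P,N,X,K,J,I,H,Q,F,E,D,C,B,A]]], Row X [Row Q [], Known L I
   [W,V,U,T,S,R,Q,P,N,X,L,K,J,I,H,G,F,E,D,C,B,A]], Row X [], Known L L
   [W,V,U,T,S,R,Q,P,N,X,L,K,J,I,H,G,F,E,D,C,B,A]]]), Known L M
   [V,W,U,T,S,R,Q,P,N,M,L,K,J,I,H,G,F,E,D,C,B,A], Known L M [U,T,W,V,R,S,Q,P,N,M,L,J,K,I,H,G,F,E,D,C,B,A],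
   Known L M [T,U,W,V,R,S,Q,P,N,M,L,J,K,I,H,G,F,E,D,C,B,A], Row L [Known J W [K,J,H,G,M,F,C,D,L,A,B], Row M
   [Known L K [X,W,V,U,T,S,R,Q,P,N,L,M,K,J,I,H,G,F,E,D,C,B,A], Known L K
   [X,V,W,U,T,S,R,Q,P,N,L,M,K,J,I,H,G,F,E,D,C,B,A], Known L K
   [X,U,T,W,V,R,S,Q,P,N,L,M,J,K,I,H,G,F,E,D,C,B,A], Known L K
   [X,T,U,W,V,R,S,Q,P,N,L,M,J,K,I,H,G,F,E,D,C,B,A], Known J T [Q,E,X,K,J,H,G,L,F,C,D,M,A,B]]], Known H J
   [M,K,J,L,H,G,F,E,D,C,B,A], Row L [Row M [Known L M [W,V,U,T,S,R,Q,P,N,L,M,K,J,I,H,G,F,E,D,C,B,A], Known L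
   M [V,W,U,T,S,R,Q,P,N,L,M,K,J,I,H,G,F,E,D,C,B,A], Known L M [U,T,W,V,R,S,Q,P,N,L,M,J,K,I,H,G,F,E,D,C,B,A],
   Known L M [T,U,W,V,R,S,Q,P,N,L,M,J,K,I,H,G,F,E,D,C,B,A], Row M []]], Row L [Row X [Known J W
   [K,J,H,G,X,F,C,D,L,A,B], Known K G [K,J,H,G,X,F,C,D,L,A,B]]], Row L []]]]"

definition cert13 :: "vertex cert" where
  "cert13 = Save L W (Row J [Row J [Row K [Row R [Save K T (Row R [Known J V [S,H,G,T,J,K,C,R,A,F,B,D]]), Known
   K T [S,R,Q,M,L,P,N,K,J,G,H,I,F,C,D,E,A,B], Row R [cert12]]]], Save L R (Row J [Row K [Row K [Row R [Save L P
   (Row R [Row Q [Known J W [K,J,G,H,Q,F,C,D,E,A,B], Known C V [I,H,G,Q,E,D,C,B,A], Known J W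
   [K,J,I,H,Q,F,E,D,C,B,A], Row Q [Row S [Save L N (Row S [Known H I [Q,W,C,B,U,T,S,A,R,D,K,J,F], Known J V
   [W,C,B,U,T,S,A,R,D,K,J,F], Row T [Row U [Known J W [C,B,S,T,U,A,K,D,R,F,J], Known K G
   [C,B,S,T,U,A,K,D,R,F,J]], Known J W [C,B,S,T,U,A,K,D,R,F,J]]]), Known L N
   [V,W,U,T,S,R,Q,P,N,M,L,K,J,I,H,G,F,E,D,C,B,A], Known H K [C,B,U,T,S,A,R,D,K,J,F], Known J W
   [C,B,U,T,S,A,R,D,K,J,F], Known K G [C,B,U,T,S,A,R,D,K,J,F], Row S []]]]]), Known L P
   [S,T,R,Q,P,N,M,L,K,J,I,H,G,F,E,D,C,B,A], Row R [Row Q [Known J W [K,J,G,H,Q,F,C,D,E,A,B], Known C V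
   [I,H,G,Q,E,D,C,B,A], Known J W [K,J,I,H,Q,F,E,D,C,B,A], Row Q [Row L [Save L Q (Row L [Row M [Row N [Row
   N [Known J W [K,J,H,I,P,F,E,D,N,B,A]], Row N [], Known H J [P,K,J,N,H,I,F,C,D,E,A,B], Row N []]]]), Known
   L Q [W,X,V,U,T,S,R,Q,P,N,M,L,K,J,I,H,G,F,E,D,C,B,A], Row L [Known J W [K,J,H,G,M,F,C,D,L,A,B]], Known H J
   [M,K,J,L,H,G,F,E,D,C,B,A], Row L [], Row L []]]]]]]]]), Row J [Row K [Known L R
   [Q,P,N,M,L,J,K,I,H,G,F,E,D,C,B,A], Row K [Row Q [Known K R [S,R,P,N,M,L,Q,J,I,H,G,F,E,D,C,B,A], Known J W
   [K,J,G,H,Q,F,C,D,E,A,B], Known C V [I,H,G,Q,E,D,C,B,A], Known J W [K,J,I,H,Q,F,E,D,C,B,A], Row Q [Row L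
   [Save L V (Row L [Row M [Save L S (Row N [Row N [Known J W [K,J,H,I,P,F,E,D,N,B,A], Row P [Known J T
   [Q,C,X,K,J,H,I,N,F,E,D,P,B,A]]], Row N [Row P []], Known H J [P,K,J,N,H,I,F,C,D,E,A,B], Row N [Row P []],
   Row N []]), Save L U (Row W [Save L T (Row X [Row X [], Row X [], Known L S
   [W,X,U,T,S,R,Q,P,N,M,L,K,J,I,H,G,F,E,D,C,B,A]]), Known L T
   [X,W,V,T,U,S,R,Q,P,N,M,L,K,J,I,H,G,F,E,D,C,B,A], Known L T
   [X,W,V,S,R,U,T,Q,P,N,M,L,J,K,I,H,G,F,E,D,C,B,A], Known L T
   [X,W,V,R,S,U,T,Q,P,N,M,L,J,K,I,H,G,F,E,D,C,B,A]])], Row M [Row M [], Known H H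
   [X,W,L,K,J,M,H,G,F,E,D,C,B,A], Row M []]]), Known L V [V,W,U,T,S,R,Q,P,N,M,L,K,J,I,H,G,F,E,D,C,B,A], Row
   L [Known J W [K,J,H,G,M,F,C,D,L,A,B], Row M [Known L U [X,W,V,U,T,S,R,Q,P,N,L,M,K,J,I,H,G,F,E,D,C,B,A],
   Known L U [X,V,W,U,T,S,R,Q,P,N,L,M,K,J,I,H,G,F,E,D,C,B,A], Known J T [Q,E,X,K,J,H,G,L,F,C,D,M,A,B]]],
   Known H J [M,K,J,L,H,G,F,E,D,C,B,A], Row L [Row M [Known L V
   [W,V,U,T,S,R,Q,P,N,L,M,K,J,I,H,G,F,E,D,C,B,A], Known L V [V,W,U,T,S,R,Q,P,N,L,M,K,J,I,H,G,F,E,D,C,B,A],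
   Row M []]], Row L [Row M []], Row L []]]]]]]])"

text \<open>\<open>G\<close> now has two new neighbours \<open>L\<close> and \<open>M\<close>; its
  edges to \<open>I\<close>, \<open>H\<close> and \<open>A\<close> are excluded by
  \<open>H K\<close>, \<open>J W\<close> and \<open>K G\<close>.\<close>

definition cert14 :: "vertex cert" where
  "cert14 = Save M B (Row I [Known J W [K,J,G,H,I,F,C,D,E,A,B], Known K G [K,J,G,H,I,F,C,D,E,A,B], Save M A
   (Row I [Save L X (Row H [Save K S (Row J [Row J [Save K R (Row K [Known B V
   [R,Q,P,N,M,L,J,I,G,H,F,E,C,B,K,A,D], Row L [Save K N (Row L [Row M [Row T [Save K J (Row T [Row U [Row U
   [Row S [Row S [Save K H (Row Q [Row X [], Row X [Row X [], Row X [], Known J W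
   [V,L,D,K,X,T,F,R,S,J,Q]]])], Row S [Save K I (Row Q [Row Q [], Row Q []])], Row S [Row X []], Row S []]],
   Row U [Row S [Row S [Row Q [Row X [], Row X [Row X [], Row X [], Known J W [V,L,D,K,X,T,F,R,S,J,Q]]]],
   Row S [Row Q [Row Q [], Row Q []]], Row S [Row X []], Row S []]], Row U [Row S [Row S [], Row S [], Row S
   []]]]]), Known K J [U,T,S,Q,R,P,N,M,L,K,J,I,H,G,F,E,D,C,B,A], Row T [Row S [Save K L (Row S [Row U [Save
   K K (Row U [Known K H [X,V,W,T,U,S,Q,R,P,N,L,M,K,J,I,H,G,F,E,D,C,B,A]]), Known K K
   [X,V,W,U,T,S,R,Q,P,N,M,L,K,J,I,H,G,F,E,D,C,B,A], Known K J [T,U,S,Q,R,P,N,L,M,K,J,I,H,G,F,E,D,C,B,A]]]),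
   Known K L [W,V,U,T,S,Q,R,P,N,M,L,K,J,I,H,G,F,E,D,C,B,A], Row S [Row U [Save K M (Row U [Known K I
   [X,V,W,T,U,S,R,Q,P,N,L,M,K,J,I,H,G,F,E,D,C,B,A], Known K I
   [X,V,W,T,U,S,Q,R,P,N,L,M,K,J,I,H,G,F,E,D,C,B,A]]), Known K M
   [X,V,W,U,T,S,R,Q,P,N,M,L,K,J,I,H,G,F,E,D,C,B,A], Known K J [T,U,S,R,Q,P,N,L,M,K,J,I,H,G,F,E,D,C,B,A],
   Known K J [T,U,S,Q,R,P,N,L,M,K,J,I,H,G,F,E,D,C,B,A]]], Row S [Row X []], Row S []]]]]]), Known H J
   [M,K,J,L,H,G,F,E,D,C,B,A], Save K Q (Row L [Row M [Row M [Row T [Save K P (Row T [Row N [Known K N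
   [S,R,Q,M,L,P,N,K,J,G,H,I,F,C,D,E,A,B], Row P [], Known H J [P,K,J,N,H,I,F,C,D,E,A,B], Row N []]]), Known
   K P [U,V,T,S,R,Q,P,N,M,L,K,J,I,H,G,F,E,D,C,B,A], Row T [Row N [Known K N
   [S,R,Q,M,L,P,N,K,J,G,H,I,F,C,D,E,A,B], Row N [], Known H J [P,K,J,N,H,I,F,C,D,E,A,B]]]]]]]), Row L [Row M
   [Known H H [U,T,L,K,J,M,H,G,F,E,D,C,B,A], Known K Q [S,R,Q,P,N,L,M,K,J,I,H,G,F,E,D,C,B,A], Row M [Row N
   [Known K N [S,R,Q,M,L,P,N,K,J,G,H,I,F,C,D,E,A,B], Known K Q [S,R,Q,M,L,P,N,K,J,G,H,I,F,C,D,E,A,B], Known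
   H J [P,K,J,N,H,I,F,C,D,E,A,B], Row N []]]]]]])]]), Known K S [P,N,M,L,J,K,I,H,G,F,E,D,C,B,A], cert13])])])"

section \<open>Triangles after the exclusion of adjacent 5-cycles\<close>

definition cert15 :: "vertex cert" where
  "cert15 = Row R [Save M S (Row R [Row H [Save M L (Row T [Row T [Row P [Save M G (Row N [Row Q [Row U [Row U
   [Known M E [H,E,K,X,J,U,I,S,R]], Row U [Known M E [N,J,B,X,S,U,E,R,I]], Row U []]], Row S [Row W [], Row
   W []]])], Row P [Known M G [N,V,R,Q,T,S,M,U,P,J,I,L,K,G,H,E,F,B,C,D,A], Row N [Known M E
   [J,C,L,W,H,N,G,P,M]], Row N [Row N [Row X []], Row N [Known M E [W,H,A,X,P,N,C,M,G]], Row N []]]], Row T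
   [Row P [Save M H (Row S [Row U [Known M E [H,E,K,X,J,U,I,S,R]], Row U [Row U [Row Q []], Row U [Known M E
   [N,J,B,X,S,U,E,R,I]], Row U []], Row N []])]], Row T [Row P [Save M I (Row N [Row N [Row X []], Row N
   [Known M E [J,C,L,X,H,N,G,P,M]], Row N [Known M E [U,H,A,X,P,N,C,M,G]], Row N []]), Save M J (Row N
   [Known M E [J,C,L,X,H,N,G,P,M]]), Save M K (Row N [Row N [], Row N []])]]]), Known M L
   [U,T,S,R,Q,N,P,M,L,K,J,I,H,G,F,E,D,C,B,A], Save M R (Row T [Row Q [Row S [Known M I
   [P,N,U,M,T,Q,V,R,W,S,H,G,K,L,I,J,C,F,A,E,D,B]], Row S [Known M J
   [P,N,W,M,T,Q,V,R,U,S,H,G,K,L,I,J,C,F,A,E,D,B], Known M H [U,N,W,M,T,Q,V,R,P,S,H,G,K,L,I,J,C,F,A,E,D,B],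
   Known M H [U,P,W,M,T,Q,V,R,N,S,H,G,K,L,I,J,C,F,A,E,D,B], Known M K
   [U,P,N,W,M,T,Q,V,R,X,S,H,G,K,L,I,J,C,F,A,E,D,B]]], Save M P (Row T [Save M N (Row N [Row N [Save M M (Row
   S [Row P [Row Q [], Row Q [Row U []]], Row U [], Row Q []])], Row N [Row V []], Row N []])]), Known M P
   [V,U,T,S,R,Q,N,P,M,L,K,J,I,H,G,F,E,D,C,B,A], Row T [Row S [Save M Q (Row X [Known M N
   [W,V,U,T,S,R,Q,X,N,M,L,K,J,I,H,G,F,E,D,C,B,A]]), Known M Q
   [W,X,V,U,T,S,R,Q,P,N,M,L,K,J,I,H,G,F,E,D,C,B,A], Row U [], Row P [], Row N []]]])]]), Row R [Row H [Known
   M R [S,N,Q,P,M,T,V,U,R,K,L,H,G,J,I,F,C,D,E,A,B], Known M R [S,P,Q,N,M,T,V,U,R,K,L,H,G,J,I,F,C,D,E,A,B],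
   Row S [Save M U (Row S [Save M T (Row Q [Row V [Row Q [Known M M
   [X,N,R,U,M,T,Q,W,P,V,S,H,G,K,L,I,J,C,F,A,E,D,B]]], Known M S [M,T,Q,W,V,P,S,H,G,K,L,I,J,C,F,A,E,D,B], Row
   Q [Row P [Row X [], Row W [], Row T []]], Row Q []]), Known M T
   [W,V,U,T,S,R,Q,N,P,M,L,K,J,I,H,G,F,E,D,C,B,A], Row Q [Row V [Row X [], Row X [Row X [], Row X []], Known
   M E [U,I,B,X,R,S,E,V,J]], Known M S [M,T,Q,W,X,V,S,H,G,K,L,I,J,C,F,A,E,D,B], Row Q [], Row Q []]]), Known
   M U [W,U,V,T,S,R,Q,P,N,M,L,K,J,I,H,G,F,E,D,C,B,A], Save M W (Row S [Row P [Known M U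
   [S,P,N,Q,W,M,T,V,U,R,K,L,H,G,J,I,F,C,D,E,A,B], Save M V (Row V [Row X [], Row N [Known M U
   [S,N,P,Q,W,M,T,V,U,R,K,L,H,G,J,I,F,C,D,E,A,B], Row N []]]), Known M V
   [X,W,U,V,T,S,R,Q,P,N,M,L,K,J,I,H,G,F,E,D,C,B,A], Row N []]]), Known M W
   [W,V,U,T,S,R,Q,N,P,M,L,K,J,I,H,G,F,E,D,C,B,A], Row S []]]]]"

definition cert16 :: "vertex cert" where
  "cert16 = Row I [Save N I (Row I [Row J [Save M X (Row J [Row K [cert15]]), Row J [Row K [Known H G
   [Q,P,N,M,J,I,L,K,G,E,F,B,C,D,A], Row H [Save N F (Row H [Save N E (Row Q [Row Q [Known H H
   [R,E,I,H,G,U,L,K,C,Q,A,F,B,D], Save N C (Row R [Row U [Row W [Row N [Row S [], Row T []]], Save N A (Row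
   W [Row R [Row V [], Row V []], Row P [Row V []]])], Save N B (Row R [Row U [Row W [], Known N A
   [W,N,S,Q,V,P,M,U,T,X,R,K,L,H,G,J,I,F,C,D,E,A,B], Known H G [W,M,C,G,J,I,Q,K,L,E,U,B,F,A,D]]]), Known N B
   [W,V,U,S,T,R,Q,P,N,M,L,K,J,I,H,G,F,E,D,C,B,A], Row R []])], Known M F [L,K,C,Q,A,F,B,D], Row Q [Save N D
   (Row V [Row V [], Row P [Row V [], Row V []], Row V [], Known M X [R,Q,P,N,M,L,K,V,I,H,G,F,E,D,C,B,A],
   Row V []])]])]), Known N F [U,T,S,R,Q,N,P,M,L,K,J,I,H,G,F,E,D,C,B,A], Row H [Save N H (Row R [Save N G
   (Row R [Known N E [S,Q,W,V,M,U,T,X,R,K,L,H,G,J,I,F,C,D,E,A,B]]), Known N G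
   [W,V,U,S,T,R,Q,P,N,M,L,K,J,I,H,G,F,E,D,C,B,A], Known M F [I,J,C,R,A,E,D,B], Row R []])]]]]]]), Row I [Row
   J [Row K [Row K [Known H G [Q,P,N,M,J,I,L,K,G,E,F,B,C,D,A], Row H [Save N M (Row P [Row Q [Save N L (Row
   Q [Row T [Row T [Row N [Row W [], Row W [], Row U [Row W [], Row R []]]], Row T [Row N [Row N [Save N J
   (Row U [Row W [], Row X []]), Known N J [X,W,V,U,T,R,S,Q,P,N,M,L,K,I,J,H,G,F,E,D,C,B,A]], Save N K (Row U
   [Row W [], Row X []]), Known N K [X,W,V,U,T,R,S,Q,P,N,M,L,K,I,J,H,G,F,E,D,C,B,A]]]]]), Row Q [Row T
   [Known N L [N,Q,S,R,T,M,U,P,K,L,J,I,G,H,F,E,D,C,B,A], Row T []]]]]), Known N M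
   [T,S,R,Q,N,P,M,L,K,J,I,H,G,F,E,D,C,B,A], Row U [Known N M [T,S,R,Q,U,N,M,L,K,J,I,H,G,F,E,D,C,B,A], Known
   M F [H,G,E,U,B,C,D,A], Row U [Row R [Save N N (Row R [Row S [Known M F [X,W,B,S,E,R,J,I], Known M F
   [W,X,B,S,E,R,J,I], Row S [], Row S [], Known M F [J,I,C,S,A,E,D,B], Known M F [J,I,F,S,D,E,A,B]]]), Known
   N N [V,W,U,T,S,R,Q,P,N,M,L,K,J,I,H,G,F,E,D,C,B,A], Known N N
   [P,N,M,Q,S,R,T,W,V,U,K,L,J,I,G,H,F,E,D,C,B,A], Known N N [N,P,M,Q,S,R,T,W,V,U,K,L,J,I,G,H,F,E,D,C,B,A],
   Known M F [I,J,C,R,A,E,D,B], Known M F [I,J,F,R,D,E,A,B], Row R []]]]]], Known H G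
   [Q,P,N,M,J,I,L,K,G,E,F,B,C,D,A], Row K [Row H [Save N Q (Row H [Row R [Save N P (Row R [Row P [Row V
   [Known M E [N,G,A,X,M,V,C,P,H]], Known M B [Q,F,W,I,V,C,L,R,H,N,G,P,M], Row S [Known M F
   [W,N,B,S,E,R,J,I], Known M F [N,W,B,S,E,R,J,I], Known M F [J,I,C,S,A,E,D,B], Known M F
   [J,I,F,S,D,E,A,B]]]]), Known M F [I,J,C,R,A,E,D,B], Known M F [I,J,F,R,D,E,A,B], Row R [Row S [Known M F
   [X,W,B,S,E,R,J,I], Known M F [W,X,B,S,E,R,J,I], Known N P [V,U,T,R,S,Q,P,N,M,L,K,I,J,H,G,F,E,D,C,B,A],
   Known M F [J,I,C,S,A,E,D,B], Known M F [J,I,F,S,D,E,A,B]]]]]), Known N Q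
   [U,T,S,R,Q,N,P,M,L,K,J,I,H,G,F,E,D,C,B,A], Row H [Row R [Save N R (Row R [Row S [Known M F
   [X,P,B,S,E,R,J,I], Known M F [P,X,B,S,E,R,J,I], Known M F [J,I,C,S,A,E,D,B], Known M F
   [J,I,F,S,D,E,A,B]]]), Known N R [W,V,U,T,S,R,Q,N,P,M,L,K,J,I,H,G,F,E,D,C,B,A], Known M F
   [I,J,C,R,A,E,D,B], Known M F [I,J,F,R,D,E,A,B], Row R []]]]]]]], Save N W (Row I [Row J [Known N I
   [Q,P,N,M,L,K,I,J,H,G,F,E,D,C,B,A], Row J [Row K [Row K [Row H [Save N T (Row Q [Save N S (Row Q [Known N
   C [N,U,P,T,S,R,M,V,W,Q,G,H,J,I,K,L,C,E,A,F,B,D]]), Known N S [U,V,T,S,R,Q,P,N,M,L,K,J,I,H,G,F,E,D,C,B,A],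
   Row Q [Known N H [V,U,P,T,S,R,M,X,W,Q,G,H,J,I,K,L,C,E,A,F,B,D]]]), Known N T
   [V,U,T,S,R,Q,N,P,M,L,K,J,I,H,G,F,E,D,C,B,A], Row W [Save N V (Row W [Known N T
   [V,U,T,S,R,Q,W,N,M,L,K,J,I,H,G,F,E,D,C,B,A], Row R [Row R [], Save N U (Row R [Known N D
   [X,P,S,M,V,U,Q,W,T,N,R,H,G,K,L,J,I,C,F,A,E,D,B]]), Known N U
   [X,W,V,U,S,T,R,Q,P,N,M,L,K,J,I,H,G,F,E,D,C,B,A], Row R [], Row R [], Known M F [I,J,F,R,D,E,A,B]]]),
   Known N V [W,V,U,T,S,R,Q,N,P,M,L,K,J,I,H,G,F,E,D,C,B,A], Known N T
   [V,U,T,S,R,Q,W,N,M,L,K,J,I,H,G,F,E,D,C,B,A], Known M F [H,G,E,W,B,C,D,A], Row W []]]]]]]]), Save N X (Row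
   I [Row J [Row J [Row R [Known M F [T,S,A,R,B,J,I,E], Known M F [S,T,A,R,B,J,I,E], Row R [Row K [Row K
   [Known H G [Q,P,N,M,J,I,L,K,G,E,F,B,C,D,A], Row H [Row Q [], Row Q [], Row X [Row X [], Known M F
   [H,G,E,X,B,C,D,A]]]], Known H G [Q,P,N,M,J,I,L,K,G,E,F,B,C,D,A], Row K [Row H [Row H [], Row H
   []]]]]]]]]), Row I [Row J [Known N I [Q,P,N,M,L,K,I,J,H,G,F,E,D,C,B,A], Known N W
   [Q,P,N,M,L,K,I,J,H,G,F,E,D,C,B,A], Known N X [Q,P,N,M,L,K,I,J,H,G,F,E,D,C,B,A], Row J [Row K [Row K
   [Known H G [Q,P,N,M,J,I,L,K,G,E,F,B,C,D,A], Row H [Save P A (Row P [Row Q [Row Q [Row V []], Row Q []]]),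
   Known P A [V,U,T,S,R,Q,N,P,M,L,K,J,I,H,G,F,E,D,C,B,A], Row W [Known P A
   [V,U,T,S,R,Q,W,N,M,L,K,J,I,H,G,F,E,D,C,B,A], Known M F [H,G,E,W,B,C,D,A], Row W []]]], Known H G
   [Q,P,N,M,J,I,L,K,G,E,F,B,C,D,A], Row K [Row H [Save P C (Row H [Row Q [Save P B (Row Q [Known H J
   [V,H,G,W,L,K,C,Q,A,F,B,D]]), Known P B [X,V,W,U,T,S,R,Q,P,N,M,L,K,J,I,H,G,F,E,D,C,B,A], Known M F
   [L,K,C,Q,A,F,B,D]]]), Known P C [W,V,U,T,S,R,Q,N,P,M,L,K,J,I,H,G,F,E,D,C,B,A], Row H []]]]]]]]"

definition cert17 :: "vertex cert" where
  "cert17 = Row I [Known P D [L,K,H,G,J,I,F,C,D,E,A,B], Known P D [K,L,H,G,J,I,F,C,D,E,A,B], Save P H (Row I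
   [Known J W [L,K,G,I,J,F,C,D,E,A,B], Row J [Known J T [M,H,T,L,K,G,J,I,F,C,D,E,A,B], Row K [Row K [Known J
   W [H,G,I,K,L,C,E,A,F,B,D], Known J W [J,I,G,K,L,E,C,B,F,A,D], Row L [Known J T
   [T,J,V,H,G,I,L,K,C,E,A,F,B,D], Known J T [M,H,V,J,I,G,L,K,E,C,B,F,A,D], Row T [Save P F (Row T [Known J U
   [N,U,L,K,S,I,J,F,T,D,E,A,B], Row U [Known M F [X,S,B,U,E,T,J,I], Known M F [S,X,B,U,E,T,J,I], Save P E
   (Row U [Known J U [M,T,L,K,Q,J,I,F,U,D,E,A,B]]), Known P E
   [X,W,V,U,T,S,R,P,Q,N,M,L,K,J,I,H,G,F,E,D,C,B,A], Known M F [J,I,C,U,A,E,D,B], Known M F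
   [J,I,F,U,D,E,A,B]]]), Known P F [W,V,U,T,R,S,Q,P,N,M,L,K,J,I,H,G,F,E,D,C,B,A], Known P F
   [W,V,U,T,Q,P,S,R,M,N,L,K,J,I,G,H,F,E,D,C,B,A], Known P F [W,V,U,T,P,Q,S,R,M,N,L,K,J,I,G,H,F,E,D,C,B,A],
   Known M F [I,J,C,T,A,E,D,B], Known M F [I,J,F,T,D,E,A,B], Row T []]]], Known M B
   [T,J,H,G,L,K,I,C,F,A,E,D,B], Save P G (Row K [Row L [Known K F [V,H,G,I,L,K,C,E,A,F,B,D], Known K F
   [V,J,I,G,L,K,E,C,B,F,A,D], Row L [Row V [Known M F [X,W,A,V,D,L,K,F], Known M F [W,X,A,V,D,L,K,F], Known
   K F [L,H,G,I,V,F,C,E,A,K,B,D], Known K F [L,J,I,G,V,F,E,C,B,K,A,D]]]]]), Known M B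
   [M,H,J,I,L,K,G,E,F,B,C,D,A], Row K [Row L [Known L X [W,V,T,J,H,G,K,L,I,C,F,A,E,D,B], Known P G
   [U,T,S,R,Q,P,N,M,K,L,J,I,H,G,F,E,D,C,B,A], Known L X [W,V,M,H,J,I,K,L,G,E,F,B,C,D,A], Row L []]]]]]),
   Known M B [M,H,L,K,J,I,G,F,E,D,C,B,A], Save P I (Row I [Row J [Known K F [T,L,K,G,J,I,F,C,D,E,A,B], Row J
   [Row T [Known M F [V,U,A,T,B,J,I,E], Known M F [U,V,A,T,B,J,I,E], Known K F [J,H,G,K,T,E,C,F,A,I,D,B],
   Known K F [J,L,K,G,T,E,F,C,D,I,A,B], Row T [Row K [Known P H [S,R,Q,P,N,M,J,I,L,K,H,G,E,F,B,C,D,A], Known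
   K F [T,H,G,L,K,I,C,F,A,E,D,B], Row K [], Known M B [M,H,J,I,L,K,G,E,F,B,C,D,A]]]]]]]), Row I [Row J
   [Known P D [L,K,H,G,I,J,F,C,D,E,A,B], Known P D [K,L,H,G,I,J,F,C,D,E,A,B], Known L X
   [U,T,M,H,L,K,I,J,G,F,E,D,C,B,A], Known P I [S,R,Q,P,N,M,L,K,I,J,H,G,F,E,D,C,B,A], Row J [Row K [Known P H
   [S,R,Q,P,N,M,J,I,L,K,H,G,E,F,B,C,D,A], Known M B [U,T,H,G,L,K,I,C,F,A,E,D,B], Known P I
   [S,R,Q,P,N,M,J,I,L,K,H,G,E,F,B,C,D,A], Known M B [M,H,J,I,L,K,G,E,F,B,C,D,A], Row K []]]]]]"

text \<open>The triangle \<open>A B D\<close> has pendant neighbours \<open>C\<close>,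
  \<open>E\<close>, \<open>F\<close>, each with two further neighbours. \<open>P D\<close> joins
  leaves \<open>G\<close> and \<open>L\<close> below different triangle vertices and closes a
  6-cycle through a triangle edge; \<open>P K\<close> joins the siblings \<open>G\<close> and
  \<open>H\<close>; \<open>P L\<close> joins \<open>G\<close> to \<open>A\<close>.\<close>

definition cert18 :: "vertex cert" where
  "cert18 = Row G [Save P D (Row G [Known K F [H,J,I,K,L,C,E,F,B,G,D,A], Row M [Known M F [G,H,E,M,B,C,D,A],
   Known M F [G,H,F,M,D,C,B,A], Row M [Row L [Known M C [H,G,K,L,I,C,F,A,E,D,B], Known K E
   [M,K,J,I,H,G,F,E,C,B,L,A,D], Known J V [M,J,I,K,L,G,E,F,B,C,D,A], cert16]]]]), Known P D
   [K,L,J,I,H,G,F,E,D,C,B,A], Known P D [J,I,L,K,H,G,E,F,B,C,D,A], Known P D [I,J,L,K,H,G,E,F,B,C,D,A], Save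
   P K (Row G [Save P J (Row H [Row M [Known M F [G,H,E,M,B,C,D,A], Known M F [G,H,F,M,D,C,B,A], Row M [Row
   N [Known M F [Q,P,A,N,C,M,H,G], Known M F [P,Q,A,N,C,M,H,G], Known M F [H,G,E,N,B,C,D,A], Known M F
   [H,G,F,N,D,C,B,A], Row N [cert17]]]]])]), Save P L (Row G [Row H [Row H [Row M [Known M F [P,N,B,M,A,H,G,C],
   Known M F [N,P,B,M,A,H,G,C], Known K F [H,J,I,K,M,C,E,F,B,G,D,A], Known K F [H,L,K,I,M,C,F,E,D,G,B,A],
   Row M [Row I [Known P D [L,K,H,G,J,I,F,C,D,E,A,B], Known P D [K,L,H,G,J,I,F,C,D,E,A,B], Known P K
   [L,K,H,G,J,I,F,C,D,E,A,B], Known K F [M,L,K,J,I,G,F,E,D,C,B,A], Known P J [J,R,Q,P,N,I,E,M,H,G,B,C,A],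
   Row I [Row J [Known P D [L,K,H,G,I,J,F,C,D,E,A,B], Known P D [K,L,H,G,I,J,F,C,D,E,A,B], Known K F
   [M,L,K,I,J,G,F,E,D,C,B,A], Known P J [I,R,Q,P,N,J,E,M,H,G,B,C,A], Row J [Row K [Known P K
   [J,I,H,G,L,K,E,C,B,F,A,D], Known M B [T,S,H,G,L,K,I,C,F,A,E,D,B], Known P J [L,R,Q,P,N,K,F,M,H,G,D,C,A],
   Known K F [M,J,I,L,K,G,E,F,B,C,D,A], Row K [Row L [Known L X [X,W,T,S,H,G,K,L,I,C,F,A,E,D,B], Known P J
   [K,R,Q,P,N,L,F,M,H,G,D,C,A], Known K F [M,J,I,K,L,G,E,F,B,C,D,A]]]]]]]]]]]]]), Row G [Row H [Known P D
   [L,K,J,I,G,H,F,E,D,C,B,A], Known P D [K,L,J,I,G,H,F,E,D,C,B,A], Known P D [J,I,L,K,G,H,E,F,B,C,D,A],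
   Known P D [I,J,L,K,G,H,E,F,B,C,D,A], Known P L [L,K,J,I,G,H,F,E,D,C,B,A], Row H [Row I [Known P D
   [L,K,H,G,J,I,F,C,D,E,A,B], Known P D [K,L,H,G,J,I,F,C,D,E,A,B], Known P K [L,K,H,G,J,I,F,C,D,E,A,B],
   Known M B [N,M,L,K,J,I,G,F,E,D,C,B,A], Known P L [L,K,H,G,J,I,F,C,D,E,A,B], Row I [Row J [Known P D
   [L,K,H,G,I,J,F,C,D,E,A,B], Known P D [K,L,H,G,I,J,F,C,D,E,A,B], Known L X
   [S,R,N,M,L,K,I,J,G,F,E,D,C,B,A], Known P L [L,K,H,G,I,J,F,C,D,E,A,B], Row J [Row K [Known P K
   [J,I,H,G,L,K,E,C,B,F,A,D], Known M B [S,R,H,G,L,K,I,C,F,A,E,D,B], Known P L [J,I,H,G,L,K,E,C,B,F,A,D],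
   Known M B [N,M,J,I,L,K,G,E,F,B,C,D,A], Row K [Row L [Known L X [W,V,S,R,H,G,K,L,I,C,F,A,E,D,B], Known P L
   [J,I,H,G,K,L,E,C,B,F,A,D], Known L X [W,V,N,M,J,I,K,L,G,E,F,B,C,D,A], Row L []]]]]]]]]]]]"

section \<open>5-cycles in the absence of triangles\<close>

text \<open>The case of two 5-cycles \<open>A B E J D\<close> and \<open>A B F I D\<close> with the
  common path \<open>B A D\<close>.\<close>

definition cert19 :: "vertex cert" where
  "cert19 = Row K [Save Q H (Row K [Known M D [I,N,D,C,M,J,K,A,E,B], Row P [Row P [Save Q G (Row M [Known M B
   [H,G,P,E,L,B,C,K,F,M,A,I,D], Save Q F (Row S [Save P X (Row S [Row R [Known P Q [M,T,P,S,R], Known P Q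
   [S,Q,K,R,P], Row Q [Row Q [Known C V [U,S,I,T,R,Q,M,P,K], Row T [Known P Q [S,V,P,T,Q], Known C U
   [J,B,V,U,P,E,Q,R,T,K,S,M], Row U [Known P Q [M,U,P,S,R], Known P Q [S,U,K,R,P], Save P T (Row U [Row H
   [Known P Q [R,X,C,U,H], Save P S (Row W [Known D W [G,A,X,F,D,I,J,B,E,U,C,M,R,K,H,S,W,P,T,Q]]), Known P S
   [X,V,W,U,Q,P,R,T,S,L,K,N,M,F,E,H,G,J,I,B,C,D,A], Known P Q [U,G,A,H,C]]]), Known P T
   [W,V,U,T,S,R,Q,P,N,M,L,K,J,I,G,H,F,E,D,C,B,A], Row U []]]], Known P Q [R,Q,E,P,K], Row Q [Save P W (Row L
   [Save P V (Row L [Row H [Save P U (Row W [Known P Q [H,V,P,W,Q]]), Known P U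
   [X,V,W,U,T,S,R,Q,P,N,M,L,K,J,I,H,G,F,E,D,C,B,A]]]), Known P V
   [W,V,U,T,S,R,Q,P,N,M,L,K,J,I,G,H,F,E,D,C,B,A], Known P Q [I,L,A,F,B], Row L []])]]]]), Known P X
   [S,Q,R,P,N,M,L,K,J,I,H,G,F,E,D,C,B,A], Row S [Save Q E (Row G [Save Q D (Row G [Row H [Row H [Row L [Save
   Q C (Row W [Row W [Row V [Row R [Row X [], Row Q [], Row Q []]], Row N [Save Q A (Row U [Row Q [], Row Q
   []]), Known Q A [X,W,V,T,U,S,R,Q,P,N,M,L,K,J,I,H,G,F,E,D,C,B,A]]], Row W [Row N [Save Q B (Row U [Row T
   []]), Known Q B [X,W,V,T,U,S,R,Q,P,N,M,L,K,J,I,H,G,F,E,D,C,B,A]]], Row W []]), Known Q C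
   [W,V,U,T,S,Q,R,P,N,M,L,K,J,I,H,G,F,E,D,C,B,A], Row N [Known Q C
   [V,W,R,Q,P,U,T,S,L,K,N,M,F,E,G,H,J,I,B,C,D,A], Known Q C
   [V,W,R,Q,P,T,U,S,L,K,N,M,F,E,G,H,J,I,B,C,D,A]]]], Row H [Row L [Row L [], Row L [], Known P Q
   [I,L,A,F,B]]]]]), Known Q D [R,Q,P,U,T,S,L,K,N,M,F,E,H,G,J,I,B,C,D,A], Known P R [H,A,G,C], Known P Q
   [H,G,B,C,A], Row G [Row H [Known Q D [U,T,S,R,Q,P,N,M,L,K,J,I,G,H,F,E,D,C,B,A], Known Q D
   [R,Q,P,U,T,S,L,K,N,M,F,E,G,H,J,I,B,C,D,A], Known P Q [G,H,B,C,A], Row H []]]])]])])]]]), Save Q Q (Row K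
   [Save Q P (Row H [Save Q N (Row Q [Row Q [Save Q M (Row N [Known Q H [M,N,K,L,I,J,H,G,E,F,D,C,B,A], Row N
   [Save Q I (Row G [Row L [Known P Q [I,L,A,F,B], Row L [Row T [Row T [Row P [Row X [], Row X []]], Row T
   []]]]])], Save Q L (Row N [Row L [Known P Q [I,L,A,F,B], Row L [Row G [Save Q J (Row G [Row M [Row S
   [Known P Q [G,R,H,S,Q]]], Row M [Known P Q [D,M,B,I,F], Known P Q [F,M,A,I,D]]]), Known Q J
   [W,V,U,T,R,S,Q,P,N,M,L,K,J,I,H,G,F,E,D,C,B,A], Save Q K (Row G [Row M []]), Row G []]]]])])]])])]), Known
   Q Q [N,M,L,K,J,I,G,H,F,E,D,C,B,A], Known P Q [J,K,A,E,B], Row K [Row L [Known Q H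
   [M,N,K,L,I,J,H,G,E,F,D,C,B,A], Known Q Q [M,N,K,L,I,J,H,G,E,F,D,C,B,A], Known Q Q
   [M,N,K,L,I,J,G,H,E,F,D,C,B,A], Known P Q [I,L,A,F,B], Row L [Row G [Known Q Q
   [K,L,M,N,E,F,G,H,I,J,B,C,D,A], Known Q Q [L,K,N,M,F,E,G,H,J,I,B,C,D,A], Known P R [H,A,G,C], Known P Q
   [H,G,B,C,A], Row G [Row H [Known Q Q [K,L,M,N,E,F,H,G,I,J,B,C,D,A], Known Q Q
   [L,K,N,M,F,E,H,G,J,I,B,C,D,A], Known P Q [G,H,B,C,A], Row H [Row M [Known P Q [D,M,B,I,F], Known P Q
   [F,M,A,I,D], Row M []]]]]]]]]]"

definition cert20 :: "vertex cert" where
  "cert20 = Row G [Save R I (Row G [Save R F (Row L [Known P Q [G,K,B,L,F], Save R E (Row R [Save Q X (Row U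
   [Known P Q [R,T,M,U,S], Row K [Row K [Row X []], Row K [Row H [Known P Q [F,X,C,K,H], Row X []]], Known P
   Q [L,K,A,F,B], Row K []]]), Known Q X [V,T,U,S,R,Q,P,N,M,L,K,J,I,H,G,F,E,D,C,B,A], Row H [Row H [Save R B
   (Row V [Known Q R [Q,A,P,W,H,K,B,C,R,V,F,G,L], Row Q [Save R A (Row U [Known P Q [Q,T,M,U,S]]), Known R A
   [X,W,V,T,U,S,R,Q,P,N,M,L,K,J,I,H,G,F,E,D,C,B,A]]]), Row V [Known Q W [X,K,B,D,V,F,W,P,A,H,L,R,C,G]], Row
   V [Known Q R [X,A,P,W,H,K,B,C,R,V,F,G,L], Known M B [W,P,E,A,X,C,R,B,H,F,G,V,L]]], Row H [Row Q [Save R C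
   (Row U [Known R B [X,W,L,K,F,H,G,C,N,B,U,T,J,A,R,Q,S,E,D,P,M,I], Known P Q [Q,T,M,U,S]]), Known R C
   [X,W,V,T,U,S,R,Q,P,N,M,L,K,J,I,H,G,F,E,D,C,B,A]]], Row H [Row X []], Row H [Row K [Known P Q [F,X,C,K,H],
   Save R D (Row U [Row V []]), Known R D [X,W,V,T,U,S,R,Q,P,N,M,L,K,J,I,H,G,F,E,D,C,B,A]]], Row H []]])]),
   Known R F [U,T,S,R,Q,P,N,M,K,L,J,I,H,G,F,E,D,C,B,A], Row R [Known R F
   [L,K,F,G,H,C,N,B,U,T,J,A,Q,R,S,E,D,P,M,I], Known R F [L,K,F,G,H,C,N,B,T,U,J,A,Q,R,S,E,D,P,M,I], Row V
   [Save R H (Row V [Known P Q [G,L,B,V,F], Row K [Save R G (Row K [Known R F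
   [R,Q,P,U,T,S,N,I,H,G,J,M,L,K,C,D,E,F,A,B]]), Known R G [X,W,V,T,U,S,R,Q,P,N,M,L,K,J,I,H,G,F,E,D,C,B,A],
   Row K [], Row K []]]), Known R H [W,V,U,T,S,R,Q,P,N,M,K,L,J,I,H,G,F,E,D,C,B,A], Known R F
   [U,T,S,R,Q,P,N,M,V,K,J,I,H,G,F,E,D,C,B,A], Row V []]]]), Known R I
   [U,T,S,Q,R,P,N,M,L,K,J,I,H,G,F,E,D,C,B,A], Save R J (Row G [Row V [Row V [Row N [Known Q K
   [R,Q,L,K,X,W,V,H,F,S,P,C,B,M,G,U,I,A,E,N,D,J], Known Q K [R,Q,L,K,X,W,V,H,F,S,P,C,B,M,G,T,I,A,E,N,D,J],
   Known Q I [K,X,W,V,H,F,S,P,C,B,M,G,L,I,A,E,N,D,J], Known Q I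
   [L,X,W,V,H,F,S,P,C,B,M,G,K,I,A,E,N,D,J]]]]]), Save R L (Row G [Known P Q [L,H,A,G,C], Row L [Known P Q
   [F,V,C,L,G], Known R E [V,R,Q,P,U,T,S,N,I,G,H,J,M,K,L,C,D,E,F,A,B], Known R E
   [V,R,Q,P,T,U,S,N,I,G,H,J,M,K,L,C,D,E,F,A,B], Known P Q [G,K,B,L,F], Row V [Save R K (Row V [Known Q X
   [W,U,T,S,V,Q,P,N,M,L,K,J,I,H,G,F,E,D,C,B,A], Row K [Known R J [R,Q,P,U,T,S,N,I,H,G,J,M,L,K,C,D,E,F,A,B],
   Row K [], Known Q R [N,M,L,K,J,H,G,E,F,D,C,B,A], Known P Q [L,K,A,F,B]]]), Known R K
   [W,V,T,U,S,R,Q,P,N,M,L,K,J,I,H,G,F,E,D,C,B,A], Known R E [W,U,T,S,V,Q,P,N,M,L,K,J,I,H,G,F,E,D,C,B,A], Row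
   V [Known M F [F,W,A,K,C,L,V,G], Row H [Known R I [U,T,S,R,Q,P,N,M,L,K,J,I,G,H,F,E,D,C,B,A], Known R I
   [U,T,S,Q,R,P,N,M,L,K,J,I,G,H,F,E,D,C,B,A], Known R J [U,T,S,R,Q,P,N,M,L,K,J,I,G,H,F,E,D,C,B,A], Row H
   []]], Known P Q [L,V,A,G,C], Row V []]]]), Known R L [U,T,S,R,Q,P,N,M,K,L,J,I,H,G,F,E,D,C,B,A], Known P R
   [H,A,G,C], Known P Q [H,G,B,C,A], Row G [Row H [Known R I [U,T,S,R,Q,P,N,M,L,K,J,I,G,H,F,E,D,C,B,A],
   Known R I [U,T,S,Q,R,P,N,M,L,K,J,I,G,H,F,E,D,C,B,A], Known R J [U,T,S,R,Q,P,N,M,L,K,J,I,G,H,F,E,D,C,B,A],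
   Known R L [U,T,S,R,Q,P,N,M,L,K,J,I,G,H,F,E,D,C,B,A], Known R L [U,T,S,R,Q,P,N,M,K,L,J,I,G,H,F,E,D,C,B,A],
   Known P Q [G,H,B,C,A], Row H []]]]"

definition cert21 :: "vertex cert" where
  "cert21 = Save S M (Row N [Save S B (Row N [Known P Q [I,M,B,N,E], Save S A (Row R [Save R X (Row R [Row S
   [Known P R [T,N,S,R], Known P Q [T,S,I,R,N], Save R S (Row S [Row T [Known P Q [S,T,I,R,N], Row T [Row L
   [Save R R (Row M [Row U [], Row U [], Save R Q (Row Q [Row P []]), Known R Q
   [W,V,U,T,S,R,P,Q,N,M,L,K,J,I,H,G,F,E,D,C,B,A], Row X [Row X [], Known R Q
   [W,V,U,T,S,R,X,P,N,M,L,K,J,I,H,G,F,E,D,C,B,A]]]), Known R R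
   [W,V,U,T,S,R,Q,P,N,M,L,K,J,I,G,H,F,E,D,C,B,A], Row U [Row U [], Row U [], Known P Q [J,U,N,S,R], Known P
   Q [R,U,D,S,J]]]]]]), Row S [Row T [Known P Q [S,T,I,R,N], Known R S
   [S,T,R,Q,P,N,M,L,K,J,I,H,G,F,E,D,C,B,A], Row T [Row J [Save R U (Row X [Known P N [E,D,M,I,W,J,T,N,X,R],
   Save R T (Row M [Row P [], Row Q []]), Known R T [X,W,V,U,T,S,R,Q,P,N,M,L,K,J,I,G,H,F,E,D,C,B,A]]), Known
   R U [W,X,V,U,T,S,R,Q,P,N,M,L,K,J,I,H,G,F,E,D,C,B,A], Known R U
   [V,U,X,W,S,T,R,Q,P,N,M,L,K,J,I,H,G,F,E,D,C,B,A], Known R U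
   [U,V,X,W,S,T,R,Q,P,N,M,L,K,J,I,H,G,F,E,D,C,B,A], Save R W (Row Q [Save R V (Row H [Row G [], Row G [],
   Row G [], Row G []]), Known R V [X,W,V,U,T,S,R,Q,P,N,M,L,K,J,I,G,H,F,E,D,C,B,A]]), Known R W
   [X,W,V,U,T,S,R,P,Q,N,M,L,K,J,I,H,G,F,E,D,C,B,A], Known Q R [M,F,G,H,E,N,L,B,C,J,I,A,D], Known Q R
   [M,F,H,G,E,N,L,B,C,J,I,A,D]]]]]]])])]), Known R P [N,L,K,J,I,H,G,F,E,D,C,B,A], Known Q T
   [M,J,I,H,G,N,E,D,C,B,A], Save S L (Row N [Save S K (Row J [Known S A [P,S,R,K,Q,L,N,E,F,H,G,I,J,B,C,D,A],
   Known S A [Q,S,R,K,P,L,N,E,F,H,G,I,J,B,C,D,A], Known Q R [M,F,G,H,E,N,L,B,C,J,I,A,D], Known Q R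
   [M,F,H,G,E,N,L,B,C,J,I,A,D], Row L [Save S E (Row M [Save S C (Row M [Row Q [Known P Q [K,U,E,Q,M], Known
   P Q [M,P,F,Q,K], Row V [Known P Q [K,V,E,Q,M], Known P Q [M,V,F,Q,K], Row V [Row H [Row X [], Row W [],
   Row S [], Row R [], Row P [], Known P Q [L,G,A,H,C]]]]]]), Known S C
   [T,S,R,P,Q,N,M,L,K,J,I,H,G,F,E,D,C,B,A], Row M [Save S D (Row T [Known S C
   [M,Q,P,S,R,K,T,L,N,E,F,H,G,I,J,B,C,D,A], Known S C [M,Q,P,R,S,K,T,L,N,E,F,H,G,I,J,B,C,D,A], Known S A
   [P,S,R,K,T,L,N,E,F,H,G,I,J,B,C,D,A], Row T [Row H [Row S [], Row R [], Row Q [], Row P [], Known P Q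
   [L,G,A,H,C]]]])]]), Known S E [T,S,R,Q,P,N,M,L,K,J,I,G,H,F,E,D,C,B,A], Known L W
   [E,Q,P,H,G,S,R,K,B,C,N,F,I,A,L,D], Known L W [J,S,R,H,G,Q,P,N,D,C,K,I,F,A,L,B], Row M [Save S F (Row M
   [Known Q N [U,N,T,Q,G,I,J,M,L,K,C,D,E,F,A,B], Row Q [Known P Q [K,V,E,Q,M], Known P Q [M,P,F,Q,K], Row W
   [Known P Q [K,W,E,Q,M], Known P Q [M,W,F,Q,K], Row W []]]]), Known S F
   [U,T,S,R,P,Q,N,M,L,K,J,I,H,G,F,E,D,C,B,A], Save S H (Row M [Known P Q [E,H,A,M,C], Row H [Save S G (Row Q
   [Row V [Row V [Row W [Row W [], Row W []]], Row V []]]), Known S G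
   [V,U,T,S,R,P,Q,N,M,L,K,J,I,H,G,F,E,D,C,B,A], Known M E [V,E,F,G,M,C,B,H,A], Row W [Known S G
   [V,U,T,S,R,W,P,N,M,L,K,J,I,H,G,F,E,D,C,B,A], Row W []]]]), Known S H
   [U,T,S,R,Q,P,N,M,L,K,J,I,G,H,F,E,D,C,B,A], Known Q R [T,I,G,M,J,L,K,D,C,E,F,A,B], Row M [Row G [Row U
   [Known P Q [L,G,A,U,C], Row H []], Known S H [U,M,Q,P,S,R,K,T,L,N,E,F,G,H,I,J,B,C,D,A], Save S I (Row G
   [Row S [Known S A [R,Q,P,N,S,L,K,J,I,H,G,F,E,D,C,B,A]]]), Known S I
   [W,V,U,T,R,S,Q,P,N,M,L,K,J,I,H,G,F,E,D,C,B,A], Save S J (Row G [Row Q []]), Known S J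
   [W,V,U,T,S,R,P,Q,N,M,L,K,J,I,H,G,F,E,D,C,B,A], Known P R [H,A,G,C], Known P Q [H,G,B,C,A], Row G
   []]]]]])])])"

definition cert22 :: "vertex cert" where
  "cert22 = Row L [Save S U (Row T [Known P Q [L,S,K,T,R], Save S T (Row S [Known P Q [T,S,F,R,K], Known S R
   [T,R,Q,P,N,S,L,K,J,I,H,G,F,E,D,C,B,A], Row S [Row U [Known P Q [L,U,K,T,R], Save S S (Row U [Row Q [Known
   S L [I,E,D,P,B,X,J,L,U,W,V,Q,F,T,S,K,R], Known S M [R,F,G,M,H,K,B,C,P,N,Q,E,A,I,J,D], Known S M
   [R,F,H,M,G,K,B,C,P,N,Q,E,A,I,J,D], Known H E [U,L,W,V,M,P,N,I,H,G,C,T,S,D,E,A,R,J,K,B,Q,F], Known P X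
   [L,T,S,R,G,F,M,K,C,B,P,N,E,Q,A,I,J,D]]]), Known S S [W,V,U,T,S,R,Q,N,P,M,L,K,J,I,H,G,F,E,D,C,B,A], Known
   P Q [R,U,F,T,L], Row U []]]])]), Known S U [S,T,R,Q,P,N,M,L,K,J,I,H,G,F,E,D,C,B,A], Save T B (Row L [Row
   Q [Known S L [L,R,F,H,M,G,K,B,C,P,N,Q,E,A,I,J,D], Row H [Known P Q [F,U,C,L,H], Known P Q [L,G,A,H,C],
   Row G [Row G [Save S W (Row P [Known Q T [I,W,L,D,B,U,P,H,A,G,C], Known P Q [G,N,D,P,I], Row U [Save S V
   (Row N [Row N [], Known S Q [C,N,P,B,M,V,K,I,A,E,Q,D,J], Known P Q [P,N,A,I,D]]), Known S V
   [X,W,V,U,S,T,R,Q,P,N,M,L,K,J,I,H,G,F,E,D,C,B,A]]]), Known S W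
   [W,V,U,T,S,R,Q,N,P,M,L,K,J,I,H,G,F,E,D,C,B,A], Known M F [L,W,B,U,A,H,G,C], Row U [Save S X (Row T [Known
   Q R [A,X,R,W,C,K,B,G,T,H,F,U,L], Known S T [U,T,S,R,F,H,G,M,V,K,B,C,P,N,Q,E,A,I,J,D], Known P Q
   [U,S,K,T,R]]), Known S X [X,W,V,U,S,T,R,Q,P,N,M,L,K,J,I,H,G,F,E,D,C,B,A], Known M C
   [E,A,X,C,W,B,G,F,H,U,L]]], Save T A (Row G [Row P [Known P Q [I,X,C,P,G], Row N [Row N [], Known S Q
   [C,N,P,B,M,V,K,I,A,E,Q,D,J]], Known P Q [G,N,D,P,I]]]), Known T A
   [W,V,U,T,S,R,Q,N,P,M,L,K,J,I,H,G,F,E,D,C,B,A], Known P Q [H,G,B,C,A], Row G []]]]]), Known T B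
   [T,S,R,Q,P,N,M,L,K,J,I,G,H,F,E,D,C,B,A], Known Q R [Q,M,K,L,J,H,G,E,F,D,C,B,A], Row L [Row Q [Known S M
   [R,F,G,M,H,K,B,C,P,N,Q,E,A,I,J,D], Known S M [R,F,H,M,G,K,B,C,P,N,Q,E,A,I,J,D], Known H F
   [M,P,N,I,H,G,C,T,S,D,E,A,R,J,K,B,Q,F], Known M B [H,G,R,F,M,B,C,K,E,Q,A,J,D], Known Q E
   [T,S,R,V,U,L,M,K,G,F,E,Q,P,N,C,B,J,I,A,D], Row W [Known S U [T,S,R,F,H,G,M,W,K,B,C,P,N,Q,E,A,I,J,D],
   Known S U [S,T,R,F,H,G,M,W,K,B,C,P,N,Q,E,A,I,J,D], Known T B [T,S,R,F,H,G,M,W,K,B,C,P,N,Q,E,A,I,J,D],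
   Known T B [T,S,R,F,H,G,M,W,K,B,C,N,P,Q,E,A,I,J,D], Known S M [R,F,G,M,W,K,B,C,P,N,Q,E,A,I,J,D], Known R M
   [R,F,K,M,W,H,G,E,Q,P,N,C,B,J,I,A,D], Known Q R [F,M,K,W,B,P,N,E,Q,A,I,J,D], Row W []]]]]"

definition cert23 :: "vertex cert" where
  "cert23 = Row K [Save T C (Row K [Known M F [J,M,L,Q,F,E,K,B], Row R [Row R [Save S R (Row M [Known P Q
   [K,S,E,R,M], Known S Q [C,K,L,D,Q,T,R,F,A,J,M,B,E]])], Row R [cert22]]]), Known P R [L,B,K,F], Save T G (Row
   K [Row H [Known P Q [F,R,C,K,H], Known S Q [I,H,G,J,M,L,K,C,D,E,F,A,B], Known P Q [K,G,A,H,C], Row R [Row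
   R [Known M F [C,S,B,G,F,H,R,K], Row L [Known T C [Q,P,N,M,K,L,J,I,H,G,F,E,D,C,B,A], Row L [Row T [Row T
   [Known P W [P,N,Q,M,E,J,I,D,S,B,U,A,H,F,W,V,L,C,K,T,G,R]]]], Row L [Row Q [Known P Q [D,Q,B,J,E], Known P
   Q [E,Q,A,J,D], Row Q [Row M [Save T D (Row V [Known P Q [M,U,F,V,L]]), Known T D
   [X,W,U,V,T,S,R,Q,P,N,M,L,K,J,I,H,G,F,E,D,C,B,A], Known S Q [C,P,N,B,M,X,W,I,A,E,Q,D,J], Known S Q
   [C,N,P,B,M,X,W,I,A,E,Q,D,J], Known P Q [J,M,A,E,B]]]]]]], Known P Q [H,R,B,K,F], Known S Q
   [M,K,L,J,R,H,G,F,E,D,C,B,A], Row R [Row Q [Known T C [Q,P,N,M,K,L,J,I,H,G,F,E,D,C,B,A], Known S Q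
   [F,G,H,E,Q,P,N,C,B,J,I,A,D], Known P Q [D,Q,B,J,E], Known P Q [E,Q,A,J,D], Row Q [Row G [Save T F (Row G
   [Row M [Save T E (Row M [Known S N [G,U,C,N,P,B,M,W,V,I,A,E,Q,D,J]]), Known T E
   [X,W,V,T,U,S,R,Q,P,N,M,L,K,J,I,H,G,F,E,D,C,B,A], Known S Q [C,N,P,B,M,W,V,I,A,E,Q,D,J], Known P Q
   [J,M,A,E,B]]]), Known T F [W,V,U,T,S,R,Q,N,P,M,L,K,J,I,H,G,F,E,D,C,B,A], Row G [Row L [Known P Q
   [F,X,C,L,G], Known S P [X,T,C,S,U,G,E,A,H,R,L,B,K,F], Known S P [X,U,C,S,T,G,E,A,H,R,L,B,K,F], Known R P
   [C,U,T,S,G,E,A,R,H,L,B,K,F]]], Known P Q [H,G,B,C,A], Row G []]]]]]]]), Known T G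
   [Q,P,N,M,L,K,J,I,G,H,F,E,D,C,B,A], Known Q R [Q,M,L,K,J,H,G,E,F,D,C,B,A], Known P Q [L,K,A,F,B], Row K
   [Row L [Known T C [Q,P,N,M,K,L,J,I,H,G,F,E,D,C,B,A], Known T G [Q,P,N,M,K,L,J,I,H,G,F,E,D,C,B,A], Known T
   G [Q,P,N,M,K,L,J,I,G,H,F,E,D,C,B,A], Known Q R [Q,M,K,L,J,H,G,E,F,D,C,B,A], Known P Q [K,L,A,F,B], Row L
   [Row Q [Known S Q [F,H,G,E,Q,P,N,C,B,J,I,A,D], Known S Q [F,G,H,E,Q,P,N,C,B,J,I,A,D], Known R M
   [S,R,K,M,Q,P,N,E,F,H,G,I,J,B,C,D,A], Known P Q [D,Q,B,J,E], Known P Q [E,Q,A,J,D], Known Q R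
   [M,F,G,Q,E,P,N,B,C,J,I,A,D], Row Q [Row V [Known P R [W,J,V,Q], Known T G
   [F,H,G,M,W,V,B,C,P,N,Q,E,A,I,J,D], Known T G [F,H,G,M,W,V,B,C,N,P,Q,E,A,I,J,D], Known P Q [W,V,D,Q,J],
   Known T C [Q,P,N,M,K,V,J,I,H,G,F,E,D,C,B,A], Known S P [W,F,V,G,E,Q,P,N,C,B,J,I,A,D], Known R N
   [W,M,V,H,G,E,Q,P,N,C,B,J,I,A,D], Known Q R [F,M,W,V,B,P,N,E,Q,A,I,J,D], Row V []]]]]]]]"

section \<open>6-cycles in the absence of triangles and 5-cycles\<close>

definition cert24 :: "vertex cert" where
  "cert24 = Save U G (Row R [Known T K [E,T,S,C,B,L,R,J,A,I,D], Known T K [E,S,T,C,B,L,R,J,A,I,D], Save T W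
   (Row R [Row U [Save T U (Row U [Row Q [Save T T (Row S [Known R P [T,L,D,V,J,N,C,I,U,S,G,R,Q], Row W
   [Known R P [T,L,D,W,J,N,C,I,U,S,G,R,Q], Row W []]]), Row W [Known T J [N,C,V,T,L,D,G,W,U,I,Q,R], Known T
   T [V,U,T,W,R,Q,P,N,M,L,K,J,I,H,G,F,E,D,C,B,A], Row W []]]]), Known T U
   [U,S,T,R,Q,P,N,M,L,K,J,I,H,G,F,E,D,C,B,A], Row U [Row Q [Row W []]], Row U [Row Q [Save T V (Row T [Known
   S N [E,S,V,D,L,W,J,N,C,I,U,T,G,R,Q], Known S N [E,S,W,D,L,V,J,N,C,I,U,T,G,R,Q], Row X []]), Known T V
   [W,V,U,S,T,R,Q,P,N,M,L,K,J,I,H,G,F,E,D,C,B,A], Known Q R [H,D,M,N,C,U,I,A,F,G,R,B,Q], Row X [Known T J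
   [N,C,W,V,L,D,G,X,U,I,Q,R], Known T J [N,C,V,W,L,D,G,X,U,I,Q,R], Known T V
   [W,V,U,X,S,R,Q,P,N,M,L,K,J,I,H,G,F,E,D,C,B,A]]]]]]), Known T W [T,S,R,P,Q,M,N,L,K,J,I,G,H,F,E,D,C,B,A],
   Save U B (Row R [Save U A (Row M [Known R P [C,U,I,Q,H,E,A,R,G,M,B,N,F], Known P Q [F,P,C,M,H], Row K
   [Save T X (Row K [Row T [Known P N [S,D,F,A,W,J,K,B,T,E], Known P N [W,E,C,B,S,K,J,A,T,D], Row X []]]),
   Known T X [V,U,S,T,R,Q,P,N,M,L,K,J,I,H,G,F,E,D,C,B,A], Row K [Row P [Row X []]], Row K [Row L [Known S K
   [X,W,H,G,K,S,B,C,T,E,U,N,A,J,L,R,D,I], Known S K [X,W,H,G,K,T,B,C,S,E,U,N,A,J,L,R,D,I], Row Q []]]]])]),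
   Known U B [T,S,R,P,Q,M,N,L,K,J,I,G,H,F,E,D,C,B,A], Known P Q [E,R,D,L,I], Save U C (Row R [Known P P
   [E,C,B,K,L,R,A,I,D], Row L [Known T K [G,K,U,J,A,Q,E,R,D,L,I], Known T K [H,K,U,J,A,P,E,R,D,L,I], Known T
   L [K,U,J,A,V,E,R,D,L,I]]]), Known P Q [L,R,A,I,D], Known S Q [G,E,F,R,L,T,S,B,C,I,J,A,D], Known R P
   [L,T,S,R,E,H,G,J,I,B,C,D,A], Row R [Row K [Save U D (Row K [Known S N [H,Q,L,N,M,K,G,J,I,F,E,C,D,B,A],
   Row W [Known U C [T,S,W,Q,P,N,M,L,K,J,I,H,G,F,E,D,C,B,A], Known T S [R,Q,P,N,M,L,K,W,I,H,G,F,E,D,C,B,A],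
   Known T J [H,G,K,L,N,M,C,W,E,F,A,B], Row W []]]), Known U D [V,U,S,T,R,Q,P,N,M,L,K,J,I,H,G,F,E,D,C,B,A],
   Save U E (Row K [Row Q [Known S M [N,M,W,H,E,F,G,K,R,L,B,C,Q,I,A,D], Row X []]]), Known U E
   [V,U,T,S,R,P,Q,M,N,L,K,J,I,G,H,F,E,D,C,B,A], Known T K [I,N,M,D,C,L,K,F,A,E,B], Known T K
   [I,M,N,D,C,L,K,F,A,E,B], Known P Q [I,K,B,L,E], Known R P [L,N,M,K,I,H,G,F,E,D,C,B,A], Known S N
   [H,Q,L,N,M,K,G,J,I,F,E,C,D,B,A], Known P Q [L,K,A,E,B], Row K [Row P [Save U F (Row P [Known P P
   [F,D,B,T,M,P,A,H,C]]), Known U F [X,W,V,U,S,T,R,Q,P,N,M,L,K,J,I,H,G,F,E,D,C,B,A], Known T K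
   [F,P,M,D,B,N,Q,H,A,G,C], Known T K [F,N,Q,D,B,M,P,G,A,H,C], Known P Q [F,P,C,M,H], Row P [], Known S Q
   [I,F,E,P,M,Q,N,B,D,H,G,A,C], Known P Q [M,P,A,H,C], Known R P [M,Q,N,P,F,J,I,G,H,B,D,C,A]]]]]])"

definition cert25 :: "vertex cert" where
  "cert25 = Save U S (Row I [Save U J (Row I [Known P Q [L,J,A,I,D], Known M F [E,F,J,L,D,B,I,A], Save U I (Row
   J [Save T S (Row J [Known M F [E,F,I,K,D,B,J,A], Row P [Save T N (Row P [Save T M (Row S [Row T [Row T
   [Row U [Known T J [K,D,W,V,M,C,J,U,T,H,S,P], Known T J [K,D,V,W,M,C,J,U,T,H,S,P], Row U []]]]])]), Known
   T N [R,S,Q,P,N,M,K,L,I,J,H,G,F,E,D,C,B,A], Known T K [F,P,M,D,B,N,Q,H,A,G,C], Known T K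
   [F,N,Q,D,B,M,P,G,A,H,C], Known P Q [F,P,C,M,H], Save T P (Row P [Row T [Row T [Row N [Row S [Row K [Known
   R P [E,W,N,R,L,C,B,S,K,I,A,J,D], Row M [Known R P [F,T,L,Q,N,D,B,P,M,G,A,H,C]]]], Known P Q [F,Q,C,N,G],
   Row K [Known P Q [E,S,D,K,J], Known R P [D,T,H,R,J,F,A,P,I,K,B,L,E], Row M [Row S [Known T N
   [S,R,P,Q,M,N,L,K,J,I,G,H,F,E,D,C,B,A], Known P Q [K,S,A,J,D]], Known R P
   [F,T,L,Q,N,D,B,P,M,G,A,H,C]]]]]]]), Known T P [R,S,Q,P,N,M,K,L,I,J,H,G,F,E,D,C,B,A], Known S Q
   [I,F,E,P,M,Q,N,B,D,H,G,A,C], Known P Q [M,P,A,H,C], Known R P [M,Q,N,P,F,J,I,G,H,B,D,C,A], Row P [Row T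
   [Known P R [U,H,T,P], Known T M [U,T,R,Q,P,N,M,L,K,J,I,H,G,F,E,D,C,B,A], Known T M
   [U,T,S,Q,P,N,M,K,L,I,J,H,G,F,E,D,C,B,A], Known P Q [U,T,C,P,H], Known T K [F,P,M,D,B,N,T,H,A,G,C], Save T
   Q (Row T [Row U [Row U [Known T J [G,A,F,V,W,E,C,M,T,U,H,P]], Row U [Known T J
   [G,A,F,V,X,W,C,M,T,U,H,P]]]]), Save T R (Row T [Row U [Known T Q
   [T,U,S,R,Q,P,N,M,L,K,J,I,H,G,F,E,D,C,B,A], Row U [Row N [Known T P [P,Q,R,S,L,K,N,M,H,G,J,I,E,F,C,D,B,A],
   Known T P [P,Q,S,R,K,L,N,M,H,G,I,J,E,F,C,D,B,A], Known P Q [F,Q,C,N,G], Known Q G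
   [U,T,P,Q,M,E,H,G,F,R,L,B,C,N,I,A,D]]]]]), Known T J [F,E,P,M,Q,N,B,T,H,G,A,C], Row T [Row U [Known T M
   [T,U,R,Q,P,N,M,L,K,J,I,H,G,F,E,D,C,B,A], Known T M [T,U,S,Q,P,N,M,K,L,I,J,H,G,F,E,D,C,B,A], Known P Q
   [T,U,C,P,H], Known T K [F,P,M,D,B,N,U,H,A,G,C], Known T Q [T,U,S,R,Q,P,N,M,L,K,J,I,H,G,F,E,D,C,B,A],
   Known T R [T,U,S,R,Q,P,N,M,L,K,J,I,H,G,F,E,D,C,B,A], Known T J [F,E,P,M,Q,N,B,U,H,G,A,C], Row U
   []]]]]]]), Known P Q [I,J,B,D,A], Save U H (Row J [cert24])])]), Known U J
   [Q,P,N,M,K,L,J,I,H,G,F,E,D,C,B,A], Known P R [J,A,I,D], Known P Q [J,I,B,D,A], Save U R (Row I [Row J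
   [Known U J [Q,P,N,M,L,K,I,J,H,G,F,E,D,C,B,A], Known U J [Q,P,N,M,K,L,I,J,H,G,F,E,D,C,B,A], Known P Q
   [I,J,B,D,A], Row J [Save U Q (Row P [Save U N (Row U [Known U G [S,R,T,Q,P,N,M,U,K,I,J,H,G,F,E,D,C,B,A],
   Row V [Save U L (Row P [Save U K (Row V [Row R [Known R P [S,T,D,W,I,M,C,J,V,R,H,U,P], Row X []]]), Row W
   [Known U K [V,U,T,S,W,Q,P,N,M,L,K,J,I,H,G,F,E,D,C,B,A], Row W []]]), Known U L
   [V,U,T,R,S,Q,P,N,M,L,K,J,I,H,G,F,E,D,C,B,A], Row V [Known T K [F,U,W,D,B,M,P,V,A,H,C]], Row V [Known U G
   [S,R,T,Q,P,N,M,U,W,I,J,H,G,F,V,D,C,B,A]], Row V [Row P [Save U M (Row S [Known S P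
   [R,W,D,T,X,I,M,C,J,V,S,H,U,P], Known S P [R,X,D,T,W,I,M,C,J,V,S,H,U,P]]), Known U M
   [X,W,V,U,T,R,S,Q,P,N,M,L,K,J,I,H,G,F,E,D,C,B,A], Known P M [F,V,J,D,B,M,U,H,A,P,C], Known Q R
   [G,D,N,M,C,V,J,A,F,H,U,B,P]]]]]), Known U N [T,U,S,R,Q,P,N,M,L,K,J,I,H,G,F,E,D,C,B,A], Known U N
   [S,R,U,T,Q,P,N,M,L,K,I,J,H,G,F,E,D,C,B,A], Known U N [R,S,U,T,Q,P,N,M,L,K,I,J,H,G,F,E,D,C,B,A], Known T K
   [F,P,M,D,B,N,Q,H,A,G,C], Known T K [F,N,Q,D,B,M,P,G,A,H,C], Known P Q [F,P,C,M,H], Save U P (Row L [Row V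
   [Known U J [Q,P,N,M,L,K,I,V,H,G,F,E,D,C,B,A], Row V [Row P [Known R X
   [G,N,X,W,F,M,E,V,C,B,S,R,L,H,A,I,P,D]]]]]), Known U P [U,T,S,R,Q,P,N,M,K,L,J,I,H,G,F,E,D,C,B,A], Known S
   Q [I,F,E,P,M,Q,N,B,D,H,G,A,C], Known P Q [M,P,A,H,C], Known R P [M,Q,N,P,F,J,I,G,H,B,D,C,A], Row P [Row V
   [Known P R [W,H,V,P], Known U N [V,T,S,R,Q,P,N,M,L,K,J,I,H,G,F,E,D,C,B,A], Known U N
   [V,R,U,T,Q,P,N,M,L,K,I,J,H,G,F,E,D,C,B,A], Known P Q [W,V,C,P,H], Known T K [F,P,M,D,B,N,V,H,A,G,C], Row
   V [Row W []], Known U P [U,T,S,R,Q,P,N,M,V,K,J,I,H,G,F,E,D,C,B,A], Known T J [F,E,P,M,Q,N,B,V,H,G,A,C],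
   Row V []]]])]]])])"

definition cert26 :: "vertex cert" where
  "cert26 = Row K [Save U V (Row L [Save U U (Row T [Known T K [G,K,U,I,A,R,E,T,D,L,J]]), Known U U
   [K,M,P,N,R,Q,S,L,T,E,F,G,H,I,J,B,C,D,A], Row K [Known T K [I,J,U,F,A,S,T,L,B,K,E], Known M F
   [J,U,A,T,B,L,K,E], Known T L [J,U,F,A,V,T,L,B,K,E]]]), Save V C (Row K [Known S P
   [R,L,N,M,K,G,J,I,F,E,C,D,B,A], Row S [Save V B (Row U [Known U V [U,S,R,Q,P,N,M,L,K,J,I,H,G,F,E,D,C,B,A],
   Row U [Save V A (Row L [Save U W (Row N [Row X []]), Row X [Save U X (Row X [Known U W
   [W,V,U,T,S,X,Q,P,N,M,L,K,J,I,H,G,F,E,D,C,B,A]]), Known U X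
   [X,V,W,U,T,S,R,Q,P,N,M,L,K,J,I,H,G,F,E,D,C,B,A], Known U W
   [W,V,U,T,S,X,Q,P,N,M,L,K,J,I,H,G,F,E,D,C,B,A]]])]]), Known P M [H,U,E,C,B,Q,K,I,A,S,D], Row U [Row U
   [Known T J [F,A,J,M,V,I,B,L,U,S,E,K], Row L [Row R [Row M [Known P Q [K,W,F,U,M]]], Known S M
   [F,E,P,T,C,B,L,H,V,K,A,J,Q,S,D,I], Known S M [H,G,T,M,D,C,N,J,U,S,A,F,L,K,B,E], Known M E
   [K,B,C,T,E,J,A,L,D], Row Q [Row M [], Known T K [F,Q,P,D,B,N,R,H,A,G,C], Known P Q [I,P,C,Q,H]]]], Known
   U V [U,S,R,Q,P,N,M,L,K,J,I,H,G,F,E,D,C,B,A], Known U T [T,K,L,N,M,H,G,J,U,E,F,C,D,B,A], Row U [Row V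
   [Known T J [Q,D,X,W,L,B,I,V,U,E,S,K], Known T J [Q,D,W,X,L,B,I,V,U,E,S,K], Row T [Row V [], Row V []],
   Known V A [X,W,U,T,S,R,Q,P,N,V,L,K,J,I,H,G,F,E,D,C,B,A], Known U T [P,S,Q,T,L,F,E,H,V,I,J,B,C,D,A]]]]]]),
   Known V C [M,K,S,L,T,Q,P,N,R,F,E,J,I,H,G,B,D,C,A], Save V D (Row K [Row T [Row T [Row L [Known S A
   [U,H,G,K,Q,B,C,S,E,V,R,A,I,L,T,D,J], Row N [Known P Q [G,M,B,N,F], Row R [Known V C
   [P,R,K,N,M,L,T,Q,S,H,G,F,E,J,I,C,B,D,A]]]]], Row T [Row L [Known S A [U,H,G,K,Q,B,C,S,E,V,N,A,I,L,T,D,J],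
   Known S A [V,H,G,T,N,D,C,M,J,U,Q,A,F,L,K,B,E], Row M [Row M [Known V B
   [S,W,Q,T,U,X,G,H,J,I,L,K,M,N,C,D,E,F,A,B]], Known T J [E,A,R,C,V,J,B,M,G,T,F,N], Row M []]]], Known V C
   [K,M,P,N,R,Q,S,L,T,E,F,G,H,I,J,B,C,D,A], Row T [Row N [Known P Q [F,R,C,N,G], Known P Q [G,M,B,N,F], Row
   L [Known S A [U,H,G,K,Q,B,C,S,E,W,V,A,I,L,T,D,J], Row U [], Known S K
   [W,V,H,G,T,N,D,C,M,J,U,Q,A,F,L,K,B,E]]]]]]), Save V E (Row K [Known R N [T,P,L,N,M,K,J,H,G,F,E,D,C,B,A],
   Row P [Known V C [R,P,T,Q,S,L,K,N,M,G,H,I,J,E,F,C,D,B,A], Known Q R [G,B,S,Q,C,U,E,A,I,H,K,D,P], Row U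
   [Row U [Known U V [U,P,T,Q,S,L,K,N,M,G,H,I,J,E,F,C,D,B,A], Row M [Known P Q [K,W,F,U,M], Known V C
   [K,M,P,N,R,Q,S,L,T,E,F,G,H,I,J,B,C,D,A], Known Q L [G,S,Q,I,C,N,W,P,A,F,U,D,T,K,B,M,J,E,L], Row N [Known
   V D [K,M,P,N,R,Q,S,L,T,E,F,G,H,I,J,B,C,D,A], Known V D [P,R,K,N,M,L,T,Q,S,H,G,F,E,J,I,C,B,D,A], Known P Q
   [F,R,C,N,G], Known Q P [P,R,M,E,H,G,F,Q,S,B,C,N,I,A,D]]]], Known V C
   [M,K,S,L,T,Q,P,N,U,F,E,J,I,H,G,B,D,C,A], Known U T [T,K,L,N,M,H,G,J,U,E,F,C,D,B,A], Row U [Row N [Known V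
   D [K,M,P,N,R,Q,S,L,T,E,F,G,H,I,J,B,C,D,A], Known V D [P,R,K,N,M,L,T,Q,S,H,G,F,E,J,I,C,B,D,A], Known P Q
   [F,R,C,N,G], Known P Q [G,M,B,N,F], Known Q P [P,R,M,E,H,G,F,Q,S,B,C,N,I,A,D]]]]]]), Known T K
   [J,N,M,D,C,L,K,F,A,E,B], Known T K [J,M,N,D,C,L,K,F,A,E,B], Known P Q [J,K,B,L,E], Known R P
   [L,N,M,K,J,H,G,F,E,D,C,B,A], Known S P [R,L,N,M,K,G,J,I,F,E,C,D,B,A], Known P Q [L,K,A,E,B], Row K [Row P
   [Known V C [S,T,M,L,K,N,R,Q,P,I,J,E,F,G,H,D,B,C,A], Known U V [S,T,M,L,K,N,R,Q,P,I,J,E,F,G,H,D,B,C,A],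
   Known T K [F,P,Q,D,B,N,R,H,A,G,C], Known P Q [I,P,C,Q,H], Known T K [I,N,R,D,B,Q,P,G,A,H,C], Known V C
   [R,P,T,Q,S,L,K,N,M,G,H,I,J,E,F,C,D,B,A], Known V D [S,T,M,L,K,N,R,Q,P,I,J,E,F,G,H,D,B,C,A], Known R P
   [Q,R,N,P,I,F,E,G,H,D,B,C,A], Known P Q [Q,P,A,H,C], Known S P [M,Q,N,R,P,F,J,I,G,H,B,D,C,A], Row P [Row S
   [Known T K [H,T,L,C,B,Q,S,J,A,I,D], Known V C [P,R,K,N,M,L,T,Q,S,H,G,F,E,J,I,C,B,D,A], Known P Q
   [H,S,D,Q,I], Known V D [P,R,K,N,M,L,T,Q,S,H,G,F,E,J,I,C,B,D,A], Known V E
   [R,P,T,Q,S,L,K,N,M,G,H,I,J,E,F,C,D,B,A], Known T K [H,L,T,C,B,Q,S,J,A,I,D], Known P Q [Q,S,A,I,D], Known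
   R P [Q,T,L,S,H,F,E,J,I,C,B,D,A], Known S P [K,Q,L,T,S,E,H,G,J,I,B,C,D,A]]]]]]"

definition cert27 :: "vertex cert" where
  "cert27 = Save V T (Row M [Save V J (Row M [Save V G (Row Q [Known T K [M,T,U,C,B,S,Q,J,A,I,D], Known P Q
   [I,P,C,Q,H], Row T [Row P [Row V [Known T K [M,V,T,C,B,S,Q,J,A,I,D], Row V []]], Known V C
   [K,M,P,N,R,Q,S,T,U,E,F,G,H,I,J,B,C,D,A], Row T [Row U [Row L [], Row K [], Known R X
   [G,N,V,H,F,B,S,Q,C,M,X,W,I,A,U,T,D,J]]]]]), Known P P [G,D,C,U,N,M,A,F,B], Row V [Save V H (Row V [Known
   V G [U,T,V,R,Q,P,N,M,L,K,J,I,H,G,F,E,D,C,B,A], Known Q R [U,N,K,L,M,H,G,F,E,V,C,B,A], Row U [Row K [Known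
   R P [E,T,D,W,L,N,B,J,K,V,F,U,M], Row S [Known U I [A,N,W,B,L,I,X,T,D,V,F,E,S,J,M,K,U]], Known M D
   [V,J,M,N,L,U,E,F,K,B], Row L [Known P Q [M,W,E,V,L], Row W [], Row W [], Known Q F
   [X,T,D,J,W,K,A,U,V,E,R,C,B,M,L,G,F,N]]], Known U A [V,L,K,M,T,S,U,Q,N,R,E,F,I,J,H,G,B,D,C,A], Known Q R
   [A,N,W,L,B,T,D,F,V,E,J,M,U], Row L [Known P Q [M,W,E,V,L], Row R [], Row P [], Known Q M
   [Q,P,H,D,K,W,U,A,E,V,C,R,M,B,L,G,F,N], Known P Q [V,K,B,L,E]]]]), Known V H
   [V,U,T,S,R,Q,P,N,M,K,L,J,I,H,G,F,E,D,C,B,A], Known V G [U,T,V,R,Q,P,N,M,L,K,J,I,H,G,F,E,D,C,B,A], Known U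
   T [R,M,N,L,K,J,I,G,V,F,E,D,C,B,A], Known T J [H,G,M,N,L,K,C,V,F,E,A,B], Row V [Row U [Save V I (Row L
   [Known S N [G,K,W,B,N,X,E,T,D,F,V,L,J,M,U], Known S N [G,K,X,B,N,W,E,T,D,F,V,L,J,M,U], Row S [], Known M
   E [J,M,N,K,U,E,F,L,B]]), Known V I [X,W,V,U,T,S,R,Q,P,N,M,K,L,J,I,H,G,F,E,D,C,B,A], Known U A
   [V,L,K,M,T,S,U,Q,N,R,E,F,I,J,H,G,B,D,C,A], Known T I [G,K,T,D,B,N,X,W,J,E,F,V,U,M], Known S D
   [S,Q,T,X,W,L,K,V,I,F,E,J,M,N,R,B,D,U,G,A,C]]]]]), Known V J [T,U,S,R,Q,P,N,M,L,K,J,I,H,G,F,E,D,C,B,A],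
   Row M [Known R N [R,S,N,L,K,M,G,J,I,E,F,C,D,B,A], Row S [Known V G
   [L,K,M,P,N,R,Q,S,U,T,E,F,G,H,I,J,B,C,D,A], Known V G [K,L,M,P,N,R,Q,S,U,T,E,F,G,H,I,J,B,C,D,A], Known Q R
   [J,B,P,Q,D,V,F,A,H,I,M,C,S], Row V [Save V K (Row V [Known V G [V,T,S,R,Q,P,N,M,L,K,J,I,H,G,F,E,D,C,B,A],
   Row L [Known P Q [M,X,E,V,L], Row R [], Known Q M [Q,P,H,D,K,X,S,A,E,V,C,R,M,B,L,G,F,N], Known P Q
   [V,K,B,L,E]]]), Known V K [W,V,U,T,S,R,Q,P,N,M,K,L,J,I,H,G,F,E,D,C,B,A], Known V G
   [V,T,S,R,Q,P,N,M,L,K,J,I,H,G,F,E,D,C,B,A], Known U T [R,M,N,L,K,J,I,G,V,F,E,D,C,B,A], Row V []]]], Save V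
   M (Row M [Save V L (Row N [Known T K [H,G,U,E,A,P,R,N,B,M,F], Known T K [H,G,T,E,A,P,R,N,B,M,F], Known T
   K [H,G,V,E,A,P,R,N,B,M,F]]), Known P P [G,D,C,R,N,M,A,F,B], Row N [Known T K [J,R,V,E,A,U,G,M,B,N,F],
   Known T K [J,R,V,E,A,T,G,M,B,N,F], Known T K [I,R,V,E,A,S,G,M,B,N,F], Known T L [G,W,E,A,V,R,N,B,M,F]]]),
   Save V P (Row M [Row V [Save V N (Row L [Known P Q [V,K,B,L,E], Row V [Known P Q [M,W,E,V,L], Known Q N
   [P,I,N,K,W,Q,F,E,H,G,L,M,B,C,V,A], Row N [Known V F [R,K,C,D,L,X,I,H,S,G,A,E,V,Q,N,B,M,F], Known T J
   [M,I,N,R,D,B,Q,P,G,A,H,C], Known S M [I,H,W,G,V,Q,K,L,D,C,M,N,E,A,F,B]]]]), Known V N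
   [V,U,T,S,R,Q,P,N,M,K,L,J,I,H,G,F,E,D,C,B,A], Known T J [N,B,C,P,S,D,F,V,H,I,M,Q], Known T J
   [H,G,M,N,L,K,C,V,F,E,A,B], Row V [Row N [Row S [Known U A [J,L,K,D,H,W,I,X,C,R,E,A,V,Q,S,G,B,M,N,F],
   Known U A [J,L,K,D,H,X,I,W,C,R,E,A,V,Q,S,G,B,M,N,F]], Known T J [M,I,N,R,D,B,Q,P,G,A,H,C], Known S M
   [J,I,R,K,C,D,L,G,V,Q,A,E,N,M,B,F], Known S M [J,I,R,L,C,D,K,G,V,Q,A,E,N,M,B,F]]]]]), Save V S (Row M
   [Known S Q [I,G,H,M,N,L,K,C,D,F,E,A,B], Row P [Save V R (Row V [Row V [Row N [Known U H
   [J,R,H,W,L,K,C,D,U,G,V,P,E,A,N,M,B,F], Known U H [J,R,H,W,L,K,C,D,T,G,V,P,E,A,N,M,B,F], Known U I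
   [R,H,W,L,K,C,D,X,G,V,P,E,A,N,M,B,F]]], Known V L [U,T,S,V,Q,P,N,M,L,K,J,I,H,G,F,E,D,C,B,A], Row V [Row N
   [Save V Q (Row K [Row K [], Row K []]), Known V Q [X,W,V,T,U,S,R,Q,P,N,M,L,K,J,I,H,G,F,E,D,C,B,A]]]]),
   Known V R [V,U,T,S,R,Q,P,N,M,K,L,J,I,H,G,F,E,D,C,B,A], Known P M [I,V,F,D,B,Q,M,H,A,P,C], Row W [Row W
   [Known V R [V,U,T,S,R,Q,P,N,M,W,K,J,I,H,G,F,E,D,C,B,A], Row R [Row U [], Row T [], Row S []]], Known V R
   [V,U,T,S,R,Q,P,N,M,W,K,J,I,H,G,F,E,D,C,B,A], Known U T [S,P,Q,R,N,F,E,I,W,H,G,B,D,C,A], Row W []]]]),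
   Known P Q [G,M,B,N,F], Known T K [G,L,K,D,C,N,M,E,A,F,B], Known T K [G,K,L,D,C,N,M,E,A,F,B], Known S Q
   [I,G,H,M,N,L,K,C,D,F,E,A,B], Known R P [N,L,K,M,G,J,I,E,F,C,D,B,A], Known P Q [N,M,A,F,B], Row M [Row S
   [Known T K [H,U,T,C,B,Q,S,J,A,I,D], Known T K [H,T,U,C,B,Q,S,J,A,I,D], Known V S
   [L,K,M,P,N,R,Q,S,U,T,E,F,G,H,I,J,B,C,D,A], Known P Q [H,S,D,Q,I], Known V M
   [L,K,M,P,N,R,Q,S,U,T,E,F,G,H,I,J,B,C,D,A], Known V P [L,K,M,P,N,R,Q,S,U,T,E,F,G,H,I,J,B,C,D,A], Known V J
   [L,K,M,P,N,R,Q,S,U,T,E,F,G,H,I,J,B,C,D,A], Known V J [K,L,M,P,N,R,Q,S,U,T,E,F,G,H,I,J,B,C,D,A], Known P Q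
   [Q,S,A,I,D], Known R P [Q,U,T,S,H,F,E,J,I,C,B,D,A], Known S Q [E,H,G,S,Q,U,T,C,B,I,J,A,D], Row S []]]])"

definition cert28 :: "vertex cert" where
  "cert28 = Row K [Save W D (Row V [Save W B (Row L [Row R [Row K [Save V X (Row T [Row M []]), Known V X
   [W,V,U,S,T,R,Q,P,N,M,L,K,J,I,H,G,F,E,D,C,B,A], Known S B [W,L,M,V,N,R,E,F,J,I,G,K,B,D,C,A], Row L [Row N
   [], Row N []]]], Save W A (Row L [Row N [Known P Q [F,R,C,N,G], Row K [Row T [], Row S [], Known S A
   [U,X,G,J,D,M,N,C,V,W,Q,F,A,K,L,B,E]]]]), Known W A [V,U,T,S,R,P,Q,N,M,L,K,J,I,H,G,F,E,D,C,B,A], Known T K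
   [V,N,M,D,C,K,L,F,A,E,B], Row L [Row K [Row T [], Row S [], Known S B [T,S,M,F,J,I,E,V,R,N,D,B,K,G,A,C],
   Known M A [G,U,D,X,W,N,M,J,L,F,E,V,B,K]]]]), Known V T [T,S,U,R,V,P,N,M,L,K,I,J,H,G,F,E,D,C,B,A], Known P
   Q [J,K,B,V,E], Known P P [E,C,B,U,K,J,A,V,D], Row K [Save W C (Row T [Known W B
   [T,S,V,U,R,Q,P,N,M,L,K,I,J,H,G,F,E,D,C,B,A], Known M E [E,V,U,S,K,I,J,T,D], Row W [Known T J
   [S,D,W,J,L,B,I,X,V,E,T,K], Row W [], Known W B [V,U,T,S,R,Q,P,N,W,L,K,J,I,H,G,F,E,D,C,B,A], Known T J
   [F,E,V,U,T,S,B,W,J,I,A,D]]]), Known W C [W,V,U,S,T,R,Q,P,N,M,L,K,J,I,H,G,F,E,D,C,B,A], Known S M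
   [T,S,W,F,J,I,E,V,R,N,D,B,K,G,A,C], Known P N [W,J,D,C,L,V,E,A,K,B], Row X [Row X [Known W B
   [X,S,V,U,R,Q,P,N,M,L,K,I,J,H,G,F,E,D,C,B,A], Known Q R [V,L,N,M,K,H,G,E,F,X,C,B,A]], Known W C
   [W,V,U,X,S,R,Q,P,N,M,L,K,J,I,H,G,F,E,D,C,B,A], Known V U [M,K,L,N,R,Q,P,I,X,E,F,G,H,D,B,C,A], Known T J
   [H,G,K,L,N,M,C,X,E,F,A,B]]]]), Known W D [U,V,T,S,R,Q,P,N,M,L,K,J,I,H,G,F,E,D,C,B,A], Known W D
   [T,S,V,U,R,Q,P,N,M,L,K,I,J,H,G,F,E,D,C,B,A], Known W D [S,T,V,U,R,Q,P,N,M,L,K,I,J,H,G,F,E,D,C,B,A], Row K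
   [Save W H (Row Q [Save W F (Row M [Save W E (Row R [Row W []])]), Known S B
   [N,M,R,G,E,F,H,K,T,S,B,C,Q,I,A,D], Save W G (Row W [Known W F
   [V,U,T,S,R,Q,P,N,W,L,K,J,I,H,G,F,E,D,C,B,A], Known T J [F,E,Q,P,R,N,B,W,H,G,A,C], Row W []])]), Known W H
   [V,U,T,S,R,P,Q,N,M,L,K,J,I,H,G,F,E,D,C,B,A], Known P P [G,D,C,L,R,E,A,K,B], Save W J (Row W [Save W I
   (Row R [Row W [Known W E [X,V,U,T,S,M,K,L,N,R,P,W,J,I,E,F,G,H,D,B,C,A]]]), Known W H
   [V,U,T,S,R,W,P,N,M,L,K,J,I,H,G,F,E,D,C,B,A], Known V U [M,K,L,N,R,Q,P,I,W,E,F,G,H,D,B,C,A], Row W []])],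
   Save W L (Row K [Known S Q [F,H,G,E,Q,T,S,C,B,K,I,A,D], Save W K (Row Q [Known W G
   [W,V,U,T,S,M,K,L,N,R,P,Q,J,I,E,F,G,H,D,B,C,A], Known T K [G,K,L,D,C,N,Q,E,A,F,B], Known S M
   [N,M,W,G,E,F,H,K,T,S,B,C,Q,I,A,D], Row W [Row W [Known W G [X,V,U,T,S,W,Q,P,N,M,L,K,J,I,H,G,F,E,D,C,B,A],
   Known Q R [Q,L,N,M,K,H,G,E,F,W,C,B,A]], Known W G [X,V,U,T,S,W,Q,P,N,M,L,K,J,I,H,G,F,E,D,C,B,A], Known V
   U [M,K,L,N,R,Q,P,I,W,E,F,G,H,D,B,C,A], Known T J [H,G,K,L,N,M,C,W,E,F,A,B]]])]), Known W L
   [V,U,T,S,R,P,Q,N,M,L,K,J,I,H,G,F,E,D,C,B,A], Known T L [N,M,D,C,L,K,F,A,E,B], Known T K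
   [G,K,L,D,C,N,M,E,A,F,B], Known P R [L,B,K,E], Known T H [T,S,L,N,M,K,I,H,G,F,E,D,C,B,A], Known S P
   [R,L,N,M,K,G,J,I,F,E,C,D,B,A], Known P Q [L,K,A,E,B], Row K [Row W [Known P R [X,E,W,K], Row X [Known W D
   [X,U,T,S,R,Q,P,N,M,L,K,J,I,H,G,F,E,D,C,B,A], Known W D [X,S,V,U,R,Q,P,N,M,L,K,I,J,H,G,F,E,D,C,B,A], Known
   W K [W,V,U,T,S,R,X,P,N,M,L,K,J,I,H,G,F,E,D,C,B,A], Known W I
   [W,V,U,T,S,X,Q,P,N,M,L,K,J,I,H,G,F,E,D,C,B,A], Known T K [W,K,L,D,C,M,X,E,A,F,B], Known P Q [W,X,B,K,E],
   Known T J [H,G,K,L,N,M,C,X,E,F,A,B]], Known W D [W,U,T,S,R,Q,P,N,M,L,K,J,I,H,G,F,E,D,C,B,A], Known W D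
   [W,S,V,U,R,Q,P,N,M,L,K,I,J,H,G,F,E,D,C,B,A], Known W K [X,V,U,T,S,R,W,P,N,M,L,K,J,I,H,G,F,E,D,C,B,A],
   Known W J [X,V,U,T,S,W,Q,P,N,M,L,K,J,I,H,G,F,E,D,C,B,A], Known T K [G,K,L,D,C,N,W,E,A,F,B], Known P Q
   [X,W,B,K,E], Known V U [M,K,L,N,R,Q,P,I,W,E,F,G,H,D,B,C,A], Known T J [H,G,K,L,N,M,C,W,E,F,A,B]]]]"

text \<open>\<open>W N\<close> consists of a tree on 14 vertices and the edge between
  \<open>G\<close> and \<open>N\<close>, which closes the 6-cycle \<open>A B F N G C\<close>. The
  first branch, ending in \<open>U T\<close>, also joins \<open>H\<close> and \<open>M\<close>, so
  that a second 6-cycle \<open>A B F M H C\<close> shares the path \<open>F B A C\<close>.\<close>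

definition cert29 :: "vertex cert" where
  "cert29 = Save W N (Row H [Row H [Known T K [N,J,I,F,E,G,H,D,B,C,A], Known T K [N,I,J,F,E,G,H,D,B,C,A], Known
   P P [F,D,B,M,N,H,A,G,C], Known M F [F,E,G,M,C,B,H,A], Save U T (Row G [Known S Q
   [I,F,E,J,N,P,M,B,D,G,H,A,C], Known S Q [J,F,E,I,N,P,M,B,D,G,H,A,C], Known M F [F,E,H,N,C,B,G,A], cert25])],
   Known T K [N,J,I,F,E,G,H,D,B,C,A], Known T K [N,I,J,F,E,G,H,D,B,C,A], Known P Q [N,H,A,G,C], Known P Q
   [G,H,B,C,A], Row H [Save W M (Row G [Known U S [K,M,L,N,Q,P,J,I,F,E,G,H,D,B,C,A], Known U S
   [L,M,K,N,Q,P,J,I,F,E,G,H,D,B,C,A], Known S Q [I,F,E,J,N,Q,P,B,D,G,H,A,C], Known S Q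
   [J,F,E,I,N,Q,P,B,D,G,H,A,C], Known M F [F,E,H,N,C,B,G,A], Row I [Save V U (Row I [Known P Q [Q,J,A,I,D],
   Known M F [H,G,J,Q,D,C,I,A], Row J [Known U T [S,P,Q,R,N,F,E,I,J,H,G,B,D,C,A], Save V F (Row J [Known M F
   [E,F,I,L,D,B,J,A], cert26]), Known V F [S,R,Q,P,N,M,K,L,J,I,H,G,F,E,D,C,B,A], Known P Q [I,J,B,D,A], Row J
   [cert27]]]), Known V U [R,P,Q,N,M,L,K,J,I,H,G,F,E,D,C,B,A], Row J [Known P Q [N,J,A,I,D], Known P Q
   [I,J,B,D,A], Row J [Save V W (Row I [Known L W [M,R,C,L,K,T,S,G,F,E,J,N,D,B,I,A], Row M [Known T J
   [E,A,U,D,R,C,B,M,I,G,F,N], Save V V (Row M [Known U R [J,R,U,C,D,L,K,V,T,I,G,A,E,M,N,B,F]]), Known V V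
   [U,S,T,R,Q,P,N,M,L,K,J,I,H,G,F,E,D,C,B,A], Known T J [E,A,R,C,U,D,B,M,G,I,F,N], Known V V
   [R,Q,P,U,T,S,N,M,L,K,H,G,J,I,F,E,C,D,B,A], Known V V [R,P,Q,U,T,S,N,M,L,K,H,G,J,I,F,E,C,D,B,A], Known P Q
   [G,M,B,N,F], Known T J [I,G,L,K,D,C,N,M,E,A,F,B], Known T J [I,G,K,L,D,C,N,M,E,A,F,B], Known R P
   [N,L,K,M,I,H,G,E,F,D,C,B,A], Known R P [N,L,K,M,G,J,I,E,F,C,D,B,A], Known P Q [N,M,A,F,B], Row M [Known U
   S [H,J,G,I,W,V,L,K,D,C,N,M,E,A,F,B]]]])]], Known V U [M,L,K,N,R,Q,P,J,I,E,F,G,H,D,B,C,A], Known V U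
   [M,K,L,N,R,Q,P,J,I,E,F,G,H,D,B,C,A], Known P R [J,A,I,D], Known P Q [J,I,B,D,A], Row I [Row J [Known V U
   [R,Q,P,N,M,L,K,I,J,H,G,F,E,D,C,B,A], Known V U [R,P,Q,N,M,L,K,I,J,H,G,F,E,D,C,B,A], Known V W
   [T,S,R,Q,P,N,M,L,K,I,J,H,G,F,E,D,C,B,A], Known V U [M,L,K,N,R,Q,P,I,J,E,F,G,H,D,B,C,A], Known V U
   [M,K,L,N,R,Q,P,I,J,E,F,G,H,D,B,C,A], Known P Q [I,J,B,D,A], Row J [cert28]]]]])]])"

section \<open>Girth at least 7\<close>

text \<open>The tree of depth 3 is completed up to \<open>W\<close>, its 22nd vertex. The leaf
  \<open>K\<close> needs two neighbours besides \<open>E\<close>, but \<open>X\<close> is the only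
  new vertex available, so some other neighbour lies in the tree. The edge from \<open>K\<close> to
  a leaf below \<open>C\<close> or \<open>D\<close> closes a 7-cycle (\<open>W S\<close> up to
  symmetry), and the other edges close cycles excluded before.\<close>

definition cert30 :: "vertex cert" where
  "cert30 = Row I [Known W N [S,R,Q,P,F,E,J,I,H,G,B,D,C,A], Known W N [R,S,Q,P,F,E,J,I,H,G,B,D,C,A], Known W N
   [Q,P,S,R,F,E,J,I,G,H,B,D,C,A], Known W N [P,Q,S,R,F,E,J,I,G,H,B,D,C,A], Known W N
   [N,M,L,K,H,G,J,I,F,E,C,D,B,A], Known W N [M,N,L,K,H,G,J,I,F,E,C,D,B,A], Known W N
   [L,K,N,M,H,G,J,I,E,F,C,D,B,A], Known W N [K,L,N,M,H,G,J,I,E,F,C,D,B,A], Known P R [J,A,I,D], Known P Q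
   [J,I,B,D,A], Row I [Row J [Known W M [U,T,S,R,Q,P,F,E,I,J,H,G,B,D,C,A], Known W M
   [U,T,R,S,Q,P,F,E,I,J,H,G,B,D,C,A], Known W M [U,T,Q,P,S,R,F,E,I,J,G,H,B,D,C,A], Known W M
   [U,T,P,Q,S,R,F,E,I,J,G,H,B,D,C,A], Known W M [U,T,N,M,L,K,H,G,I,J,F,E,C,D,B,A], Known W M
   [U,T,M,N,L,K,H,G,I,J,F,E,C,D,B,A], Known W M [U,T,L,K,N,M,H,G,I,J,E,F,C,D,B,A], Known W M
   [U,T,K,L,N,M,H,G,I,J,E,F,C,D,B,A], Known P Q [I,J,B,D,A], Row J [Row K [Save W S (Row K [Save W Q (Row U
   [Save W P (Row N [Row X []]), Known W P [W,V,U,T,S,R,Q,P,M,N,L,K,J,I,H,G,F,E,D,C,B,A], Known M E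
   [E,W,V,T,K,I,J,U,D], Known S B [N,M,W,J,E,F,I,K,Q,P,B,D,U,G,A,C], Row X [Row X [], Known W P
   [W,V,U,T,S,R,Q,P,X,M,L,K,J,I,H,G,F,E,D,C,B,A], Known T J [F,E,U,T,W,V,B,X,I,J,A,D]]]), Known W Q
   [W,V,T,U,S,R,Q,P,N,M,L,K,J,I,H,G,F,E,D,C,B,A], Known S Q [F,J,I,E,W,Q,P,D,B,K,G,A,C], Known P P
   [J,D,C,L,W,E,A,K,B], Row X [Save W R (Row X [Known W P [W,V,X,T,S,R,Q,P,N,M,L,K,J,I,H,G,F,E,D,C,B,A],
   Known T K [F,W,V,C,B,N,K,J,A,X,D], Known U Q [W,V,U,T,L,M,K,N,Q,P,J,I,F,E,X,G,D,B,C,A], Known Q R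
   [W,L,M,N,K,H,G,E,F,X,C,B,A]]), Known W R [X,W,V,U,T,S,R,Q,P,M,N,L,K,J,I,H,G,F,E,D,C,B,A], Known W Q
   [W,V,X,T,S,R,Q,P,N,M,L,K,J,I,H,G,F,E,D,C,B,A], Known W M [U,T,K,L,N,M,H,G,I,X,E,F,C,D,B,A], Known W M
   [Q,P,K,L,N,M,J,I,G,X,E,F,D,C,B,A], Known T J [H,G,K,L,N,M,C,X,E,F,A,B]]]), Known W S
   [V,W,U,T,S,R,Q,P,N,M,L,K,J,I,H,G,F,E,D,C,B,A], Known W S [U,T,W,V,S,R,Q,P,N,M,L,K,I,J,H,G,F,E,D,C,B,A],
   Known W S [T,U,W,V,S,R,Q,P,N,M,L,K,I,J,H,G,F,E,D,C,B,A], Known W S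
   [S,R,Q,P,W,V,U,T,N,M,L,K,H,G,J,I,F,E,C,D,B,A], Known W S [R,S,Q,P,W,V,U,T,N,M,L,K,H,G,J,I,F,E,C,D,B,A],
   Known W S [Q,P,S,R,W,V,U,T,N,M,L,K,G,H,J,I,F,E,C,D,B,A], Known W S
   [P,Q,S,R,W,V,U,T,N,M,L,K,G,H,J,I,F,E,C,D,B,A], Known T L [N,M,D,C,L,K,F,A,E,B], Known T L
   [M,N,D,C,L,K,F,A,E,B], Known P R [L,B,K,E], Known T H [U,T,L,N,M,K,I,H,G,F,E,D,C,B,A], Known T H
   [Q,P,L,N,M,K,G,J,I,F,E,C,D,B,A], Known P Q [L,K,A,E,B], Row K []]]]]]"

section \<open>The top of the search tree\<close>

text \<open>The start is the tree of depth 2 with root \<open>A\<close> and leaves \<open>E\<close>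
  to \<open>J\<close>. \<open>T L\<close> adds the edge between \<open>E\<close> and
  \<open>J\<close>, hence the 5-cycle \<open>A B E J D\<close>. In a graph without triangles and
  4-cycles every 5-cycle extends to a copy of \<open>T L\<close>, because the other edges are
  supplied by the minimum degree.\<close>

definition cert31 :: "vertex cert" where
  "cert31 = Row E [Save T L (Row F [Row E [Known M F [D,C,I,J,F,A,E,B], Save Q T (Row F [Save Q S (Row I [Known
   P Q [D,L,B,I,F], Known C U [H,G,K,L,B,C,E,F,J,A,I,D], Save Q R (Row J [Known P Q [D,K,B,J,E], cert19])])])],
   Known P Q [J,F,A,E,B], Known P Q [E,F,C,B,A], Save T K (Row F [Save T J (Row E [Known Q S
   [I,G,H,J,L,K,D,C,E,F,A,B], Known Q S [I,H,G,J,L,K,D,C,E,F,A,B], Row I [Save R P (Row J [Row I [Save Q W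
   (Row M [Save Q V (Row K [Row K [Row L [Known K S [R,Q,H,G,E,P,K,B,C,M,F,I,A,L,D], Row N [Save Q U (Row N
   [Known Q F [S,R,Q,K,C,L,P,F,A,I,T,H,M,B,D,N,E,J]]), Known Q U [S,R,Q,P,N,M,L,K,J,I,G,H,F,E,D,C,B,A], Row
   N [Known Q F [S,R,Q,K,C,L,P,F,A,I,U,T,M,B,D,N,E,J]]]]]])]), Known Q W [N,M,K,L,J,I,H,G,F,E,D,C,B,A],
   Known C V [N,E,F,M,J,I,B,D,A], Save R N (Row P [Known P Q [E,P,D,M,I], Known Q W
   [N,M,P,K,J,I,H,G,F,E,D,C,B,A], Known P Q [M,P,A,I,D], Row P [Save R M (Row M [Known Q V
   [P,N,I,H,G,J,M,L,K,C,D,E,F,A,B], Known Q V [P,N,I,G,H,J,M,L,K,C,D,E,F,A,B], Known C T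
   [R,Q,H,G,N,P,D,C,J,I,E,A,M,B], Row S [Known P Q [E,S,D,M,I], Known P Q [I,S,B,M,E], Known Q V
   [P,N,I,S,G,J,M,L,K,C,D,E,F,A,B], Row S [cert20]]])]])]]), Save S Q (Row I [Known M D [F,M,B,C,L,E,I,A,J,D],
   Save S P (Row K [Known Q W [M,K,L,N,E,F,H,G,I,J,B,C,D,A], Known Q S [L,M,J,K,H,G,F,E,D,C,B,A], Save S N
   (Row K [cert21])])]), Known S Q [M,K,L,J,I,H,G,F,E,D,C,B,A], Known P Q [E,I,A,J,D], Known P Q [J,I,B,D,A],
   Save T I (Row I [Save T H (Row J [Known P Q [D,M,B,J,E], Known R N [K,M,L,P,N,E,F,H,G,I,J,B,C,D,A], Known
   R N [L,M,K,P,N,E,F,H,G,I,J,B,C,D,A], Known Q R [M,F,G,H,E,P,N,B,C,J,I,A,D], Known Q R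
   [M,F,H,G,E,P,N,B,C,J,I,A,D], cert23])])]])])]), Known T L [I,J,H,G,F,E,D,C,B,A], Known T L
   [H,G,J,I,F,E,C,D,B,A], Known T L [G,H,J,I,F,E,C,D,B,A], Known P R [F,A,E,B], Known P Q [F,E,C,B,A], Row E
   [Row F [Known T J [L,K,J,I,H,G,E,F,D,C,B,A], Known T J [L,K,I,J,H,G,E,F,D,C,B,A], Known T J
   [L,K,H,G,J,I,E,F,C,D,B,A], Known T J [L,K,G,H,J,I,E,F,C,D,B,A], Known P Q [E,F,C,B,A], Row F [Row G [cert29,
   Known W N [M,N,L,K,J,I,H,G,F,E,D,C,B,A], Known W N [L,K,N,M,J,I,H,G,E,F,D,C,B,A], Known W N
   [K,L,N,M,J,I,H,G,E,F,D,C,B,A], Known T L [J,I,F,E,H,G,D,B,C,A], Known T L [I,J,F,E,H,G,D,B,C,A], Known P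
   R [H,A,G,C], Known P Q [H,G,B,C,A], Row G [Row H [Known W M [Q,P,N,M,L,K,J,I,G,H,F,E,D,C,B,A], Known W M
   [Q,P,M,N,L,K,J,I,G,H,F,E,D,C,B,A], Known W M [Q,P,L,K,N,M,J,I,G,H,E,F,D,C,B,A], Known W M
   [Q,P,K,L,N,M,J,I,G,H,E,F,D,C,B,A], Known T J [Q,P,J,I,F,E,G,H,D,B,C,A], Known T J
   [Q,P,I,J,F,E,G,H,D,B,C,A], Known P Q [G,H,B,C,A], Row H [cert30]]]]]]]]"

text \<open>\<open>P R\<close> is the triangle \<open>A B D\<close> with a pendant edge at
  \<open>A\<close>; by the degree condition its refutation excludes all triangles.
  \<open>P Q\<close> has a second pendant edge, at \<open>B\<close>. Inside it, \<open>M F\<close>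
  adds the 5-cycle \<open>A C H E B\<close> on the triangle edge \<open>A B\<close>, and
  \<open>P P\<close> is the remaining case.\<close>

definition cert32 :: "vertex cert" where
  "cert32 = Row A [Row A [Row A [Row B [Save P R (Row B [Save P Q (Row D [Row C [Row C [Row E [Save M F (Row E
   [Save M E (Row F [Save C V (Row F [cert3]), Save M D (Row F [Save M C (Row G [Save H K (Row G [Row H [Known
   C V [L,E,D,I,H,G,B,C,A]], cert8]), Save J W (Row G [Save J V (Row I [Save J U (Row I [Save J T (Row L [Known
   C V [I,B,D,L,E,G,A,H,C], Row L [cert11]])])])]), Save K G (Row G [Save K F (Row H [Save K E (Row I [Row I
   [Row L [Known C V [M,E,D,L,H,G,B,C,A], Row L [Row M [Known C V [I,H,G,M,E,D,C,B,A], Row M [Row J [Save K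
   C (Row J [Row K [Row Q [Row Q [Row R [Row U [Save K B (Row U [Save J X (Row W [Row X [], Row X []]), Save
   K A (Row X [Known J X [V,U,W,X,P,N,K,J,T,S,I,F,Q,R,M,E,D,L,H,G,B,C,A]]), Known K A
   [X,W,V,U,S,T,R,Q,P,N,M,L,K,J,I,H,G,F,E,D,C,B,A]]), Known K B
   [W,X,V,U,T,S,Q,R,P,N,M,L,K,J,I,H,G,F,E,D,C,B,A], Row U [], Row U [], Row U [], Row U []]]], Row Q [Row W
   []], Row Q [Row R []]]]]), Save K D (Row J [Row K [Row K [Row Q [Known K C
   [P,N,K,J,T,S,I,F,R,Q,M,E,D,L,H,G,B,C,A], Row R [], Row Q []]]]]), Row J [Row K [Known K D
   [T,S,R,Q,P,N,M,L,J,K,I,H,G,F,E,D,C,B,A], Row K [Row Q [Known K C [P,N,K,J,T,S,I,F,R,Q,M,E,D,L,H,G,B,C,A],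
   Known K D [P,N,K,J,T,S,I,F,R,Q,M,E,D,L,H,G,B,C,A]]]]]]]]]]]])])]), Row G [cert14]])])])]), Known M F
   [G,H,F,E,D,C,B,A], Save P P (Row E [Save P N (Row F [Known M F [J,I,C,F,A,E,D,B], Known M F
   [I,J,C,F,A,E,D,B], Known M F [H,G,E,F,B,C,D,A], Known M F [G,H,E,F,B,C,D,A], Save P M (Row F
   [cert18])])])]]]])]), Known P R [C,D,B,A], Row B [Row C [Known P R [D,B,C,A], Row C [Row D [Row D
   [cert31]]]]]]]]]"

lemmas certificate_defs =
  cert1_def cert2_def cert3_def cert4_def cert5_def cert6_def cert7_def cert8_def cert9_def cert10_def
  cert11_def cert12_def cert13_def cert14_def cert15_def cert16_def cert17_def cert18_def cert19_def
  cert20_def cert21_def cert22_def cert23_def cert24_def cert25_def cert26_def cert27_def cert28_def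
  cert29_def cert30_def cert31_def cert32_def

lemma check_certificate:
  "check cert32 [A] [B, C, D, E, F, G, H, I, J, K, L, M, N, P, Q, R, S, T, U, V, W, X] (blank []) (blank [])
    (blank (blank ([A], blank [A]))) \<noteq> None"
  \<comment> \<open>Lookups are \<open>vertex.case\<close>, and equality of names is decided by
    reflexivity and \<open>vertex.distinct\<close>. The run ends with the final store under
    \<open>Some\<close>, to which \<open>option.distinct\<close> applies.\<close>
  by (simp only: certificate_defs eval_simps nbrs_ok.simps hom_ok.simps few.simps mark.simps widen_vertex
      update_vertex blank_apply vertex.case vertex.distinct append.simps list.set insert_iff empty_iff
      option.distinct simp_thms)

section \<open>Cycles in digraphs\<close>

text \<open>A list of vertices is lifted to a walk by choosing one arc for each step. The tail of
  the vertex sequence is recorded because the library's \<open>cycle\<close> requires exactly that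
  tail to be distinct.\<close>

lemma (in wf_digraph) awalk_of_vertex_list:
  assumes "successively (dominates G) (u # ys)" and "last (u # ys) \<rightarrow>\<^bsub>G\<^esub> w"
  shows "\<exists>p. awalk u p w \<and> length p = Suc (length ys) \<and> tl (awalk_verts u p) = ys @ [w]"
  using assms
proof (induction ys arbitrary: u)
  case Nil
  then obtain a where "a \<in> arcs G" "tail G a = u" "head G a = w"
    by (auto simp: arcs_ends_conv)
  then show ?case by (intro exI[of _ "[a]"]) (auto simp: awalk_simps)
next
  case (Cons y ys)
  from Cons.prems(1) obtain a where a: "a \<in> arcs G" "tail G a = u" "head G a = y"
    by (auto simp: arcs_ends_conv)
  from Cons obtain p where p: "awalk y p w" "length p = Suc (length ys)" "tl (awalk_verts y p) = ys @ [w]"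
    by auto
  have "awalk_verts y p = y # ys @ [w]"
    using p(1,3) by (cases p) (auto simp: awalk_Cons_iff)
  with a p(1,2) show ?case by (intro exI[of _ "a # p"]) (auto simp: awalk_Cons_iff)
qed

lemma (in wf_digraph) has_cycle_of_lengthI:
  assumes "3 \<le> length ys" and "distinct ys" and "successively (dominates G) ys"
    and "last ys \<rightarrow>\<^bsub>G\<^esub> hd ys"
  shows "has_cycle_of_length G (length ys)"
proof -
  from assms(1) obtain u zs where ys: "ys = u # zs" by (cases ys) auto
  \<comment> \<open>The tail of the closed walk is \<open>zs @ [u]\<close>, a rotation of
    \<open>ys\<close>, so it is distinct as well.\<close>
  with assms awalk_of_vertex_list[of u zs u] obtain p
    where "awalk u p u" "length p = length ys" "tl (awalk_verts u p) = zs @ [u]"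
    by auto
  with assms(2) ys have "cycle p"
    unfolding cycle_def by (intro exI[of _ u]) auto
  with \<open>length p = length ys\<close> assms(1) show ?thesis
    unfolding has_cycle_of_length_def by blast
qed

hide_const (open) A B C D E F G H I J K L M N P Q R S T U V W X

theorem theorem2p1:
  fixes G :: "('a, 'b) pre_digraph"
  assumes "graph G"
    and "verts G \<noteq> {}"
    and "min_degree G \<ge> 3"
    and "card (verts G) \<le> 23"
  shows "has_cycle_of_length G 4 \<or> has_cycle_of_length G 8"
proof (rule ccontr)
  assume no: "\<not> ?thesis"
  interpret graph G by fact
  interpret counterexample "verts G" "dominates G"
  proof
    fix x y assume "x \<rightarrow>\<^bsub>G\<^esub> y"
    then show "y \<in> verts G" and "y \<rightarrow>\<^bsub>G\<^esub> x"
      using sym_arcs arcs_ends_symmetric by auto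
  next
    fix x show "\<not> x \<rightarrow>\<^bsub>G\<^esub> x"
      using no_loops by (auto simp: arcs_ends_conv)
  next
    fix x assume "x \<in> verts G"
    then have "3 \<le> out_degree G x"
      using assms(3) by (auto simp: min_degree_def intro: order_trans)
    \<comment> \<open>Without parallel arcs, distinct arcs leaving \<open>x\<close> have distinct
      heads, so counting arcs amounts to counting neighbours.\<close>
    also have "out_degree G x = card (head G ` out_arcs G x)"
      unfolding out_degree_def
      by (intro card_image[symmetric]) (auto intro!: inj_onI no_multi_arcs simp: arc_to_ends_def)
    also have "head G ` out_arcs G x = {y. x \<rightarrow>\<^bsub>G\<^esub> y}"
      by (auto simp: arcs_ends_conv)
    finally show "3 \<le> card {y. x \<rightarrow>\<^bsub>G\<^esub> y}" .
  next
    fix ys assume "length ys \<in> {4, 8}" "distinct ys" "successively (dominates G) ys"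
    then show "\<not> last ys \<rightarrow>\<^bsub>G\<^esub> hd ys"
      using has_cycle_of_lengthI[of ys] no by auto
  qed simp
  show False
    \<comment> \<open>The starting vertex and the 22 others of the certificate are 23 distinct
      names, which is where the bound on the number of vertices enters.\<close>
    by (rule notE[OF check_certificate no_certificate[OF assms(2)]]) (use assms(4) in simp_all)
qed

end
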